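(* Let $T\subset\mathbb{R}^3$ be a nondegenerate closed tetrahedron, $\varepsilon>0$, and let $\beta$, hence $\theta=\beta/\varepsilon$, be constant in $T$. Then $$\Pi^{k+1}_{\theta,T}\,J^k_\theta\,w=J^k_{\theta,T}\,\Pi^k_{\theta,T}\,w\quad\text{on }T,\qquad k=0,1,2,$$ for every $w\in C^\infty(T)$ if $k=0$, and every $w\in C^\infty(T;\mathbb{R}^3)$ if $k=1,2$.
   Context: Geometry: $T$ has vertices $x_1,\dots,x_4$; $E_{ij}$ ($i<j$) is the edge joining $x_i,x_j$, $t_{ij}=(x_j-x_i)/|x_j-x_i|$; $F_i$ is the facet opposite $x_i$ with unit outward normal $n_i$. For $x\in T$: $l_i:=x_i-x$, $\sigma_i:=\beta\cdot l_i$, $\sigma_{ij}:=\beta\cdot(x_j-x_i)$, and $T_m$ is the (possibly degenerate) tetrahedron with apex $x$ and base $F_m$, with volume $|T_m|$. Bernoulli functions: $$B_1^\varepsilon(a)=\frac{\varepsilon}{\int_0^1e^{ay/\varepsilon}dy},\quad B_2^\varepsilon(a,b)=\varepsilon\frac{\int_0^1e^{ay_1/\varepsilon}dy_1}{2\int_0^1\int_0^{1-y_2}e^{(ay_1+by_2)/\varepsilon}dy_1dy_2},$$ $$B_3^\varepsilon(a,b,c)=\varepsilon\frac{2\int_0^1\int_0^{1-y_2}e^{(ay_1+by_2)/\varepsilon}dy_1dy_2}{6\int_0^1\int_0^{1-y_3}\int_0^{1-y_2-y_3}e^{(ay_1+by_2+cy_3)/\varepsilon}dy_1dy_2dy_3}.$$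 Basis functions and discrete fluxes, defined at each $x\in T$ as unique solutions of linear systems: - $(j^V_i,\phi^V_i)\in\mathbb{R}^3\times\mathbb{R}$: $\ l_s\cdot j_i^V+B_1^\varepsilon(\sigma_s)\phi_i^V=B_1^\varepsilon(-\sigma_s)\delta_{is}$, $1\le s\le4$. - $(j^E_{ij},\phi^E_{ij})\in\mathbb{R}^3\times\mathbb{R}^3$, $i<j$: $\ j^E_{ij}\cdot\frac{l_s\times l_t}2-B_2^\varepsilon(\sigma_s,\sigma_t)\phi^E_{ij}\cdot l_s+B_2^\varepsilon(\sigma_t,\sigma_s)\phi^E_{ij}\cdot l_t=B_2^\varepsilon(\sigma_{st},-\sigma_s)\delta_{is}\delta_{jt}$, $1\le s<t\le4$. - $(j^F_i,\phi^F_i)\in\mathbb{R}\times\mathbb{R}^3$: for $m=1,\dots,4$, $\ |T_m|j_i^F+\big(B_3^\varepsilon(\sigma_p,\sigma_q,\sigma_r)\frac{l_p\times l_q}2+B_3^\varepsilon(\sigma_q,\sigma_r,\sigma_p)\frac{l_q\times l_r}2+B_3^\varepsilon(\sigma_r,\sigma_p,\sigma_q)\frac{l_r\times l_p}2\big)\cdot\phi_i^F=B_3^\varepsilon(\sigma_{pq},\sigma_{pr},-\sigma_p)\delta_{im}$, where $(p,q,r)$ is an ordering of $\{1,2,3,4\}\setminus\{m\}$ with $((x_q-x_p)\times(x_r-x_p))\cdot n_m>0$. - $\phi^T=1/|T|$. Spaces: $\mathcal{S}^0_{1^-}(T),\mathcal{S}^1_{1^-}(T),\mathcal{S}^2_{1^-}(T),\mathcal{S}^3_{1^-}(T)$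 are the spans of $\{\phi_i^V\},\{\phi_{ij}^E\},\{\phi_i^F\},\{\phi^T\}$. Degrees of freedom: $l_i^0(v)=v(x_i)$, $l_{ij}^1(v)=\int_{E_{ij}}v\cdot t_{ij}$, $l_i^2(v)=\int_{F_i}v\cdot n_i$, $l_T^3(v)=\int_Tv$. They are dual to the bases $\{\phi_i^V\}$, $\{\phi_{ij}^E\}$, $\{\phi_i^F\}$, $\{\phi^T\}$ respectively, i.e. $l_s^0(\phi_i^V)=\delta_{is}$, $l_{st}^1(\phi_{ij}^E)=\delta_{is}\delta_{jt}$, $l_s^2(\phi_i^F)=\delta_{is}$, $l_T^3(\phi^T)=1$. Fluxes: $J^0_\theta u=\varepsilon\nabla u+\beta u$, $J^1_\theta u=\varepsilon\nabla\times u+\beta\times u$, $J^2_\theta u=\varepsilon\nabla\cdot u+\beta\cdot u$. Discrete fluxes: $J^0_{\theta,T}v_h=\sum_il_i^0(v_h)j_i^V$, $J^1_{\theta,T}v_h=\sum_{i<j}l^1_{ij}(v_h)j_{ij}^E$, $J^2_{\theta,T}v_h=\sum_il_i^2(v_h)j_i^F$ for $v_h\in\mathcal{S}^k_{1^-}(T)$. Weighted interpolations, with $E_\theta(y)=\exp(\theta\cdot y)$ and $⟨E_\theta⟩_S=\frac1{|S|}\int_SE_\theta$: $$\Pi^0_{\theta,T}v=\sum_i\frac{l_i^0(E_\theta v)}{E_\theta(x_i)}\phi_i^V,\quad\Pi^1_{\theta,T}v=\sum_{i<j}\frac{l^1_{ij}(E_\theta v)}{⟨E_\theta⟩_{E_{ij}}}\phi^E_{ij},\quad\Pi^2_{\theta,T}v=\sum_i\frac{l_i^2(E_\theta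 v)}{⟨E_\theta⟩_{F_i}}\phi_i^F,\quad\Pi^3_{\theta,T}v=\frac{l_T^3(E_\theta v)}{⟨E_\theta⟩_T}\phi^T.$$ *)

theory Defs
  imports "HOL-Analysis.Analysis"
begin

unbundle cross3_syntax

text \<open>The vertices of the tetrahedron are the values \<open>x 1, x 2, x 3, x 4\<close> of a map
  \<open>x :: nat \<Rightarrow> real^3\<close>; its other values play no role. Throughout, \<open>y\<close> is the point of the
  tetrahedron at which the pointwise linear systems are posed, so that
  \<open>l\<^sub>s = x s - y\<close> and \<open>\<sigma>\<^sub>s = \<beta> \<bullet> (x s - y)\<close>. The infix \<open>\<times>\<close> is the cross product.\<close>

section \<open>Geometry\<close>

definition tetra :: "(nat \<Rightarrow> real^3) \<Rightarrow> (real^3) set" where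
  "tetra x = convex hull (x ` {1..4})"

definition nondegenerate :: "(nat \<Rightarrow> real^3) \<Rightarrow> bool" where
  "nondegenerate x \<longleftrightarrow> inj_on x {1..4} \<and> \<not> affine_dependent (x ` {1..4})"

definition tangent :: "(nat \<Rightarrow> real^3) \<Rightarrow> nat \<Rightarrow> nat \<Rightarrow> real^3" where
  "tangent x i j = (x j - x i) /\<^sub>R norm (x j - x i)"

definition normal :: "(nat \<Rightarrow> real^3) \<Rightarrow> nat \<Rightarrow> real^3" where
  "normal x m = (THE n. norm n = 1
      \<and> (\<forall>p \<in> {1..4} - {m}. \<forall>q \<in> {1..4} - {m}. n \<bullet> (x q - x p) = 0)
      \<and> (\<forall>p \<in> {1..4} - {m}. n \<bullet> (x p - x m) > 0))"

definition subtetra :: "(nat \<Rightarrow> real^3) \<Rightarrow> real^3 \<Rightarrow> nat \<Rightarrow> (real^3) set" where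
  "subtetra x y m = convex hull (insert y (x ` ({1..4} - {m})))"

definition volume :: "(real^3) set \<Rightarrow> real" where
  "volume S = measure lebesgue S"

text \<open>\<open>skip m k\<close> is the \<open>k\<close>-th smallest index different from \<open>m\<close>, so the facet opposite
  \<open>x m\<close> has vertices \<open>x (skip m 1), x (skip m 2), x (skip m 3)\<close>.\<close>

definition skip :: "nat \<Rightarrow> nat \<Rightarrow> nat" where
  "skip m k = (if k < m then k else Suc k)"

text \<open>Line and surface integrals, written out in the affine parametrisation of a segment and
  of a triangle (the Jacobian of the latter being twice its area).\<close>

definition segment_integral :: "real^3 \<Rightarrow> real^3 \<Rightarrow> (real^3 \<Rightarrow> real) \<Rightarrow> real" where
  "segment_integral a b f = norm (b - a) * integral {0..1} (\<lambda>s. f (a + s *\<^sub>R (b - a)))"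

definition triangle_integral :: "real^3 \<Rightarrow> real^3 \<Rightarrow> real^3 \<Rightarrow> (real^3 \<Rightarrow> real) \<Rightarrow> real" where
  "triangle_integral a b c f = norm ((b - a) \<times> (c - a)) *
     integral {0..1} (\<lambda>t. integral {0..1 - t} (\<lambda>s. f (a + s *\<^sub>R (b - a) + t *\<^sub>R (c - a))))"

definition edge_integral :: "(nat \<Rightarrow> real^3) \<Rightarrow> nat \<Rightarrow> nat \<Rightarrow> (real^3 \<Rightarrow> real) \<Rightarrow> real" where
  "edge_integral x i j f = segment_integral (x i) (x j) f"

definition facet_integral :: "(nat \<Rightarrow> real^3) \<Rightarrow> nat \<Rightarrow> (real^3 \<Rightarrow> real) \<Rightarrow> real" where
  "facet_integral x m f =
     triangle_integral (x (skip m 1)) (x (skip m 2)) (x (skip m 3)) f"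

definition edge_length :: "(nat \<Rightarrow> real^3) \<Rightarrow> nat \<Rightarrow> nat \<Rightarrow> real" where
  "edge_length x i j = norm (x j - x i)"

definition facet_area :: "(nat \<Rightarrow> real^3) \<Rightarrow> nat \<Rightarrow> real" where
  "facet_area x m =
     norm ((x (skip m 2) - x (skip m 1)) \<times> (x (skip m 3) - x (skip m 1))) / 2"

section \<open>Smooth functions on a closed set and the fluxes\<close>

text \<open>\<open>smooth_on S f\<close>: all iterated directional derivatives of \<open>f\<close> exist, relative to \<open>S\<close>,
  and are continuous on \<open>S\<close>. For a closed convex body \<open>S\<close> derivatives within \<open>S\<close> are unique at
  every point of \<open>S\<close>, boundary included, and this is the usual space of functions smooth up to
  the boundary.\<close>

primrec Ck_on ::
  "nat \<Rightarrow> (real^3) set \<Rightarrow> (real^3 \<Rightarrow> 'b::real_normed_vector) \<Rightarrow> bool" where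
  "Ck_on 0 S f \<longleftrightarrow> continuous_on S f"
| "Ck_on (Suc k) S f \<longleftrightarrow> f differentiable_on S \<and>
     (\<forall>v. Ck_on k S (\<lambda>y. frechet_derivative f (at y within S) v))"

definition smooth_on :: "(real^3) set \<Rightarrow> (real^3 \<Rightarrow> 'b::real_normed_vector) \<Rightarrow> bool" where
  "smooth_on S f \<longleftrightarrow> (\<forall>k. Ck_on k S f)"

definition grad_on :: "(real^3) set \<Rightarrow> (real^3 \<Rightarrow> real) \<Rightarrow> real^3 \<Rightarrow> real^3" where
  "grad_on S u y = (\<chi> i. frechet_derivative u (at y within S) (axis i 1))"

text \<open>Recall that \<open>jacobian u net $ i $ j\<close> is the \<open>j\<close>-th partial derivative of the \<open>i\<close>-th
  component of \<open>u\<close>.\<close>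

definition curl_on :: "(real^3) set \<Rightarrow> (real^3 \<Rightarrow> real^3) \<Rightarrow> real^3 \<Rightarrow> real^3" where
  "curl_on S u y = (let D = jacobian u (at y within S) in
     vector [D$3$2 - D$2$3, D$1$3 - D$3$1, D$2$1 - D$1$2])"

definition div_on :: "(real^3) set \<Rightarrow> (real^3 \<Rightarrow> real^3) \<Rightarrow> real^3 \<Rightarrow> real" where
  "div_on S u y = trace (jacobian u (at y within S))"

definition flux0 ::
  "(nat \<Rightarrow> real^3) \<Rightarrow> real \<Rightarrow> real^3 \<Rightarrow> (real^3 \<Rightarrow> real) \<Rightarrow> real^3 \<Rightarrow> real^3" where
  "flux0 x \<epsilon> \<beta> u y = \<epsilon> *\<^sub>R grad_on (tetra x) u y + u y *\<^sub>R \<beta>"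

definition flux1 ::
  "(nat \<Rightarrow> real^3) \<Rightarrow> real \<Rightarrow> real^3 \<Rightarrow> (real^3 \<Rightarrow> real^3) \<Rightarrow> real^3 \<Rightarrow> real^3" where
  "flux1 x \<epsilon> \<beta> u y = \<epsilon> *\<^sub>R curl_on (tetra x) u y + \<beta> \<times> u y"

definition flux2 ::
  "(nat \<Rightarrow> real^3) \<Rightarrow> real \<Rightarrow> real^3 \<Rightarrow> (real^3 \<Rightarrow> real^3) \<Rightarrow> real^3 \<Rightarrow> real" where
  "flux2 x \<epsilon> \<beta> u y = \<epsilon> * div_on (tetra x) u y + \<beta> \<bullet> u y"

section \<open>Bernoulli functions\<close>

definition exp_int1 :: "real \<Rightarrow> real \<Rightarrow> real" where
  "exp_int1 \<epsilon> a = integral {0..1} (\<lambda>y. exp (a * y / \<epsilon>))"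

definition exp_int2 :: "real \<Rightarrow> real \<Rightarrow> real \<Rightarrow> real" where
  "exp_int2 \<epsilon> a b = integral {0..1} (\<lambda>y2. integral {0..1 - y2} (\<lambda>y1.
     exp ((a * y1 + b * y2) / \<epsilon>)))"

definition exp_int3 :: "real \<Rightarrow> real \<Rightarrow> real \<Rightarrow> real \<Rightarrow> real" where
  "exp_int3 \<epsilon> a b c = integral {0..1} (\<lambda>y3. integral {0..1 - y3} (\<lambda>y2.
     integral {0..1 - y2 - y3} (\<lambda>y1. exp ((a * y1 + b * y2 + c * y3) / \<epsilon>))))"

definition B1 :: "real \<Rightarrow> real \<Rightarrow> real" where
  "B1 \<epsilon> a = \<epsilon> / exp_int1 \<epsilon> a"

definition B2 :: "real \<Rightarrow> real \<Rightarrow> real \<Rightarrow> real" where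
  "B2 \<epsilon> a b = \<epsilon> * (exp_int1 \<epsilon> a / (2 * exp_int2 \<epsilon> a b))"

definition B3 :: "real \<Rightarrow> real \<Rightarrow> real \<Rightarrow> real \<Rightarrow> real" where
  "B3 \<epsilon> a b c = \<epsilon> * ((2 * exp_int2 \<epsilon> a b) / (6 * exp_int3 \<epsilon> a b c))"

section \<open>Basis functions and discrete fluxes\<close>

text \<open>Each of the following predicates is the linear system at the point \<open>y\<close> for the pair
  (discrete flux, basis function); the pair is then its unique solution.\<close>

definition vertex_system ::
  "(nat \<Rightarrow> real^3) \<Rightarrow> real \<Rightarrow> real^3 \<Rightarrow> nat \<Rightarrow> real^3 \<Rightarrow> real^3 \<Rightarrow> real \<Rightarrow> bool" where
  "vertex_system x \<epsilon> \<beta> i y j \<phi> \<longleftrightarrow>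
     (let l = (\<lambda>s. x s - y); \<sigma> = (\<lambda>s. \<beta> \<bullet> (x s - y)) in
      \<forall>s\<in>{1..4}. l s \<bullet> j + B1 \<epsilon> (\<sigma> s) * \<phi> = B1 \<epsilon> (- \<sigma> s) * of_bool (i = s))"

definition edge_system ::
  "(nat \<Rightarrow> real^3) \<Rightarrow> real \<Rightarrow> real^3 \<Rightarrow> nat \<Rightarrow> nat \<Rightarrow> real^3 \<Rightarrow> real^3 \<Rightarrow> real^3 \<Rightarrow> bool" where
  "edge_system x \<epsilon> \<beta> i k y j \<phi> \<longleftrightarrow>
     (let l = (\<lambda>s. x s - y); \<sigma> = (\<lambda>s. \<beta> \<bullet> (x s - y)); \<sigma>2 = (\<lambda>s t. \<beta> \<bullet> (x t - x s)) in
      \<forall>s\<in>{1..4}. \<forall>t\<in>{s<..4}.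
        j \<bullet> ((l s \<times> l t) /\<^sub>R 2)
          - B2 \<epsilon> (\<sigma> s) (\<sigma> t) * (\<phi> \<bullet> l s) + B2 \<epsilon> (\<sigma> t) (\<sigma> s) * (\<phi> \<bullet> l t)
        = B2 \<epsilon> (\<sigma>2 s t) (- \<sigma> s) * of_bool (i = s) * of_bool (k = t))"

text \<open>Both sides of the \<open>m\<close>-th equation below are invariant under cyclic permutations of
  \<open>(p, q, r)\<close>, so it does not matter which positively oriented ordering is used; we demand the
  equation for all of them.\<close>

definition facet_system ::
  "(nat \<Rightarrow> real^3) \<Rightarrow> real \<Rightarrow> real^3 \<Rightarrow> nat \<Rightarrow> real^3 \<Rightarrow> real \<Rightarrow> real^3 \<Rightarrow> bool" where
  "facet_system x \<epsilon> \<beta> i y j \<phi> \<longleftrightarrow>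
     (let l = (\<lambda>s. x s - y); \<sigma> = (\<lambda>s. \<beta> \<bullet> (x s - y)); \<sigma>2 = (\<lambda>s t. \<beta> \<bullet> (x t - x s)) in
      \<forall>m\<in>{1..4}. \<forall>p q r. {p, q, r} = {1..4} - {m} \<longrightarrow>
        ((x q - x p) \<times> (x r - x p)) \<bullet> normal x m > 0 \<longrightarrow>
        volume (subtetra x y m) * j
          + (B3 \<epsilon> (\<sigma> p) (\<sigma> q) (\<sigma> r) *\<^sub>R ((l p \<times> l q) /\<^sub>R 2)
           + B3 \<epsilon> (\<sigma> q) (\<sigma> r) (\<sigma> p) *\<^sub>R ((l q \<times> l r) /\<^sub>R 2)
           + B3 \<epsilon> (\<sigma> r) (\<sigma> p) (\<sigma> q) *\<^sub>R ((l r \<times> l p) /\<^sub>R 2)) \<bullet> \<phi>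
        = B3 \<epsilon> (\<sigma>2 p q) (\<sigma>2 p r) (- \<sigma> p) * of_bool (i = m))"

definition jV :: "(nat \<Rightarrow> real^3) \<Rightarrow> real \<Rightarrow> real^3 \<Rightarrow> nat \<Rightarrow> real^3 \<Rightarrow> real^3" where
  "jV x \<epsilon> \<beta> i y = fst (THE (j, \<phi>). vertex_system x \<epsilon> \<beta> i y j \<phi>)"

definition phiV :: "(nat \<Rightarrow> real^3) \<Rightarrow> real \<Rightarrow> real^3 \<Rightarrow> nat \<Rightarrow> real^3 \<Rightarrow> real" where
  "phiV x \<epsilon> \<beta> i y = snd (THE (j, \<phi>). vertex_system x \<epsilon> \<beta> i y j \<phi>)"

definition jE :: "(nat \<Rightarrow> real^3) \<Rightarrow> real \<Rightarrow> real^3 \<Rightarrow> nat \<Rightarrow> nat \<Rightarrow> real^3 \<Rightarrow> real^3" where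
  "jE x \<epsilon> \<beta> i k y = fst (THE (j, \<phi>). edge_system x \<epsilon> \<beta> i k y j \<phi>)"

definition phiE :: "(nat \<Rightarrow> real^3) \<Rightarrow> real \<Rightarrow> real^3 \<Rightarrow> nat \<Rightarrow> nat \<Rightarrow> real^3 \<Rightarrow> real^3" where
  "phiE x \<epsilon> \<beta> i k y = snd (THE (j, \<phi>). edge_system x \<epsilon> \<beta> i k y j \<phi>)"

definition jF :: "(nat \<Rightarrow> real^3) \<Rightarrow> real \<Rightarrow> real^3 \<Rightarrow> nat \<Rightarrow> real^3 \<Rightarrow> real" where
  "jF x \<epsilon> \<beta> i y = fst (THE (j, \<phi>). facet_system x \<epsilon> \<beta> i y j \<phi>)"

definition phiF :: "(nat \<Rightarrow> real^3) \<Rightarrow> real \<Rightarrow> real^3 \<Rightarrow> nat \<Rightarrow> real^3 \<Rightarrow> real^3" where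
  "phiF x \<epsilon> \<beta> i y = snd (THE (j, \<phi>). facet_system x \<epsilon> \<beta> i y j \<phi>)"

definition phiT :: "(nat \<Rightarrow> real^3) \<Rightarrow> real^3 \<Rightarrow> real" where
  "phiT x y = 1 / volume (tetra x)"

section \<open>Degrees of freedom\<close>

definition dof0 :: "(nat \<Rightarrow> real^3) \<Rightarrow> nat \<Rightarrow> (real^3 \<Rightarrow> real) \<Rightarrow> real" where
  "dof0 x i v = v (x i)"

definition dof1 :: "(nat \<Rightarrow> real^3) \<Rightarrow> nat \<Rightarrow> nat \<Rightarrow> (real^3 \<Rightarrow> real^3) \<Rightarrow> real" where
  "dof1 x i j v = edge_integral x i j (\<lambda>y. v y \<bullet> tangent x i j)"

definition dof2 :: "(nat \<Rightarrow> real^3) \<Rightarrow> nat \<Rightarrow> (real^3 \<Rightarrow> real^3) \<Rightarrow> real" where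
  "dof2 x i v = facet_integral x i (\<lambda>y. v y \<bullet> normal x i)"

definition dof3 :: "(nat \<Rightarrow> real^3) \<Rightarrow> (real^3 \<Rightarrow> real) \<Rightarrow> real" where
  "dof3 x v = integral (tetra x) v"

section \<open>Discrete fluxes of functions\<close>

text \<open>These are meant for functions in the span of the corresponding basis functions; the
  defining formulas make sense for arbitrary functions.\<close>

definition dflux0 ::
  "(nat \<Rightarrow> real^3) \<Rightarrow> real \<Rightarrow> real^3 \<Rightarrow> (real^3 \<Rightarrow> real) \<Rightarrow> real^3 \<Rightarrow> real^3" where
  "dflux0 x \<epsilon> \<beta> v y = (\<Sum>i\<in>{1..4}. dof0 x i v *\<^sub>R jV x \<epsilon> \<beta> i y)"

definition dflux1 ::
  "(nat \<Rightarrow> real^3) \<Rightarrow> real \<Rightarrow> real^3 \<Rightarrow> (real^3 \<Rightarrow> real^3) \<Rightarrow> real^3 \<Rightarrow> real^3" where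
  "dflux1 x \<epsilon> \<beta> v y = (\<Sum>i\<in>{1..4}. \<Sum>j\<in>{i<..4}. dof1 x i j v *\<^sub>R jE x \<epsilon> \<beta> i j y)"

definition dflux2 ::
  "(nat \<Rightarrow> real^3) \<Rightarrow> real \<Rightarrow> real^3 \<Rightarrow> (real^3 \<Rightarrow> real^3) \<Rightarrow> real^3 \<Rightarrow> real" where
  "dflux2 x \<epsilon> \<beta> v y = (\<Sum>i\<in>{1..4}. dof2 x i v * jF x \<epsilon> \<beta> i y)"

section \<open>Weighted interpolations\<close>

text \<open>The weight is \<open>exp (\<theta> \<bullet> y)\<close> with \<open>\<theta> = \<beta> / \<epsilon>\<close>.\<close>

definition wt :: "real \<Rightarrow> real^3 \<Rightarrow> real^3 \<Rightarrow> real" where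
  "wt \<epsilon> \<beta> y = exp ((\<beta> /\<^sub>R \<epsilon>) \<bullet> y)"

definition interp0 ::
  "(nat \<Rightarrow> real^3) \<Rightarrow> real \<Rightarrow> real^3 \<Rightarrow> (real^3 \<Rightarrow> real) \<Rightarrow> real^3 \<Rightarrow> real" where
  "interp0 x \<epsilon> \<beta> v y =
     (\<Sum>i\<in>{1..4}. dof0 x i (\<lambda>z. wt \<epsilon> \<beta> z * v z) / wt \<epsilon> \<beta> (x i) * phiV x \<epsilon> \<beta> i y)"

definition interp1 ::
  "(nat \<Rightarrow> real^3) \<Rightarrow> real \<Rightarrow> real^3 \<Rightarrow> (real^3 \<Rightarrow> real^3) \<Rightarrow> real^3 \<Rightarrow> real^3" where
  "interp1 x \<epsilon> \<beta> v y =
     (\<Sum>i\<in>{1..4}. \<Sum>j\<in>{i<..4}. (dof1 x i j (\<lambda>z. wt \<epsilon> \<beta> z *\<^sub>R v z)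
        / (edge_integral x i j (wt \<epsilon> \<beta>) / edge_length x i j)) *\<^sub>R phiE x \<epsilon> \<beta> i j y)"

definition interp2 ::
  "(nat \<Rightarrow> real^3) \<Rightarrow> real \<Rightarrow> real^3 \<Rightarrow> (real^3 \<Rightarrow> real^3) \<Rightarrow> real^3 \<Rightarrow> real^3" where
  "interp2 x \<epsilon> \<beta> v y =
     (\<Sum>i\<in>{1..4}. (dof2 x i (\<lambda>z. wt \<epsilon> \<beta> z *\<^sub>R v z)
        / (facet_integral x i (wt \<epsilon> \<beta>) / facet_area x i)) *\<^sub>R phiF x \<epsilon> \<beta> i y)"

definition interp3 ::
  "(nat \<Rightarrow> real^3) \<Rightarrow> real \<Rightarrow> real^3 \<Rightarrow> (real^3 \<Rightarrow> real) \<Rightarrow> real^3 \<Rightarrow> real" where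
  "interp3 x \<epsilon> \<beta> v y = dof3 x (\<lambda>z. wt \<epsilon> \<beta> z * v z)
     / (integral (tetra x) (wt \<epsilon> \<beta>) / volume (tetra x)) * phiT x y"

end

theory Submission
  imports Defs
begin

text \<open>Let \<open>E\<close> be the weight, \<open>\<theta> = \<beta> / \<epsilon>\<close>, and let \<open>E1, E2, E3\<close> denote its integrals over the
  segment, triangle or tetrahedron with given vertices, in affine parametrisation. They are symmetric
  in the vertices, and the Bernoulli functions are quotients of them: for example
  \<open>B2 \<epsilon> (\<sigma> s) (\<sigma> t) = \<epsilon> E1(y, x s) / (2 E2(y, x s, x t))\<close>. Clearing denominators, the systems at \<open>y\<close> with
  data \<open>d\<close> become
  \<open>E1(y, x s) (l s \<bullet> j) + \<epsilon> E(y) \<phi> = \<epsilon> E(x s) d s\<close>,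
  \<open>E2(y, x s, x t) (j \<bullet> (l s \<times> l t)) + \<epsilon> (E1(y, x t) (\<phi> \<bullet> l t) - E1(y, x s) (\<phi> \<bullet> l s)) = \<epsilon> E1(x s, x t) d s t\<close>
  and an analogous one for facets. In this form the flux part of a solution of one system inserted as
  the function part of the next telescopes, and it solves that system (with zero flux) for data
  given by differences, respectively oriented sums, of the weighted degrees of freedom. By Stokes'
  theorem and \<open>E J w = \<epsilon> d (E w)\<close> these data are the coefficients of the interpolated flux. For \<open>k = 2\<close>
  one adds up the four facet equations instead, whereupon \<open>\<phi>\<close> drops out.

  Unique solvability reduces to the recurrence
  \<open>(\<theta> \<bullet> (p - y)) E3(y, p, q, r) = E2(p, q, r) - E2(y, q, r)\<close> and a sign argument based on barycentric
  coordinates; the same recurrence gives the duality of the degrees of freedom.\<close>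

section \<open>Affine integrals over segments, triangles and tetrahedra\<close>

text \<open>The substitution \<open>r = k z * u\<close> moves the variable upper limit into the
  integrand, leaving a parameter integral over the fixed interval [0,1].\<close>

lemma continuous_on_integral_upper:
  fixes h :: "'a::topological_space \<Rightarrow> real \<Rightarrow> real"
  assumes h: "continuous_on {(z, r). z \<in> Z \<and> 0 \<le> r \<and> r \<le> k z} (\<lambda>(z, r). h z r)"
    and k: "continuous_on Z k" "\<And>z. z \<in> Z \<Longrightarrow> 0 \<le> k z"
  shows "continuous_on Z (\<lambda>z. integral {0..k z} (h z))"
proof -
  have eq: "integral {0..k z} (h z) = k z * integral (cbox 0 1) (\<lambda>u. h z (k z * u))"
    if z: "z \<in> Z" for z
  \<comment> \<open>The substitution is invertible only for a positive limit; at limit 0 both sides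
    are 0.\<close>
  proof (cases "k z = 0")
    case False
    with k z have pos: "k z > 0" by (simp add: order_less_le)
    have "continuous_on {0..k z} (\<lambda>r. h z r)"
      using continuous_on_compose2[OF h, of "{0..k z}" "\<lambda>r. (z, r)"] z
        continuous_on_Pair[OF continuous_on_const continuous_on_id, of "{0..k z}" z]
      by (auto simp: image_subset_iff)
    then have "(h z has_integral integral {0..k z} (h z)) (cbox 0 (k z))"
      by (simp add: integrable_continuous_real integrable_integral)
    from has_integral_affinity[OF this, of "k z" 0] pos
    have "((\<lambda>u. h z (k z * u)) has_integral integral {0..k z} (h z) / k z) (cbox 0 1)"
      by (simp add: image_mult_atLeastAtMost divide_simps)
    then have "integral (cbox 0 1) (\<lambda>u. h z (k z * u)) = integral {0..k z} (h z) / k z"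
      by (rule integral_unique)
    then show ?thesis using pos by simp
  qed simp
  have "continuous_on (Sigma Z (\<lambda>_. cbox 0 1)) (\<lambda>(z, u). h z (k z * u))"
  proof -
    have "continuous_on (Sigma Z (\<lambda>_. cbox 0 1)) (\<lambda>p. k (fst p))"
      by (rule continuous_on_compose2[OF k(1)]) (auto intro!: continuous_intros)
    then have "continuous_on (Sigma Z (\<lambda>_. cbox 0 1)) (\<lambda>p. (fst p, k (fst p) * snd p))"
      by (intro continuous_intros)
    from continuous_on_compose2[OF h this] show ?thesis
      using k(2) by (force simp: case_prod_unfold intro: mult_left_le)
  qed
  then have "continuous_on Z (\<lambda>z. k z * integral (cbox 0 1) (\<lambda>u. h z (k z * u)))"
    by (intro continuous_intros k(1) integral_continuous_on_param)
  then show ?thesis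
    by (rule continuous_on_eq) (simp add: eq)
qed

lemma continuous_on_integral_inner_triangle:
  fixes h :: "real \<Rightarrow> real \<Rightarrow> real"
  assumes h: "continuous_on {(s, t). 0 \<le> s \<and> 0 \<le> t \<and> s + t \<le> c} (\<lambda>(s, t). h s t)"
  shows "continuous_on {0..c} (\<lambda>t. integral {0..c - t} (\<lambda>s. h s t))"
proof (rule continuous_on_integral_upper)
  have "continuous_on {(t, s). t \<in> {0..c} \<and> 0 \<le> s \<and> s \<le> c - t} (\<lambda>p. (snd p, fst p))"
    by (intro continuous_intros)
  from continuous_on_compose2[OF h this]
  show "continuous_on {(t, s). t \<in> {0..c} \<and> 0 \<le> s \<and> s \<le> c - t} (\<lambda>(t, s). h s t)"
    by (force simp: case_prod_unfold)
qed (auto intro!: continuous_intros)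

text \<open>Bridges two kinds of integral: Fubini is applied to the Bochner integral of the function
  extended by zero off the triangle, while the affine integrals are iterated gauge
  integrals.\<close>

lemma lborel_integral_triangle:
  fixes h :: "real \<Rightarrow> real \<Rightarrow> real"
  assumes h: "continuous_on {(s, t). 0 \<le> s \<and> 0 \<le> t \<and> s + t \<le> c} (\<lambda>(s, t). h s t)"
  shows "(\<integral>t. (\<integral>s. indicator {(s, t). 0 \<le> s \<and> 0 \<le> t \<and> s + t \<le> c} (s, t) *\<^sub>R h s t \<partial>lborel) \<partial>lborel) =
      integral {0..c} (\<lambda>t. integral {0..c - t} (\<lambda>s. h s t))"
    (is "(\<integral>t. (\<integral>s. indicator ?S _ *\<^sub>R _ \<partial>lborel) \<partial>lborel) = _")
proof -
  have inner: "(\<integral>s. indicator ?S (s, t) *\<^sub>R h s t \<partial>lborel) =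
      indicator {0..c} t *\<^sub>R integral {0..c - t} (\<lambda>s. h s t)" for t
  proof (cases "t \<in> {0..c}")
    case True
    have ind: "indicator ?S (s, t) = (indicator {0..c - t} s :: real)" for s
      using True by (auto simp: indicator_def)
    have "continuous_on {0..c - t} (\<lambda>s. h s t)"
      using continuous_on_compose2[OF h, of "{0..c - t}" "\<lambda>s. (s, t)"] True
      by (force intro!: continuous_intros)
    from set_borel_integral_eq_integral(2)[OF borel_integrable_atLeastAtMost'[OF this]] True
    show ?thesis unfolding ind by (simp add: set_lebesgue_integral_def)
  next
    case False
    then have "indicator ?S (s, t) = (0::real)" for s
      by (auto simp: indicator_def)
    with False show ?thesis by simp
  qed
  from set_borel_integral_eq_integral(2)[OF borel_integrable_atLeastAtMost'[OF
      continuous_on_integral_inner_triangle[OF h]]]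
  show ?thesis unfolding inner by (simp add: set_lebesgue_integral_def)
qed

lemma compact_triangle: "compact {(s, t). 0 \<le> s \<and> 0 \<le> t \<and> s + t \<le> (c::real)}" (is "compact ?S")
proof -
  have "closed ?S"
    unfolding case_prod_unfold by (intro closed_Collect_conj closed_Collect_le continuous_intros)
  moreover have "?S \<subseteq> cbox (0, 0) (c, c)" by (auto simp: mem_box Basis_prod_def)
  ultimately show ?thesis
    using bounded_subset[OF bounded_cbox] by (simp add: compact_eq_bounded_closed)
qed

text \<open>By Fubini both sides are the integral over the same triangle, which the exchange of
  coordinates maps to itself.\<close>

lemma integral_triangle_swap:
  fixes h :: "real \<Rightarrow> real \<Rightarrow> real"
  assumes h: "continuous_on {(s, t). 0 \<le> s \<and> 0 \<le> t \<and> s + t \<le> c} (\<lambda>(s, t). h s t)"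
  shows "integral {0..c} (\<lambda>t. integral {0..c - t} (\<lambda>s. h s t)) =
         integral {0..c} (\<lambda>s. integral {0..c - s} (\<lambda>t. h s t))"
proof -
  let ?S = "{(s, t). 0 \<le> s \<and> 0 \<le> t \<and> s + t \<le> c}"
  from borel_integrable_compact[OF compact_triangle h]
  have int: "integrable (lborel \<Otimes>\<^sub>M lborel) (\<lambda>(s, t). indicator ?S (s, t) *\<^sub>R h s t)"
    by (simp add: lborel_prod case_prod_unfold)
  have h': "continuous_on ?S (\<lambda>(s, t). h t s)"
  proof -
    have "continuous_on ?S (\<lambda>p. (snd p, fst p))" by (intro continuous_intros)
    from continuous_on_compose2[OF h this] show ?thesis
      by (force simp: case_prod_unfold)
  qed
  have "integral {0..c} (\<lambda>t. integral {0..c - t} (\<lambda>s. h s t)) =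
      (\<integral>s. (\<integral>t. indicator ?S (s, t) *\<^sub>R h s t \<partial>lborel) \<partial>lborel)"
    using lborel_integral_triangle[OF h] lborel_pair.Fubini_integral[OF int] by simp
  also have "\<dots> = (\<integral>s. (\<integral>t. indicator ?S (t, s) *\<^sub>R h s t \<partial>lborel) \<partial>lborel)"
    by (simp add: indicator_def add.commute conj_commute conj_left_commute)
  also have "\<dots> = integral {0..c} (\<lambda>s. integral {0..c - s} (\<lambda>t. h s t))"
    by (rule lborel_integral_triangle[OF h'])
  finally show ?thesis .
qed

lemma integral_triangle_add:
  fixes g h :: "real \<Rightarrow> real \<Rightarrow> real"
  assumes g: "continuous_on {(s, t). 0 \<le> s \<and> 0 \<le> t \<and> s + t \<le> c} (\<lambda>(s, t). g s t)"
    and h: "continuous_on {(s, t). 0 \<le> s \<and> 0 \<le> t \<and> s + t \<le> c} (\<lambda>(s, t). h s t)"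
  shows "integral {0..c} (\<lambda>t. integral {0..c - t} (\<lambda>s. g s t + h s t)) =
         integral {0..c} (\<lambda>t. integral {0..c - t} (\<lambda>s. g s t)) +
         integral {0..c} (\<lambda>t. integral {0..c - t} (\<lambda>s. h s t))"
proof -
  have int: "(\<lambda>s. k s t) integrable_on {0..c - t}"
    if "continuous_on {(s, t). 0 \<le> s \<and> 0 \<le> t \<and> s + t \<le> c} (\<lambda>(s, t). k s t)" "t \<in> {0..c}"
    for k :: "real \<Rightarrow> real \<Rightarrow> real" and t
  proof (rule integrable_continuous_real)
    have "continuous_on {0..c - t} (\<lambda>s. (s, t))" by (intro continuous_intros)
    from continuous_on_compose2[OF that(1) this] that(2)
    show "continuous_on {0..c - t} (\<lambda>s. k s t)" by force
  qed
  have "integral {0..c} (\<lambda>t. integral {0..c - t} (\<lambda>s. g s t + h s t)) =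
      integral {0..c} (\<lambda>t. integral {0..c - t} (\<lambda>s. g s t) + integral {0..c - t} (\<lambda>s. h s t))"
    by (intro integral_cong Henstock_Kurzweil_Integration.integral_add int g h)
  also have "\<dots> = integral {0..c} (\<lambda>t. integral {0..c - t} (\<lambda>s. g s t)) +
         integral {0..c} (\<lambda>t. integral {0..c - t} (\<lambda>s. h s t))"
    by (intro Henstock_Kurzweil_Integration.integral_add integrable_continuous_real
        continuous_on_integral_inner_triangle g h)
  finally show ?thesis .
qed

lemma integral_triangle_diff:
  fixes g h :: "real \<Rightarrow> real \<Rightarrow> real"
  assumes g: "continuous_on {(s, t). 0 \<le> s \<and> 0 \<le> t \<and> s + t \<le> c} (\<lambda>(s, t). g s t)"
    and h: "continuous_on {(s, t). 0 \<le> s \<and> 0 \<le> t \<and> s + t \<le> c} (\<lambda>(s, t). h s t)"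
  shows "integral {0..c} (\<lambda>t. integral {0..c - t} (\<lambda>s. g s t - h s t)) =
         integral {0..c} (\<lambda>t. integral {0..c - t} (\<lambda>s. g s t)) -
         integral {0..c} (\<lambda>t. integral {0..c - t} (\<lambda>s. h s t))"
  using integral_triangle_add[OF g, of "\<lambda>s t. - h s t"] continuous_on_minus[OF h]
  by (simp add: case_prod_unfold)

text \<open>Reflection is an involution, so it preserves non-integrability as well as integrability;
  in the non-integrable case both integrals have the default value 0.\<close>

lemma integral_reflect_upper:
  fixes f :: "real \<Rightarrow> real"
  shows "integral {0..k} (\<lambda>r. f (k - r)) = integral {0..k} f"
proof -
  have *: "((\<lambda>r. f (k - r)) has_integral i) {0..k}" if "(f has_integral i) {0..k}" for f :: "real \<Rightarrow> real" and i
  proof -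
    have "(\<lambda>x. - x + k) ` {0..k} = {0..k}"
      by (auto simp: image_iff intro: bexI[of _ "k - x" for x])
    then show ?thesis
      using has_integral_affinity[of f i 0 k "-1" k] that by (simp add: add.commute)
  qed
  show ?thesis
  proof (cases "f integrable_on {0..k}")
    case True
    then show ?thesis using * integrable_integral integral_unique by blast
  next
    case False
    have "\<not> (\<lambda>r. f (k - r)) integrable_on {0..k}"
      using *[of "\<lambda>r. f (k - r)"] False unfolding integrable_on_def by auto
    with False show ?thesis by (simp add: not_integrable_integral)
  qed
qed

section \<open>Affine integrals and their symmetry in the vertices\<close>

definition seg_int :: "(real^3 \<Rightarrow> real) \<Rightarrow> real^3 \<Rightarrow> real^3 \<Rightarrow> real" where
  "seg_int f a b = integral {0..1} (\<lambda>s. f (a + s *\<^sub>R (b - a)))"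

text \<open>Like its companions, it omits the Jacobian (here twice the area). It therefore stays
  meaningful, and positive for a positive integrand, when the vertices degenerate, as happens for an
  apex \<open>y\<close> on the boundary of the tetrahedron.\<close>

definition tri_int :: "(real^3 \<Rightarrow> real) \<Rightarrow> real^3 \<Rightarrow> real^3 \<Rightarrow> real^3 \<Rightarrow> real" where
  "tri_int f a b c = integral {0..1} (\<lambda>t. integral {0..1 - t} (\<lambda>s.
     f (a + s *\<^sub>R (b - a) + t *\<^sub>R (c - a))))"

definition tet_int :: "(real^3 \<Rightarrow> real) \<Rightarrow> real^3 \<Rightarrow> real^3 \<Rightarrow> real^3 \<Rightarrow> real^3 \<Rightarrow> real" where
  "tet_int f a b c d = integral {0..1} (\<lambda>t. integral {0..1 - t} (\<lambda>s. integral {0..1 - s - t} (\<lambda>r.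
     f (a + r *\<^sub>R (b - a) + s *\<^sub>R (c - a) + t *\<^sub>R (d - a)))))"

lemma convex_mem_affine4:
  fixes a b c d :: "'a::real_vector"
  assumes "convex K" "a \<in> K" "b \<in> K" "c \<in> K" "d \<in> K" "0 \<le> r" "0 \<le> s" "0 \<le> t" "r + s + t \<le> 1"
  shows "a + r *\<^sub>R (b - a) + s *\<^sub>R (c - a) + t *\<^sub>R (d - a) \<in> K"
proof -
  have "(\<Sum>i\<in>{0..3::nat}. [1 - r - s - t, r, s, t] ! i *\<^sub>R [a, b, c, d] ! i) \<in> K"
    by (rule convex_sum) (use assms in \<open>auto simp: numeral_3_eq_3 le_Suc_eq\<close>)
  then show ?thesis by (simp add: numeral_3_eq_3 algebra_simps)
qed

lemma convex_mem_affine3: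
  fixes a b c :: "'a::real_vector"
  assumes "convex K" "a \<in> K" "b \<in> K" "c \<in> K" "0 \<le> s" "0 \<le> t" "s + t \<le> 1"
  shows "a + s *\<^sub>R (b - a) + t *\<^sub>R (c - a) \<in> K"
  using convex_mem_affine4[of K a b c a s t 0] assms by simp

lemma convex_mem_affine2:
  fixes a b :: "'a::real_vector"
  assumes "convex K" "a \<in> K" "b \<in> K" "0 \<le> s" "s \<le> 1"
  shows "a + s *\<^sub>R (b - a) \<in> K"
  using convex_mem_affine3[of K a b a s 0] assms by simp

lemma continuous_on_tri_param:
  fixes f :: "real^3 \<Rightarrow> real"
  assumes "convex K" "continuous_on K f" "a \<in> K" "b \<in> K" "c \<in> K"
  shows "continuous_on {(s, t). 0 \<le> s \<and> 0 \<le> t \<and> s + t \<le> 1}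
           (\<lambda>(s, t). f (a + s *\<^sub>R (b - a) + t *\<^sub>R (c - a)))"
  unfolding case_prod_unfold
  by (rule continuous_on_compose2[OF assms(2)])
     (use assms in \<open>auto intro!: continuous_intros convex_mem_affine3\<close>)

lemma seg_int_swap: "seg_int f a b = seg_int f b a"
proof -
  have "f (a + (1 - s) *\<^sub>R (b - a)) = f (b + s *\<^sub>R (a - b))" for s
    by (rule arg_cong[where f = f]) (simp add: algebra_simps)
  then show ?thesis
    using integral_reflect_upper[of 1 "\<lambda>s. f (a + s *\<^sub>R (b - a))"] by (simp add: seg_int_def)
qed

text \<open>Reflecting the innermost variable, \<open>s\<close> to \<open>1 - t - s\<close>,
  exchanges the barycentric weights of the first two vertices. Together with the Fubini exchanges
  below, such adjacent transpositions generate all permutations of the vertices.\<close>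

lemma tri_int_swap12: "tri_int f a b c = tri_int f b a c"
proof -
  have "f (a + (1 - t - s) *\<^sub>R (b - a) + t *\<^sub>R (c - a)) = f (b + s *\<^sub>R (a - b) + t *\<^sub>R (c - b))" for s t
    by (rule arg_cong[where f = f]) (simp add: algebra_simps)
  then show ?thesis
    using integral_reflect_upper[of "1 - t" "\<lambda>s. f (a + s *\<^sub>R (b - a) + t *\<^sub>R (c - a))" for t]
    by (simp add: tri_int_def)
qed

lemma tet_int_swap12: "tet_int f a b c d = tet_int f b a c d"
proof -
  have "f (a + (1 - s - t - r) *\<^sub>R (b - a) + s *\<^sub>R (c - a) + t *\<^sub>R (d - a)) =
      f (b + r *\<^sub>R (a - b) + s *\<^sub>R (c - b) + t *\<^sub>R (d - b))" for r s t
    by (rule arg_cong[where f = f]) (simp add: algebra_simps)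
  then show ?thesis
    using integral_reflect_upper[of "1 - s - t"
        "\<lambda>r. f (a + r *\<^sub>R (b - a) + s *\<^sub>R (c - a) + t *\<^sub>R (d - a))" for s t]
    by (simp add: tet_int_def)
qed

lemma tri_int_swap23:
  assumes "convex K" "continuous_on K f" "a \<in> K" "b \<in> K" "c \<in> K"
  shows "tri_int f a b c = tri_int f a c b"
proof -
  have "f (a + s *\<^sub>R (b - a) + t *\<^sub>R (c - a)) = f (a + t *\<^sub>R (c - a) + s *\<^sub>R (b - a))" for s t
    by (simp add: algebra_simps)
  then show ?thesis
    using integral_triangle_swap[OF continuous_on_tri_param[OF assms]]
    by (simp add: tri_int_def)
qed

lemma continuous_on_tet_param:
  fixes f :: "real^3 \<Rightarrow> real"
  assumes "convex K" "continuous_on K f" "a \<in> K" "b \<in> K" "c \<in> K" "d \<in> K"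
  shows "continuous_on {(s, t). 0 \<le> s \<and> 0 \<le> t \<and> s + t \<le> 1}
           (\<lambda>(s, t). integral {0..1 - s - t} (\<lambda>r.
              f (a + r *\<^sub>R (b - a) + s *\<^sub>R (c - a) + t *\<^sub>R (d - a))))"
  unfolding case_prod_unfold
proof (rule continuous_on_integral_upper)
  show "continuous_on {(z, r). z \<in> {p. 0 \<le> fst p \<and> 0 \<le> snd p \<and> fst p + snd p \<le> 1} \<and> 0 \<le> r \<and>
        r \<le> 1 - fst z - snd z}
      (\<lambda>(z, r). f (a + r *\<^sub>R (b - a) + fst z *\<^sub>R (c - a) + snd z *\<^sub>R (d - a)))"
    unfolding case_prod_unfold
    by (rule continuous_on_compose2[OF assms(2)])
       (use assms in \<open>auto intro!: continuous_intros convex_mem_affine4\<close>)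
qed (auto intro!: continuous_intros)

lemma tet_int_swap34:
  assumes "convex K" "continuous_on K f" "a \<in> K" "b \<in> K" "c \<in> K" "d \<in> K"
  shows "tet_int f a b c d = tet_int f a b d c"
proof -
  have "integral {0..1 - s - t} (\<lambda>r. f (a + r *\<^sub>R (b - a) + s *\<^sub>R (c - a) + t *\<^sub>R (d - a))) =
      integral {0..1 - t - s} (\<lambda>r. f (a + r *\<^sub>R (b - a) + t *\<^sub>R (d - a) + s *\<^sub>R (c - a)))" for s t
    by (simp add: algebra_simps)
  then show ?thesis
    using integral_triangle_swap[OF continuous_on_tet_param[OF assms]]
    by (simp add: tet_int_def)
qed

text \<open>Fubini in the two inner variables on each slice of fixed \<open>t\<close>; the slice is
  a triangle of side \<open>1 - t\<close>, hence the general size \<open>c\<close> in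
  \<open>integral_triangle_swap\<close>.\<close>

lemma tet_int_swap23:
  assumes "convex K" "continuous_on K f" "a \<in> K" "b \<in> K" "c \<in> K" "d \<in> K"
  shows "tet_int f a b c d = tet_int f a c b d"
  unfolding tet_int_def
proof (rule integral_cong)
  fix t :: real assume t: "t \<in> {0..1}"
  have "continuous_on {(r, s). 0 \<le> r \<and> 0 \<le> s \<and> r + s \<le> 1 - t}
      (\<lambda>(r, s). f (a + r *\<^sub>R (b - a) + s *\<^sub>R (c - a) + t *\<^sub>R (d - a)))"
    unfolding case_prod_unfold
    by (rule continuous_on_compose2[OF assms(2)])
       (use assms t in \<open>auto intro!: continuous_intros convex_mem_affine4\<close>)
  from integral_triangle_swap[OF this]
  have "integral {0..1 - t} (\<lambda>s. integral {0..1 - t - s}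
          (\<lambda>r. f (a + r *\<^sub>R (b - a) + s *\<^sub>R (c - a) + t *\<^sub>R (d - a)))) =
      integral {0..1 - t} (\<lambda>r. integral {0..1 - t - r}
          (\<lambda>s. f (a + r *\<^sub>R (b - a) + s *\<^sub>R (c - a) + t *\<^sub>R (d - a))))" .
  moreover have "1 - t - s = 1 - s - t" for s by simp
  moreover have "a + r *\<^sub>R (b - a) + s *\<^sub>R (c - a) = a + s *\<^sub>R (c - a) + r *\<^sub>R (b - a)" for r s
    by (simp add: algebra_simps)
  ultimately show "integral {0..1 - t} (\<lambda>s. integral {0..1 - s - t}
          (\<lambda>r. f (a + r *\<^sub>R (b - a) + s *\<^sub>R (c - a) + t *\<^sub>R (d - a)))) =
      integral {0..1 - t} (\<lambda>s. integral {0..1 - s - t}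
          (\<lambda>r. f (a + r *\<^sub>R (c - a) + s *\<^sub>R (b - a) + t *\<^sub>R (d - a))))"
    by (simp only:)
qed

section \<open>Linearity and congruence of the affine integrals\<close>

lemma seg_int_cmult: "seg_int (\<lambda>z. k * f z) a b = k * seg_int f a b"
  by (simp add: seg_int_def)

lemma tri_int_cmult: "tri_int (\<lambda>z. k * f z) a b c = k * tri_int f a b c"
  by (simp add: tri_int_def)

lemma tet_int_cmult: "tet_int (\<lambda>z. k * f z) a b c d = k * tet_int f a b c d"
  by (simp add: tet_int_def)

lemma seg_int_cong:
  assumes "convex K" "a \<in> K" "b \<in> K" "\<And>z. z \<in> K \<Longrightarrow> f z = g z"
  shows "seg_int f a b = seg_int g a b"
  unfolding seg_int_def
  by (intro integral_cong assms(4) convex_mem_affine2 assms) auto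

lemma tri_int_cong:
  assumes "convex K" "a \<in> K" "b \<in> K" "c \<in> K" "\<And>z. z \<in> K \<Longrightarrow> f z = g z"
  shows "tri_int f a b c = tri_int g a b c"
  unfolding tri_int_def
  by (intro integral_cong assms(5) convex_mem_affine3 assms) auto

lemma tet_int_cong:
  assumes "convex K" "a \<in> K" "b \<in> K" "c \<in> K" "d \<in> K" "\<And>z. z \<in> K \<Longrightarrow> f z = g z"
  shows "tet_int f a b c d = tet_int g a b c d"
  unfolding tet_int_def
  by (intro integral_cong assms(6) convex_mem_affine4 assms) auto

lemma seg_int_add:
  assumes "convex K" "continuous_on K f" "continuous_on K g" "a \<in> K" "b \<in> K"
  shows "seg_int (\<lambda>z. f z + g z) a b = seg_int f a b + seg_int g a b"
proof -
  have "(\<lambda>s. h (a + s *\<^sub>R (b - a))) integrable_on {0..1}" if "continuous_on K h" for h :: "_ \<Rightarrow> real"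
    by (rule integrable_continuous_real, rule continuous_on_compose2[OF that])
       (use assms in \<open>auto intro!: continuous_intros convex_mem_affine2\<close>)
  then show ?thesis unfolding seg_int_def
    by (intro Henstock_Kurzweil_Integration.integral_add) (use assms in auto)
qed

lemma tri_int_add:
  assumes "convex K" "continuous_on K f" "continuous_on K g" "a \<in> K" "b \<in> K" "c \<in> K"
  shows "tri_int (\<lambda>z. f z + g z) a b c = tri_int f a b c + tri_int g a b c"
  unfolding tri_int_def
  by (rule integral_triangle_add; rule continuous_on_tri_param) (use assms in auto)

lemma tri_int_diff:
  assumes "convex K" "continuous_on K f" "continuous_on K g" "a \<in> K" "b \<in> K" "c \<in> K"
  shows "tri_int (\<lambda>z. f z - g z) a b c = tri_int f a b c - tri_int g a b c"
  unfolding tri_int_def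
  by (rule integral_triangle_diff; rule continuous_on_tri_param) (use assms in auto)

lemma tet_int_add:
  assumes "convex K" "continuous_on K f" "continuous_on K g" "a \<in> K" "b \<in> K" "c \<in> K" "d \<in> K"
  shows "tet_int (\<lambda>z. f z + g z) a b c d = tet_int f a b c d + tet_int g a b c d"
proof -
  have int: "(\<lambda>r. h (a + r *\<^sub>R (b - a) + s *\<^sub>R (c - a) + t *\<^sub>R (d - a))) integrable_on {0..1 - s - t}"
    if "continuous_on K h" "0 \<le> s" "0 \<le> t" for h :: "_ \<Rightarrow> real" and s t
    by (rule integrable_continuous_real, rule continuous_on_compose2[OF that(1)])
       (use assms that in \<open>auto intro!: continuous_intros convex_mem_affine4\<close>)
  have "tet_int (\<lambda>z. f z + g z) a b c d =
      integral {0..1} (\<lambda>t. integral {0..1 - t} (\<lambda>s.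
        integral {0..1 - s - t} (\<lambda>r. f (a + r *\<^sub>R (b - a) + s *\<^sub>R (c - a) + t *\<^sub>R (d - a))) +
        integral {0..1 - s - t} (\<lambda>r. g (a + r *\<^sub>R (b - a) + s *\<^sub>R (c - a) + t *\<^sub>R (d - a)))))"
    unfolding tet_int_def
    by (intro integral_cong Henstock_Kurzweil_Integration.integral_add int) (use assms in auto)
  also have "\<dots> = tet_int f a b c d + tet_int g a b c d"
    unfolding tet_int_def
    by (rule integral_triangle_add; rule continuous_on_tet_param) (use assms in auto)
  finally show ?thesis .
qed

section \<open>The fundamental theorem of calculus on simplices\<close>

lemma has_integral_derivative_line:
  fixes G :: "real^3 \<Rightarrow> real"
  assumes G: "\<And>z. z \<in> K \<Longrightarrow> (G has_derivative G' z) (at z within K)"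
    and k: "0 \<le> k" and p: "\<And>r. 0 \<le> r \<Longrightarrow> r \<le> k \<Longrightarrow> p + r *\<^sub>R v \<in> K"
  shows "((\<lambda>r. G' (p + r *\<^sub>R v) v) has_integral G (p + k *\<^sub>R v) - G p) {0..k}"
proof -
  have "((\<lambda>r. G (p + r *\<^sub>R v)) has_vector_derivative G' (p + r *\<^sub>R v) v) (at r within {0..k})"
    if "r \<in> {0..k}" for r
  proof -
    have "((\<lambda>r. p + r *\<^sub>R v) has_derivative (\<lambda>h. h *\<^sub>R v)) (at r within {0..k})"
      by (auto intro!: derivative_eq_intros)
    from has_derivative_in_compose2[OF G _ _ this] that p
    have "((\<lambda>r. G (p + r *\<^sub>R v)) has_derivative (\<lambda>h. G' (p + r *\<^sub>R v) (h *\<^sub>R v))) (at r within {0..k})"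
      by (auto simp: image_subset_iff)
    moreover have "G' (p + r *\<^sub>R v) (h *\<^sub>R v) = h *\<^sub>R G' (p + r *\<^sub>R v) v" for h
      using G[of "p + r *\<^sub>R v"] p that by (auto dest!: has_derivative_linear simp: linear_cmul)
    ultimately show ?thesis by (simp add: has_vector_derivative_def)
  qed
  from fundamental_theorem_of_calculus[OF k this] show ?thesis by simp
qed

lemma seg_int_deriv:
  assumes G: "\<And>z. z \<in> K \<Longrightarrow> (G has_derivative G' z) (at z within K)"
    and K: "convex K" "a \<in> K" "b \<in> K"
  shows "seg_int (\<lambda>z. G' z (b - a)) a b = G b - G a"
proof -
  have "((\<lambda>r. G' (a + r *\<^sub>R (b - a)) (b - a)) has_integral G (a + 1 *\<^sub>R (b - a)) - G a) {0..1}"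
    by (rule has_integral_derivative_line[OF G]) (use K in \<open>auto intro: convex_mem_affine2\<close>)
  then show ?thesis by (simp add: seg_int_def integral_unique)
qed

lemma seg_int_diff:
  assumes "convex K" "continuous_on K f" "continuous_on K g" "a \<in> K" "b \<in> K"
  shows "seg_int (\<lambda>z. f z - g z) a b = seg_int f a b - seg_int g a b"
  using seg_int_add[OF assms(1,2), of "\<lambda>z. - g z"] seg_int_cmult[of "-1" g] assms
  by (simp add: continuous_on_minus)

text \<open>The direction \<open>b - a\<close> is that of the innermost variable, so the fundamental
  theorem applies on each chord, whose ends lie on the edges \<open>b c\<close> and
  \<open>a c\<close>. Other edge directions are reached by permuting the vertices.\<close>

lemma tri_int_deriv:
  assumes G: "\<And>z. z \<in> K \<Longrightarrow> (G has_derivative G' z) (at z within K)"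
    and K: "convex K" "a \<in> K" "b \<in> K" "c \<in> K"
  shows "tri_int (\<lambda>z. G' z (b - a)) a b c = seg_int G b c - seg_int G a c"
proof -
  have cont: "continuous_on K G"
    using G by (meson continuous_on_eq_continuous_within has_derivative_continuous)
  have "integral {0..1 - t} (\<lambda>s. G' (a + s *\<^sub>R (b - a) + t *\<^sub>R (c - a)) (b - a)) =
      G (b + t *\<^sub>R (c - b)) - G (a + t *\<^sub>R (c - a))" if t: "t \<in> {0..1}" for t
  proof -
    have "((\<lambda>r. G' ((a + t *\<^sub>R (c - a)) + r *\<^sub>R (b - a)) (b - a)) has_integral
        G ((a + t *\<^sub>R (c - a)) + (1 - t) *\<^sub>R (b - a)) - G (a + t *\<^sub>R (c - a))) {0..1 - t}"
    proof (rule has_integral_derivative_line[OF G])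
      fix r assume "0 \<le> r" "r \<le> 1 - t"
      then show "a + t *\<^sub>R (c - a) + r *\<^sub>R (b - a) \<in> K"
        using convex_mem_affine3[OF K(1,2) K(4,3), of t r] t by simp
    qed (use t in auto)
    moreover have "a + t *\<^sub>R (c - a) + (1 - t) *\<^sub>R (b - a) = b + t *\<^sub>R (c - b)"
      by (simp add: algebra_simps)
    moreover have "a + t *\<^sub>R (c - a) + r *\<^sub>R (b - a) = a + r *\<^sub>R (b - a) + t *\<^sub>R (c - a)" for r
      by (simp add: algebra_simps)
    ultimately show ?thesis by (simp add: integral_unique)
  qed
  then have "tri_int (\<lambda>z. G' z (b - a)) a b c =
      integral {0..1} (\<lambda>t. G (b + t *\<^sub>R (c - b)) - G (a + t *\<^sub>R (c - a)))"
    unfolding tri_int_def by (rule integral_cong)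
  also have "\<dots> = seg_int G b c - seg_int G a c"
    unfolding seg_int_def
    by (intro Henstock_Kurzweil_Integration.integral_diff integrable_continuous_real;
        rule continuous_on_compose2[OF cont])
       (use K in \<open>auto intro!: continuous_intros convex_mem_affine2\<close>)
  finally show ?thesis .
qed

lemma tet_int_deriv:
  assumes G: "\<And>z. z \<in> K \<Longrightarrow> (G has_derivative G' z) (at z within K)"
    and K: "convex K" "a \<in> K" "b \<in> K" "c \<in> K" "d \<in> K"
  shows "tet_int (\<lambda>z. G' z (b - a)) a b c d = tri_int G b c d - tri_int G a c d"
proof -
  have cont: "continuous_on K G"
    using G by (meson continuous_on_eq_continuous_within has_derivative_continuous)
  have "integral {0..1 - s - t} (\<lambda>r. G' (a + r *\<^sub>R (b - a) + s *\<^sub>R (c - a) + t *\<^sub>R (d - a)) (b - a)) =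
      G (b + s *\<^sub>R (c - b) + t *\<^sub>R (d - b)) - G (a + s *\<^sub>R (c - a) + t *\<^sub>R (d - a))"
    if st: "t \<in> {0..1}" "s \<in> {0..1 - t}" for s t
  proof -
    have "((\<lambda>r. G' ((a + s *\<^sub>R (c - a) + t *\<^sub>R (d - a)) + r *\<^sub>R (b - a)) (b - a)) has_integral
        G ((a + s *\<^sub>R (c - a) + t *\<^sub>R (d - a)) + (1 - s - t) *\<^sub>R (b - a)) -
        G (a + s *\<^sub>R (c - a) + t *\<^sub>R (d - a))) {0..1 - s - t}"
    proof (rule has_integral_derivative_line[OF G])
      fix r assume "0 \<le> r" "r \<le> 1 - s - t"
      then show "a + s *\<^sub>R (c - a) + t *\<^sub>R (d - a) + r *\<^sub>R (b - a) \<in> K"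
        using convex_mem_affine4[OF K(1,2) K(4,5,3), of s t r] st by simp
    qed (use st in auto)
    \<comment> \<open>The far end of the chord, rewritten as a point of the facet
      \<open>b c d\<close> with the same parameters.\<close>
    moreover have "a + s *\<^sub>R (c - a) + t *\<^sub>R (d - a) + (1 - s - t) *\<^sub>R (b - a) =
        b + s *\<^sub>R (c - b) + t *\<^sub>R (d - b)"
      by (simp add: algebra_simps)
    moreover have "a + s *\<^sub>R (c - a) + t *\<^sub>R (d - a) + r *\<^sub>R (b - a) =
        a + r *\<^sub>R (b - a) + s *\<^sub>R (c - a) + t *\<^sub>R (d - a)" for r
      by (simp add: algebra_simps)
    ultimately show ?thesis by (simp add: integral_unique)
  qed
  then have "tet_int (\<lambda>z. G' z (b - a)) a b c d =
      integral {0..1} (\<lambda>t. integral {0..1 - t} (\<lambda>s.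
        G (b + s *\<^sub>R (c - b) + t *\<^sub>R (d - b)) - G (a + s *\<^sub>R (c - a) + t *\<^sub>R (d - a))))"
    unfolding tet_int_def by (intro integral_cong)
  also have "\<dots> = tri_int G b c d - tri_int G a c d"
    unfolding tri_int_def
    by (rule integral_triangle_diff; rule continuous_on_tri_param) (use cont K in auto)
  finally show ?thesis .
qed

section \<open>Integration over a tetrahedron\<close>

text \<open>Coordinates in nested pairs make Lebesgue measure on the space a product measure, to
  which Fubini applies.\<close>

definition emb3 :: "real * real * real \<Rightarrow> real^3" where
  "emb3 = (\<lambda>(r, s, t). r *\<^sub>R axis 1 1 + s *\<^sub>R axis 2 1 + t *\<^sub>R axis 3 1)"

lemma emb3_nth [simp]: "emb3 (r, s, t) $ 1 = r" "emb3 (r, s, t) $ 2 = s" "emb3 (r, s, t) $ 3 = t"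
  by (simp_all add: emb3_def axis_def)

lemma continuous_on_emb3: "continuous_on S emb3"
  unfolding emb3_def case_prod_unfold by (intro continuous_intros)

lemma Basis_vec3: "(Basis :: (real^3) set) = {axis 1 1, axis 2 1, axis 3 1}"
  by (auto simp: Basis_vec_def UNIV_3)

text \<open>Lebesgue measure is determined by the volumes of boxes, and \<open>emb3\<close> pulls
  boxes back to boxes with the same side lengths.\<close>

lemma lborel_emb3: "(lborel :: (real^3) measure) = distr lborel borel emb3"
proof (rule lborel_eqI)
  have m: "emb3 \<in> measurable lborel borel"
    using borel_measurable_continuous_onI[OF continuous_on_emb3] by simp
  fix l u :: "real^3" assume le: "\<And>b. b \<in> Basis \<Longrightarrow> l \<bullet> b \<le> u \<bullet> b"
  have "l $ i \<le> u $ i" for i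
    using le[of "axis i 1"] by (simp add: inner_axis)
  moreover have box_Pair: "(p, q) \<in> box (a, b) (c, d) \<longleftrightarrow> p \<in> box a c \<and> q \<in> box b d"
    for a c p :: "'p::euclidean_space" and b d q :: "'q::euclidean_space"
    by (auto simp: mem_box Basis_prod_def ball_Un)
  moreover have "emb3 -` box l u = box (l$1, l$2, l$3) (u$1, u$2, u$3)"
    by (simp add: set_eq_iff split_paired_all mem_box_cart forall_3 box_Pair)
  moreover have "(\<Prod>b\<in>Basis. (u - l) \<bullet> b) = (u$1 - l$1) * (u$2 - l$2) * (u$3 - l$3)"
    by (simp add: Basis_vec3 axis_eq_axis inner_axis)
  moreover have "emeasure lborel (box (l$1, l$2, l$3) (u$1, u$2, u$3)) =
      ennreal ((u$1 - l$1) * (u$2 - l$2) * (u$3 - l$3))"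
    by (subst emeasure_lborel_box)
       (use calculation in \<open>auto simp: Basis_prod_def zero_prod_def mult_ac\<close>)
  ultimately show "emeasure (distr lborel borel emb3) (box l u) = ennreal (\<Prod>b\<in>Basis. (u - l) \<bullet> b)"
    by (subst emeasure_distr[OF m]) simp_all
qed simp

definition std3 :: "(real^3) set" where
  "std3 = {v. 0 \<le> v$1 \<and> 0 \<le> v$2 \<and> 0 \<le> v$3 \<and> v$1 + v$2 + v$3 \<le> 1}"

lemma std3_eq: "std3 = convex hull (insert 0 Basis)"
  unfolding std_simplex std3_def
  by (simp add: Basis_vec3 inner_axis axis_eq_axis conj_assoc add.assoc)

lemma compact_std3: "compact std3"
  unfolding std3_eq by (intro finite_imp_compact_convex_hull) simp

lemma continuous_on_integral_std3:
  fixes h :: "real^3 \<Rightarrow> real"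
  assumes h: "continuous_on std3 h"
  shows "continuous_on {(s, t). 0 \<le> s \<and> 0 \<le> t \<and> s + t \<le> 1}
    (\<lambda>(s, t). integral {0..1 - s - t} (\<lambda>r. h (emb3 (r, s, t))))"
  unfolding case_prod_unfold
proof (rule continuous_on_integral_upper)
  have "continuous_on {(z, r). z \<in> {p. 0 \<le> fst p \<and> 0 \<le> snd p \<and> fst p + snd p \<le> 1} \<and> 0 \<le> r \<and>
        r \<le> 1 - fst z - snd z} (\<lambda>(z, r). emb3 (r, fst z, snd z))"
    unfolding case_prod_unfold
    by (intro continuous_on_compose2[OF continuous_on_emb3[of UNIV]] continuous_intros) auto
  from continuous_on_compose2[OF h this]
  show "continuous_on {(z, r). z \<in> {p. 0 \<le> fst p \<and> 0 \<le> snd p \<and> fst p + snd p \<le> 1} \<and> 0 \<le> r \<and>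
        r \<le> 1 - fst z - snd z} (\<lambda>(z, r). h (emb3 (r, fst z, snd z)))"
    by (force simp: std3_def case_prod_unfold)
qed (auto intro!: continuous_intros)

text \<open>Fubini twice: \<open>r\<close> is integrated out first, and the remaining integral over
  the triangle of pairs \<open>(s, t)\<close> is evaluated by
  \<open>lborel_integral_triangle\<close>.\<close>

lemma integral_std3:
  fixes h :: "real^3 \<Rightarrow> real"
  assumes h: "continuous_on std3 h"
  shows "integral std3 h = integral {0..1} (\<lambda>t. integral {0..1 - t} (\<lambda>s.
     integral {0..1 - s - t} (\<lambda>r. h (emb3 (r, s, t)))))"
proof -
  let ?T = "{(s, t). 0 \<le> s \<and> 0 \<le> t \<and> s + t \<le> (1::real)}"
  have int: "integrable lborel (\<lambda>v. indicator std3 v *\<^sub>R h v)"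
    by (rule borel_integrable_compact[OF compact_std3 h])
  have m: "emb3 \<in> measurable lborel borel"
    using borel_measurable_continuous_onI[OF continuous_on_emb3] by simp
  have int': "integrable (lborel \<Otimes>\<^sub>M lborel) (\<lambda>(r, st). indicator std3 (emb3 (r, st)) *\<^sub>R h (emb3 (r, st)))"
    using int by (subst (asm) lborel_emb3, subst (asm) integrable_distr_eq[OF m])
      (auto simp: lborel_prod case_prod_unfold)
  have int'': "integrable (lborel \<Otimes>\<^sub>M lborel)
      (\<lambda>(s, t). indicator ?T (s, t) *\<^sub>R integral {0..1 - s - t} (\<lambda>r. h (emb3 (r, s, t))))"
    using borel_integrable_compact[OF compact_triangle continuous_on_integral_std3[OF h]]
    by (simp add: lborel_prod case_prod_unfold)
  have inner: "(\<integral>r. indicator std3 (emb3 (r, s, t)) *\<^sub>R h (emb3 (r, s, t)) \<partial>lborel) =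
      indicator ?T (s, t) *\<^sub>R integral {0..1 - s - t} (\<lambda>r. h (emb3 (r, s, t)))" for s t
  proof (cases "(s, t) \<in> ?T")
    case True
    have ind: "indicator std3 (emb3 (r, s, t)) = (indicator {0..1 - s - t} r :: real)" for r
      using True by (auto simp: indicator_def std3_def)
    have "continuous_on {0..1 - s - t} (\<lambda>r. emb3 (r, s, t))"
      by (intro continuous_on_compose2[OF continuous_on_emb3[of UNIV]] continuous_intros) auto
    from continuous_on_compose2[OF h this] True
    have "continuous_on {0..1 - s - t} (\<lambda>r. h (emb3 (r, s, t)))"
      by (force simp: std3_def)
    from set_borel_integral_eq_integral(2)[OF borel_integrable_atLeastAtMost'[OF this]] True
    show ?thesis unfolding ind by (simp add: set_lebesgue_integral_def)
  next
    case False
    then have "indicator std3 (emb3 (r, s, t)) = (0::real)" for r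
      by (auto simp: indicator_def std3_def)
    with False show ?thesis by simp
  qed
  have "integral std3 h = (\<integral>v. indicator std3 v *\<^sub>R h v \<partial>lborel)"
    using set_borel_integral_eq_integral(2)[of std3 h] int
    by (simp add: set_integrable_def set_lebesgue_integral_def)
  also have "\<dots> = (\<integral>p. indicator std3 (emb3 p) *\<^sub>R h (emb3 p) \<partial>lborel)"
    using int by (subst lborel_emb3, subst integral_distr[OF m]) (auto simp: borel_measurable_integrable)
  also have "\<dots> = (\<integral>(r, st). indicator std3 (emb3 (r, st)) *\<^sub>R h (emb3 (r, st)) \<partial>(lborel \<Otimes>\<^sub>M lborel))"
    by (simp add: lborel_prod case_prod_unfold)
  also have "\<dots> = (\<integral>st. (\<integral>r. indicator std3 (emb3 (r, st)) *\<^sub>R h (emb3 (r, st)) \<partial>lborel) \<partial>lborel)"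
    by (rule lborel_pair.integral_snd[OF int', symmetric])
  also have "\<dots> = (\<integral>(s, t). indicator ?T (s, t) *\<^sub>R integral {0..1 - s - t} (\<lambda>r. h (emb3 (r, s, t)))
      \<partial>(lborel \<Otimes>\<^sub>M lborel))"
    unfolding lborel_prod by (intro Bochner_Integration.integral_cong) (simp_all only: split_paired_all inner case_prod_conv)
  also have "\<dots> = (\<integral>t. (\<integral>s. indicator ?T (s, t) *\<^sub>R integral {0..1 - s - t} (\<lambda>r. h (emb3 (r, s, t)))
      \<partial>lborel) \<partial>lborel)"
    by (rule lborel_pair.integral_snd[OF int'', symmetric])
  also have "\<dots> = integral {0..1} (\<lambda>t. integral {0..1 - t} (\<lambda>s.
     integral {0..1 - s - t} (\<lambda>r. h (emb3 (r, s, t)))))"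
    by (rule lborel_integral_triangle[OF continuous_on_integral_std3[OF h]])
  finally show ?thesis .
qed

section \<open>Affine images of the standard simplex\<close>

definition aff3 :: "real^3 \<Rightarrow> real^3 \<Rightarrow> real^3 \<Rightarrow> real^3 \<Rightarrow> real^3 \<Rightarrow> real^3" where
  "aff3 a b c d v = a + v$1 *\<^sub>R (b - a) + v$2 *\<^sub>R (c - a) + v$3 *\<^sub>R (d - a)"

definition lin3 :: "real^3 \<Rightarrow> real^3 \<Rightarrow> real^3 \<Rightarrow> real^3 \<Rightarrow> real^3" where
  "lin3 u v w z = z$1 *\<^sub>R u + z$2 *\<^sub>R v + z$3 *\<^sub>R w"

lemma linear_lin3: "linear (lin3 u v w)"
  unfolding lin3_def by (rule linearI) (simp_all add: algebra_simps)

lemma aff3_lin3: "aff3 a b c d = (\<lambda>z. a + lin3 (b - a) (c - a) (d - a) z)"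
  by (simp add: aff3_def lin3_def fun_eq_iff add.assoc)

lemma det_lin3: "det (matrix (lin3 u v w)) = u \<bullet> (v \<times> w)"
  by (simp add: matrix_def lin3_def det_3 axis_def cross3_simps)

lemma aff3_image: "aff3 a b c d ` std3 = convex hull {a, b, c, d}"
proof -
  let ?L = "lin3 (b - a) (c - a) (d - a)"
  have "aff3 a b c d ` std3 = (\<lambda>z. a + z) ` ?L ` std3"
    by (auto simp: aff3_lin3 image_iff)
  also have "\<dots> = convex hull ((\<lambda>z. a + z) ` ?L ` insert 0 Basis)"
    by (simp only: std3_eq convex_hull_linear_image[OF linear_lin3] convex_hull_translation)
  also have "(\<lambda>z. a + z) ` ?L ` insert 0 Basis = {a, b, c, d}"
    by (auto simp: lin3_def Basis_vec3 axis_def)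
  finally show ?thesis .
qed

text \<open>The standard simplex has volume 1/6 and a linear map scales volume by the modulus of its
  determinant. Determinant zero is included; it occurs for subtetrahedra whose apex lies in the
  plane of the base.\<close>

lemma measure_tetrahedron:
  "measure lebesgue (convex hull {a, b, c, d}) = \<bar>(b - a) \<bullet> ((c - a) \<times> (d - a))\<bar> / 6"
proof -
  let ?L = "lin3 (b - a) (c - a) (d - a)"
  have "measure lebesgue (convex hull {a, b, c, d}) = measure lebesgue ((\<lambda>z. a + z) ` ?L ` std3)"
    by (simp add: aff3_image[symmetric] aff3_lin3 image_image)
  also have "\<dots> = \<bar>det (matrix ?L)\<bar> * measure lebesgue std3"
    by (simp add: measure_translation measure_linear_image linear_lin3 lmeasurable_compact compact_std3)
  also have "measure lebesgue std3 = 1 / 6"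
    using content_std_simplex[where 'a = "real^3"] compact_std3
    by (simp add: std3_eq compact_imp_closed fact_numeral)
  finally show ?thesis by (simp add: det_lin3)
qed

lemma integral_tetrahedron:
  fixes f :: "real^3 \<Rightarrow> real"
  assumes f: "continuous_on (convex hull {a, b, c, d}) f"
    and nondeg: "(b - a) \<bullet> ((c - a) \<times> (d - a)) \<noteq> 0"
  shows "integral (convex hull {a, b, c, d}) f = \<bar>(b - a) \<bullet> ((c - a) \<times> (d - a))\<bar> * tet_int f a b c d"
proof -
  let ?L = "lin3 (b - a) (c - a) (d - a)" and ?g = "aff3 a b c d"
  let ?D = "\<bar>(b - a) \<bullet> ((c - a) \<times> (d - a))\<bar>"
  \<comment> \<open>The change-of-variables theorem used below takes integrands with values in
    \<open>real^'n\<close>, so the scalar function is viewed as a vector with one component.\<close>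
  define F where "F = (\<lambda>z. (\<chi> i. f z) :: real^1)"
  have "continuous_on UNIV ?g"
    unfolding aff3_def by (intro continuous_intros)
  then have fg: "continuous_on std3 (\<lambda>v. f (?g v))"
    by (intro continuous_on_compose2[OF f]) (auto simp flip: aff3_image intro: continuous_on_subset)
  have der: "(?g has_derivative ?L) (at v within std3)" for v
    unfolding aff3_lin3
    by (auto intro!: derivative_eq_intros linear_imp_has_derivative linear_lin3)
  have "inj ?L"
    using nondeg det_nz_iff_inj[OF linear_lin3, of "b - a" "c - a" "d - a"] by (simp add: det_lin3)
  then have inj: "inj_on ?g std3"
    by (auto simp: aff3_lin3 inj_on_def)
  have "continuous_on (convex hull {a, b, c, d}) F"
    unfolding F_def using f by (intro continuous_intros)
  moreover have cpt: "compact (convex hull {a, b, c, d})"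
    by (intro finite_imp_compact_convex_hull) simp
  ultimately have "integrable lborel (\<lambda>z. indicator (convex hull {a, b, c, d}) z *\<^sub>R F z)"
    by (intro borel_integrable_compact)
  then have abs: "F absolutely_integrable_on (?g ` std3)"
    unfolding aff3_image set_integrable_def
    by (subst integrable_completion) (auto dest: borel_measurable_integrable)
  have "integral std3 (\<lambda>v. ?D *\<^sub>R F (?g v)) = integral (?g ` std3) F \<and>
      (\<lambda>v. ?D *\<^sub>R F (?g v)) absolutely_integrable_on std3"
    using has_absolute_integral_change_of_variables[OF _ der inj, of F "integral (?g ` std3) F"] abs
      lmeasurable_compact[OF compact_std3]
    by (simp add: det_lin3 fmeasurableD)
  then have "integral (convex hull {a, b, c, d}) F $ 1 = integral std3 (\<lambda>v. (?D *\<^sub>R F (?g v)) $ 1)"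
    and "integral (convex hull {a, b, c, d}) F $ 1 = integral (convex hull {a, b, c, d}) (\<lambda>z. F z $ 1)"
    using abs unfolding aff3_image
    by (metis absolutely_integrable_on_def integral_component_eq_cart)+
  then have "integral (convex hull {a, b, c, d}) f = ?D * integral std3 (\<lambda>v. f (?g v))"
    by (simp add: F_def)
  also have "integral std3 (\<lambda>v. f (?g v)) = tet_int f a b c d"
    by (subst integral_std3[OF fg]) (simp add: tet_int_def aff3_def)
  finally show ?thesis .
qed

section \<open>The exponential weight\<close>

text \<open>A continuous nonnegative function with integral zero vanishes identically. Strict
  positivity is asked only at 0, because the inner integrals to which this is applied vanish at the
  upper end, where their interval collapses.\<close>

lemma integral_upper_pos:
  fixes f :: "real \<Rightarrow> real"
  assumes "0 < c" "continuous_on {0..c} f" "\<And>x. x \<in> {0..c} \<Longrightarrow> 0 \<le> f x" "0 < f 0"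
  shows "0 < integral {0..c} f"
proof -
  have "0 \<le> integral {0..c} f"
    using assms by (intro Henstock_Kurzweil_Integration.integral_nonneg integrable_continuous_real)
  moreover have "integral {0..c} f \<noteq> 0"
    using integral_eq_0_iff[of 0 c f] assms by force
  ultimately show ?thesis by simp
qed

lemma seg_int_pos:
  assumes K: "convex K" "continuous_on K f" "a \<in> K" "b \<in> K"
    and pos: "\<And>z. z \<in> K \<Longrightarrow> 0 < f z"
  shows "0 < seg_int f a b"
  unfolding seg_int_def
proof (rule integral_upper_pos)
  show "continuous_on {0..1} (\<lambda>s. f (a + s *\<^sub>R (b - a)))"
    by (rule continuous_on_compose2[OF K(2)])
       (use K in \<open>auto intro!: continuous_intros convex_mem_affine2\<close>)
qed (use K in \<open>auto intro!: pos less_imp_le[OF pos] convex_mem_affine2\<close>)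

lemma tri_int_pos:
  assumes K: "convex K" "continuous_on K f" "a \<in> K" "b \<in> K" "c \<in> K"
    and pos: "\<And>z. z \<in> K \<Longrightarrow> 0 < f z"
  shows "0 < tri_int f a b c"
  unfolding tri_int_def
proof (rule integral_upper_pos)
  have cont: "continuous_on {0..1 - t} (\<lambda>s. f (a + s *\<^sub>R (b - a) + t *\<^sub>R (c - a)))"
    if "t \<in> {0..1}" for t
    by (rule continuous_on_compose2[OF K(2)])
       (use K that in \<open>auto intro!: continuous_intros convex_mem_affine3\<close>)
  show "continuous_on {0..1} (\<lambda>t. integral {0..1 - t} (\<lambda>s. f (a + s *\<^sub>R (b - a) + t *\<^sub>R (c - a))))"
    by (rule continuous_on_integral_inner_triangle[OF continuous_on_tri_param[OF K]])
  show "0 \<le> integral {0..1 - t} (\<lambda>s. f (a + s *\<^sub>R (b - a) + t *\<^sub>R (c - a)))" if "t \<in> {0..1}" for t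
    by (intro Henstock_Kurzweil_Integration.integral_nonneg integrable_continuous_real cont that)
       (use K that in \<open>auto intro!: less_imp_le[OF pos] convex_mem_affine3\<close>)
  show "0 < integral {0..1 - 0} (\<lambda>s. f (a + s *\<^sub>R (b - a) + 0 *\<^sub>R (c - a)))"
    using seg_int_pos[OF K(1-4) pos] by (simp add: seg_int_def)
qed simp

lemma tet_int_pos:
  assumes K: "convex K" "continuous_on K f" "a \<in> K" "b \<in> K" "c \<in> K" "d \<in> K"
    and pos: "\<And>z. z \<in> K \<Longrightarrow> 0 < f z"
  shows "0 < tet_int f a b c d"
  unfolding tet_int_def
proof (rule integral_upper_pos)
  have int: "(\<lambda>r. f (a + r *\<^sub>R (b - a) + s *\<^sub>R (c - a) + t *\<^sub>R (d - a))) integrable_on {0..1 - s - t}"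
    if "0 \<le> s" "0 \<le> t" for s t
    by (rule integrable_continuous_real, rule continuous_on_compose2[OF K(2)])
       (use K that in \<open>auto intro!: continuous_intros convex_mem_affine4\<close>)
  show "continuous_on {0..1} (\<lambda>t. integral {0..1 - t} (\<lambda>s. integral {0..1 - s - t}
      (\<lambda>r. f (a + r *\<^sub>R (b - a) + s *\<^sub>R (c - a) + t *\<^sub>R (d - a)))))"
    by (rule continuous_on_integral_inner_triangle[OF continuous_on_tet_param[OF K]])
  show "0 \<le> integral {0..1 - t} (\<lambda>s. integral {0..1 - s - t}
      (\<lambda>r. f (a + r *\<^sub>R (b - a) + s *\<^sub>R (c - a) + t *\<^sub>R (d - a))))" if t: "t \<in> {0..1}" for t
  proof (intro Henstock_Kurzweil_Integration.integral_nonneg int)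
    have "continuous_on {0..1 - t} (\<lambda>s. (s, t))" by (intro continuous_intros)
    from continuous_on_compose2[OF continuous_on_tet_param[OF K] this] t
    show "(\<lambda>s. integral {0..1 - s - t} (\<lambda>r. f (a + r *\<^sub>R (b - a) + s *\<^sub>R (c - a) + t *\<^sub>R (d - a))))
        integrable_on {0..1 - t}"
      by (intro integrable_continuous_real) force
  qed (use K t in \<open>auto intro!: less_imp_le[OF pos] convex_mem_affine4\<close>)
  show "0 < integral {0..1 - 0} (\<lambda>s. integral {0..1 - s - 0}
      (\<lambda>r. f (a + r *\<^sub>R (b - a) + s *\<^sub>R (c - a) + 0 *\<^sub>R (d - a))))"
    using tri_int_pos[OF K(1-5) pos] by (simp add: tri_int_def)
qed simp

lemma tri_int_const: "tri_int (\<lambda>_. k) a b c = k / 2"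
proof -
  have "((\<lambda>t. (1 - t) * k) has_integral (1 - 1\<^sup>2 / 2) * k - (0 - 0\<^sup>2 / 2) * k) {0..1::real}"
    by (intro fundamental_theorem_of_calculus)
       (auto intro!: derivative_eq_intros simp flip: has_real_derivative_iff_has_vector_derivative)
  moreover have "tri_int (\<lambda>_. k) a b c = integral {0..1} (\<lambda>t. (1 - t) * k)"
    unfolding tri_int_def by (rule integral_cong) simp
  ultimately show ?thesis by (simp only: integral_unique) simp
qed

text \<open>A square system: the values of the functionals, taken as coordinates, form a linear
  endomorphism, for which injectivity implies surjectivity.\<close>

lemma unique_linear_solution:
  fixes L :: "'k \<Rightarrow> 'a::euclidean_space \<Rightarrow> real" and R :: "'k \<Rightarrow> real"
  assumes I: "finite I" "card I = DIM('a)" and lin: "\<And>k. k \<in> I \<Longrightarrow> linear (L k)"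
    and inj: "\<And>v. (\<And>k. k \<in> I \<Longrightarrow> L k v = 0) \<Longrightarrow> v = 0"
  shows "\<exists>!v. \<forall>k\<in>I. L k v = R k"
proof -
  obtain h where h: "bij_betw h I (Basis :: 'a set)"
    using finite_same_card_bij[OF I(1) finite_Basis I(2)] by blast
  define g where "g = (\<lambda>c. \<Sum>k\<in>I. c k *\<^sub>R h k)"
  have g_inner: "g c \<bullet> h k = c k" if "k \<in> I" for c k
  proof -
    have "h i \<bullet> h k = of_bool (i = k)" if "i \<in> I" for i
    proof -
      have "h i \<in> Basis" "h k \<in> Basis" "h i = h k \<longleftrightarrow> i = k"
        using h \<open>k \<in> I\<close> that by (auto simp: bij_betw_def inj_on_def)
      then show ?thesis by (simp add: inner_Basis)
    qed
    then have "g c \<bullet> h k = (\<Sum>i\<in>I. c i * of_bool (i = k))"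
      by (simp add: g_def inner_sum_left)
    also have "\<dots> = c k" using that I(1) by (simp add: of_bool_def if_distrib sum.delta cong: if_cong)
    finally show ?thesis .
  qed
  have "linear (\<lambda>v. g (\<lambda>k. L k v))"
    unfolding g_def
    by (rule linearI) (simp_all add: linear_add linear_cmul lin algebra_simps sum.distrib scaleR_sum_right)
  moreover have "inj (\<lambda>v. g (\<lambda>k. L k v))"
    unfolding linear_injective_0[OF calculation] by (metis g_inner inj inner_zero_left)
  ultimately have "surj (\<lambda>v. g (\<lambda>k. L k v))"
    by (rule linear_injective_imp_surjective) simp
  then obtain v where "g R = g (\<lambda>k. L k v)" by (metis surjD)
  then have v: "L k v = R k" if "k \<in> I" for k
    using g_inner that by metis
  show ?thesis
  proof (rule ex1I[of _ v])
    fix v' assume v': "\<forall>k\<in>I. L k v' = R k"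
    have "v' - v = 0"
      by (rule inj) (use v v' lin in \<open>auto simp: linear_diff\<close>)
    then show "v' = v" by simp
  qed (use v in auto)
qed

section \<open>Vector identities in three-space\<close>

lemma triple_expansion:
  fixes u v w z :: "real^3"
  shows "(u \<bullet> (v \<times> w)) *\<^sub>R z = (z \<bullet> (v \<times> w)) *\<^sub>R u + (z \<bullet> (w \<times> u)) *\<^sub>R v + (z \<bullet> (u \<times> v)) *\<^sub>R w"
  by (simp add: cross3_simps forall_3)

text \<open>The expansion of \<open>z\<close> in the basis reciprocal to \<open>u\<close>,
  \<open>v\<close>, \<open>w\<close>. As in the preceding form of Cramer's rule, the determinant is
  kept as a factor, so that the identity also holds for dependent vectors.\<close>

lemma triple_expansion_dual:
  fixes u v w z :: "real^3"
  shows "(u \<bullet> (v \<times> w)) *\<^sub>R z = (z \<bullet> u) *\<^sub>R (v \<times> w) + (z \<bullet> v) *\<^sub>R (w \<times> u) + (z \<bullet> w) *\<^sub>R (u \<times> v)"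
  by (simp add: cross3_simps forall_3)

text \<open>The vector areas of the faces of a pyramid with apex \<open>y\<close> balance, so the
  lateral faces together have the vector area of the base.\<close>

lemma cross_triangle:
  fixes p q r y :: "real^3"
  shows "(q - p) \<times> (r - p) = (p - y) \<times> (q - y) + (q - y) \<times> (r - y) + (r - y) \<times> (p - y)"
  by (simp add: cross3_simps forall_3)

lemma eq_scaleR_cross:
  fixes n u v :: "real^3"
  assumes "n \<bullet> u = 0" "n \<bullet> v = 0"
  shows "((u \<times> v) \<bullet> (u \<times> v)) *\<^sub>R n = ((u \<times> v) \<bullet> n) *\<^sub>R (u \<times> v)"
proof -
  have "n \<times> (u \<times> v) = 0" using assms by (simp add: Lagrange)
  then show ?thesis using Lagrange[of "u \<times> v" n "u \<times> v"] by simp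
qed

section \<open>The weight, its integrals and the Bernoulli functions\<close>

lemma wt_pos: "0 < wt \<epsilon> \<beta> z" by (simp add: wt_def)

lemma wt_add: "wt \<epsilon> \<beta> (a + b) = wt \<epsilon> \<beta> a * exp ((\<beta> \<bullet> b) / \<epsilon>)"
  by (simp add: wt_def inner_add_right exp_add divide_inverse mult.commute)

lemma wt_has_derivative:
  "(wt \<epsilon> \<beta> has_derivative (\<lambda>h. wt \<epsilon> \<beta> z * ((\<beta> /\<^sub>R \<epsilon>) \<bullet> h))) (at z within S)"
  unfolding wt_def by (auto intro!: derivative_eq_intros)

lemma continuous_on_wt: "continuous_on S (wt \<epsilon> \<beta>)"
  unfolding wt_def by (intro continuous_intros)

context
  fixes \<epsilon> :: real and \<beta> :: "real^3"
begin

private abbreviation "E0 \<equiv> wt \<epsilon> \<beta>"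
private abbreviation "E1 \<equiv> seg_int (wt \<epsilon> \<beta>)"
private abbreviation "E2 \<equiv> tri_int (wt \<epsilon> \<beta>)"
private abbreviation "E3 \<equiv> tet_int (wt \<epsilon> \<beta>)"

lemma wt_int_pos: "0 < E1 a b" "0 < E2 a b c" "0 < E3 a b c d"
  using seg_int_pos[of UNIV E0 a b] tri_int_pos[of UNIV E0 a b c] tet_int_pos[of UNIV E0 a b c d]
  by (simp_all add: continuous_on_wt wt_pos)

lemma wt_int_swap:
  "E1 a b = E1 b a" "E2 a b c = E2 b a c" "E2 a b c = E2 a c b"
  "E3 a b c d = E3 b a c d" "E3 a b c d = E3 a c b d" "E3 a b c d = E3 a b d c"
  by (rule seg_int_swap tri_int_swap12 tet_int_swap12 tri_int_swap23[of UNIV]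
      tet_int_swap23[of UNIV] tet_int_swap34[of UNIV]; simp add: continuous_on_wt)+

text \<open>The directional derivative of the weight is a constant multiple of the weight itself;
  integrating it leaves a difference of integrals over two faces.\<close>

lemma wt_int_recurrence:
  "((\<beta> /\<^sub>R \<epsilon>) \<bullet> (b - a)) * E2 a b c = E1 b c - E1 a c"
  "((\<beta> /\<^sub>R \<epsilon>) \<bullet> (b - a)) * E3 a b c d = E2 b c d - E2 a c d"
proof -
  note [simp] = mult.commute[of "E0 _"] tri_int_cmult tet_int_cmult
  show "((\<beta> /\<^sub>R \<epsilon>) \<bullet> (b - a)) * E2 a b c = E1 b c - E1 a c"
    using tri_int_deriv[OF wt_has_derivative[of \<epsilon> \<beta> _ UNIV], of a b c] by (simp del: inner_scaleR_left)
  show "((\<beta> /\<^sub>R \<epsilon>) \<bullet> (b - a)) * E3 a b c d = E2 b c d - E2 a c d"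
    using tet_int_deriv[OF wt_has_derivative[of \<epsilon> \<beta> _ UNIV], of a b c d] by (simp del: inner_scaleR_left)
qed

text \<open>Factoring out the weight at \<open>p\<close> turns the exponentials of edge increments
  into the weight at the points of the simplex with vertex \<open>p\<close>.\<close>

lemma exp_int_wt:
  "exp_int1 \<epsilon> (\<beta> \<bullet> (q - p)) = E1 p q / E0 p"
  "exp_int2 \<epsilon> (\<beta> \<bullet> (q - p)) (\<beta> \<bullet> (r - p)) = E2 p q r / E0 p"
  "exp_int3 \<epsilon> (\<beta> \<bullet> (q - p)) (\<beta> \<bullet> (r - p)) (\<beta> \<bullet> (s - p)) = E3 p q r s / E0 p"
proof -
  have 1: "E0 (p + s *\<^sub>R u) = E0 p * exp ((\<beta> \<bullet> u) * s / \<epsilon>)" for s u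
    by (simp add: wt_add mult_ac)
  have 2: "E0 (p + s *\<^sub>R u + t *\<^sub>R v) = E0 p * exp (((\<beta> \<bullet> u) * s + (\<beta> \<bullet> v) * t) / \<epsilon>)" for s t u v
    using wt_add[of \<epsilon> \<beta> p "s *\<^sub>R u + t *\<^sub>R v"] by (simp add: inner_add_right mult_ac add_ac)
  have 3: "E0 (p + r *\<^sub>R w + s *\<^sub>R u + t *\<^sub>R v) =
      E0 p * exp (((\<beta> \<bullet> w) * r + (\<beta> \<bullet> u) * s + (\<beta> \<bullet> v) * t) / \<epsilon>)" for r s t u v w
    using wt_add[of \<epsilon> \<beta> p "r *\<^sub>R w + s *\<^sub>R u + t *\<^sub>R v"] by (simp add: inner_add_right mult_ac add_ac)
  show "exp_int1 \<epsilon> (\<beta> \<bullet> (q - p)) = E1 p q / E0 p"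
    by (simp add: exp_int1_def seg_int_def 1 wt_pos[THEN less_imp_neq, THEN not_sym])
  show "exp_int2 \<epsilon> (\<beta> \<bullet> (q - p)) (\<beta> \<bullet> (r - p)) = E2 p q r / E0 p"
    by (simp add: exp_int2_def tri_int_def 2 wt_pos[THEN less_imp_neq, THEN not_sym])
  \<comment> \<open>\<open>exp_int3\<close> and \<open>tet_int\<close> write the innermost upper
    limit with the subtractions in different order.\<close>
  have "1 - s - t = 1 - t - (s::real)" for s t by simp
  then show "exp_int3 \<epsilon> (\<beta> \<bullet> (q - p)) (\<beta> \<bullet> (r - p)) (\<beta> \<bullet> (s - p)) = E3 p q r s / E0 p"
    by (simp add: exp_int3_def tet_int_def 3 wt_pos[THEN less_imp_neq, THEN not_sym])
qed

lemma B_wt: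
  "B1 \<epsilon> (\<beta> \<bullet> (q - p)) = \<epsilon> * E0 p / E1 p q"
  "B2 \<epsilon> (\<beta> \<bullet> (q - p)) (\<beta> \<bullet> (r - p)) = \<epsilon> * E1 p q / (2 * E2 p q r)"
  "B3 \<epsilon> (\<beta> \<bullet> (q - p)) (\<beta> \<bullet> (r - p)) (\<beta> \<bullet> (s - p)) = \<epsilon> * E2 p q r / (3 * E3 p q r s)"
  using wt_pos[of \<epsilon> \<beta> p] by (simp_all add: B1_def B2_def B3_def exp_int_wt)

text \<open>Up to a constant factor, \<open>pyramid_flux\<close> is the integral of \<open>E n\<close> over the lateral faces of the
  pyramid with apex \<open>y\<close>, and \<open>pyramid_flux_eq\<close> says that the integral of \<open>E n\<close> over its whole
  boundary is the integral of \<open>\<theta> E\<close>.\<close>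

definition pyramid_flux :: "real^3 \<Rightarrow> real^3 \<Rightarrow> real^3 \<Rightarrow> real^3 \<Rightarrow> real^3" where
  "pyramid_flux y p q r = E2 y p q *\<^sub>R ((p - y) \<times> (q - y)) + E2 y q r *\<^sub>R ((q - y) \<times> (r - y))
     + E2 y r p *\<^sub>R ((r - y) \<times> (p - y))"

lemma pyramid_flux_eq:
  "pyramid_flux y p q r = E2 p q r *\<^sub>R ((q - p) \<times> (r - p))
     - (E3 y p q r * ((p - y) \<bullet> ((q - y) \<times> (r - y)))) *\<^sub>R (\<beta> /\<^sub>R \<epsilon>)"
proof -
  let ?t = "\<beta> /\<^sub>R \<epsilon>"
  \<comment> \<open>Each lateral integral differs from that of the base by the recurrence in the
    direction from the apex to the base vertex that it lacks.\<close>
  have e1: "E2 y q r = E2 p q r - (?t \<bullet> (p - y)) * E3 y p q r"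
    using wt_int_recurrence(2)[of p y q r] by simp
  have e2: "E2 y r p = E2 p q r - (?t \<bullet> (q - y)) * E3 y p q r"
    using wt_int_recurrence(2)[of q y r p] wt_int_swap(2,3) wt_int_swap(5,6)
    by (metis add_diff_cancel_left' diff_add_cancel)
  have e3: "E2 y p q = E2 p q r - (?t \<bullet> (r - y)) * E3 y p q r"
    using wt_int_recurrence(2)[of r y p q] wt_int_swap(2,3) wt_int_swap(5,6)
    by (metis add_diff_cancel_left' diff_add_cancel)
  \<comment> \<open>Expanding \<theta> in the reciprocal basis of the three lateral edges produces
    the same correction terms.\<close>
  have e4: "(E3 y p q r * ((p - y) \<bullet> ((q - y) \<times> (r - y)))) *\<^sub>R ?t =
      E3 y p q r *\<^sub>R ((?t \<bullet> (p - y)) *\<^sub>R ((q - y) \<times> (r - y)) +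
        (?t \<bullet> (q - y)) *\<^sub>R ((r - y) \<times> (p - y)) + (?t \<bullet> (r - y)) *\<^sub>R ((p - y) \<times> (q - y)))"
    by (simp only: triple_expansion_dual flip: scaleR_scaleR)
  have alg: "(e - k * f) *\<^sub>R Z + (e - i * f) *\<^sub>R X + (e - j * f) *\<^sub>R Y =
      e *\<^sub>R (Z + X + Y) - f *\<^sub>R (i *\<^sub>R X + j *\<^sub>R Y + k *\<^sub>R Z)" for e f i j k and X Y Z :: "real^3"
    by (simp add: algebra_simps)
  show ?thesis
    unfolding pyramid_flux_def e1 e2 e3 e4 cross_triangle[of q p r y] by (rule alg)
qed

end

section \<open>Geometry of the tetrahedron\<close>

text \<open>The vertex index \<open>1\<close> must not be rewritten to \<open>Suc 0\<close>.\<close>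

declare One_nat_def [simp del]

locale tetrahedron =
  fixes x :: "nat \<Rightarrow> real^3" and \<epsilon> :: real and \<beta> :: "real^3"
  assumes nondeg: "nondegenerate x" and eps: "\<epsilon> > 0"
begin

abbreviation "E0 \<equiv> wt \<epsilon> \<beta>"
abbreviation "E1 \<equiv> seg_int (wt \<epsilon> \<beta>)"
abbreviation "E2 \<equiv> tri_int (wt \<epsilon> \<beta>)"
abbreviation "E3 \<equiv> tet_int (wt \<epsilon> \<beta>)"

abbreviation "P m k \<equiv> x (skip m k)"

text \<open>Six times the signed volume. The vertex numbering may have either orientation, so the
  sign is carried along in \<open>orient\<close>.\<close>

definition D0 :: real where
  "D0 = (x 2 - x 1) \<bullet> ((x 3 - x 1) \<times> (x 4 - x 1))"

text \<open>The normal \<open>W m\<close> of the facet opposite \<open>x m\<close> is formed with the increasing order of the vertices;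
  it points outwards iff \<open>orient m = 1\<close>.\<close>

definition alt :: "nat \<Rightarrow> real" where
  "alt m = (if odd m then 1 else -1)"

definition orient :: "nat \<Rightarrow> real" where
  "orient m = sgn D0 * alt m"

definition W :: "nat \<Rightarrow> real^3" where
  "W m = (P m 2 - P m 1) \<times> (P m 3 - P m 1)"

text \<open>Six times the signed volume of the subtetrahedron with apex \<open>y\<close>, base
  vertices in increasing order.\<close>

definition D :: "real^3 \<Rightarrow> nat \<Rightarrow> real" where
  "D y m = (P m 1 - y) \<bullet> ((P m 2 - y) \<times> (P m 3 - y))"

definition N :: "real^3 \<Rightarrow> nat \<Rightarrow> real^3" where
  "N y m = pyramid_flux \<epsilon> \<beta> y (P m 1) (P m 2) (P m 3)"

abbreviation "E2f m \<equiv> E2 (P m 1) (P m 2) (P m 3)"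
abbreviation "E3f y m \<equiv> E3 y (P m 1) (P m 2) (P m 3)"

section \<open>Signed volumes and barycentric coordinates\<close>

lemma indices: "{1..4} = {1, 2, 3, 4::nat}" by auto

lemma tetra_eq: "tetra x = convex hull {x 1, x 2, x 3, x 4}"
  by (simp add: tetra_def indices)

lemma convex_tetra: "convex (tetra x)"
  by (simp add: tetra_def)

lemma vertex_in_tetra: "i \<in> {1..4} \<Longrightarrow> x i \<in> tetra x"
  unfolding tetra_def by (intro hull_inc) auto

lemma skip_simps:
  "skip 1 1 = 2" "skip 1 2 = 3" "skip 1 3 = 4" "skip 2 1 = 1" "skip 2 2 = 3" "skip 2 3 = 4"
  "skip 3 1 = 1" "skip 3 2 = 2" "skip 3 3 = 4" "skip 4 1 = 1" "skip 4 2 = 2" "skip 4 3 = 3"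
  by (simp_all add: skip_def)

lemma skip_in: "m \<in> {1..4} \<Longrightarrow> k \<in> {1..3} \<Longrightarrow> skip m k \<in> {1..4}"
  by (auto simp: skip_def)

lemma skip_complement: "m \<in> {1..4} \<Longrightarrow> {1..4} - {m} = {skip m 1, skip m 2, skip m 3}"
  unfolding indices by (auto simp: skip_simps)

lemma alt_simps: "alt 1 = 1" "alt 2 = -1" "alt 3 = 1" "alt 4 = -1"
  by (simp_all add: alt_def)

text \<open>If the determinant vanished, the coordinates of a kernel vector, with minus their sum at
  \<open>x 1\<close>, would form an affine dependence.\<close>

lemma D0_nonzero: "D0 \<noteq> 0"
proof
  assume "D0 = 0"
  then have "\<not> inj (lin3 (x 2 - x 1) (x 3 - x 1) (x 4 - x 1))"
    using det_nz_iff_inj[OF linear_lin3, of "x 2 - x 1" "x 3 - x 1" "x 4 - x 1"]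
    by (simp add: det_lin3 D0_def)
  then obtain z where z: "lin3 (x 2 - x 1) (x 3 - x 1) (x 4 - x 1) z = 0" "z \<noteq> 0"
    using linear_injective_0[OF linear_lin3] by blast
  have dist: "x i \<noteq> x j" if "i \<in> {1..4}" "j \<in> {1..4}" "i \<noteq> j" for i j
    using nondeg that by (auto simp: nondegenerate_def inj_on_def)
  \<comment> \<open>Affine dependence is phrased with coefficients on points rather than on indices,
    so the evaluation of \<open>U\<close> relies on the vertices being distinct.\<close>
  define U where "U p = (if p = x 2 then z$1 else if p = x 3 then z$2 else if p = x 4 then z$3
      else - (z$1 + z$2 + z$3))" for p
  have d: "x 1 \<noteq> x 2" "x 1 \<noteq> x 3" "x 1 \<noteq> x 4" "x 2 \<noteq> x 3" "x 2 \<noteq> x 4" "x 3 \<noteq> x 4"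
    by (intro dist; simp)+
  have U: "U (x 1) = - (z$1 + z$2 + z$3)" "U (x 2) = z$1" "U (x 3) = z$2" "U (x 4) = z$3"
    using d d[symmetric] by (auto simp: U_def)
  have "sum U (x ` {1..4}) = 0"
    using d d[symmetric] by (simp add: indices U)
  moreover have "(\<Sum>v\<in>x ` {1..4}. U v *\<^sub>R v) = lin3 (x 2 - x 1) (x 3 - x 1) (x 4 - x 1) z"
    using d d[symmetric] by (simp add: indices U lin3_def algebra_simps)
  moreover have "\<exists>v\<in>x ` {1..4}. U v \<noteq> 0"
    using z(2) by (auto simp: indices U vec_eq_iff forall_3)
  ultimately have "affine_dependent (x ` {1..4})"
    using z(1) by (subst affine_dependent_explicit_finite) auto
  then show False using nondeg by (simp add: nondegenerate_def)
qed

lemma orient_sq: "orient m * orient m = 1"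
  using D0_nonzero by (auto simp: orient_def alt_def sgn_if)

lemma orient_cases: "orient m = 1 \<or> orient m = -1"
  using D0_nonzero by (auto simp: orient_def alt_def sgn_if)

text \<open>The total vector area of a closed surface vanishes; the factors \<open>alt m\<close>
  orient all facets consistently.\<close>

lemma sum_alt_W: "(\<Sum>m\<in>{1..4}. alt m *\<^sub>R W m) = 0"
  unfolding indices by (simp add: alt_simps W_def skip_simps cross3_simps forall_3)

text \<open>Each triangle spanned by \<open>y\<close> and an edge is a lateral face of two pyramids,
  with opposite orientations, so all terms cancel in pairs.\<close>

lemma sum_alt_N: "(\<Sum>m\<in>{1..4}. alt m *\<^sub>R N y m) = 0"
proof -
  have sw: "E2 y a b *\<^sub>R (u \<times> v) = - (E2 y b a *\<^sub>R (v \<times> u))" for a b u v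
    using wt_int_swap(3)[of \<epsilon> \<beta> y a b] cross_skew[of u v] by simp
  show ?thesis
    unfolding indices
    using sw[of "x 2" "x 4" "x 2 - y" "x 4 - y"] sw[of "x 1" "x 3" "x 1 - y" "x 3 - y"]
    by (simp add: alt_simps N_def pyramid_flux_def skip_simps)
qed

text \<open>Up to the factor \<open>alt m * D0\<close>, the affine function
  \<open>W m \<bullet> (P m 1 - z)\<close> is the barycentric coordinate of \<open>z\<close>
  belonging to \<open>x m\<close>.\<close>

lemma W_inner:
  assumes "m \<in> {1..4}" "i \<in> {1..4}"
  shows "W m \<bullet> (P m 1 - x i) = (if i = m then alt m * D0 else 0)"
proof -
  have m: "W m \<bullet> (P m 1 - x m) = alt m * D0"
    using assms(1) unfolding indices
    by (auto simp: W_def D0_def skip_simps alt_simps cross3_simps)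
  have k: "W m \<bullet> (P m 1 - P m k) = 0" if "k \<in> {1..3}" for k
  proof -
    have "k \<in> {1, 2, 3}" using that by auto
    then have "W m \<bullet> (P m k - P m 1) = 0"
      by (auto simp: W_def dot_cross_self inner_commute)
    then show ?thesis by (simp add: inner_diff_right)
  qed
  have "W m \<bullet> (P m 1 - x i) = 0" if "i \<noteq> m"
  proof -
    have "i = skip m 1 \<or> i = skip m 2 \<or> i = skip m 3"
      using skip_complement[OF assms(1)] assms(2) that by blast
    then show ?thesis using k[of 1] k[of 2] k[of 3] by auto
  qed
  with m show ?thesis by simp
qed

lemma D_eq: "D y m = W m \<bullet> (P m 1 - y)"
  unfolding D_def W_def cross_triangle[of "P m 2" "P m 1" "P m 3" y]
  by (simp add: inner_add_left dot_cross_self inner_commute[of "P m 1 - y"])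

text \<open>Signed subtetrahedron volumes are multiples of the barycentric coordinates by
  \<open>alt m * D0\<close>, which fixes their signs on all of \<open>tetra x\<close>, with value
  zero on the facet \<open>m\<close>.\<close>

lemma barycentric:
  assumes "y \<in> tetra x"
  obtains \<kappa> :: "nat \<Rightarrow> real" where "\<And>m. m \<in> {1..4} \<Longrightarrow> 0 \<le> \<kappa> m"
    "\<And>m. m \<in> {1..4} \<Longrightarrow> D y m = alt m * \<kappa> m * D0"
    "(\<Sum>m\<in>{1..4}. \<kappa> m) = 1" "(\<Sum>m\<in>{1..4}. \<kappa> m *\<^sub>R (x m - y)) = 0"
proof -
  obtain v where v: "v \<in> std3" and y: "y = aff3 (x 1) (x 2) (x 3) (x 4) v"
    using assms unfolding tetra_eq aff3_image[symmetric] by blast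
  define \<kappa> where "\<kappa> m = (if m = 1 then 1 - v$1 - v$2 - v$3 else if m = 2 then v$1
      else if m = 3 then v$2 else v$3)" for m :: nat
  define a u v' w where "a = x 1" and "u = x 2 - x 1" and "v' = x 3 - x 1" and "w = x 4 - x 1"
  have x: "x 1 = a" "x 2 = a + u" "x 3 = a + v'" "x 4 = a + w"
    by (simp_all add: a_def u_def v'_def w_def)
  have y': "y = a + v$1 *\<^sub>R u + v$2 *\<^sub>R v' + v$3 *\<^sub>R w"
    by (simp add: y aff3_def a_def u_def v'_def w_def)
  have sum1: "(\<Sum>m\<in>{1..4}. \<kappa> m) = 1" by (simp add: indices \<kappa>_def)
  have sum0: "(\<Sum>m\<in>{1..4}. \<kappa> m *\<^sub>R (x m - y)) = 0"
    by (simp add: indices \<kappa>_def x y' algebra_simps)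
  have D: "D y m = alt m * \<kappa> m * D0" if m: "m \<in> {1..4}" for m
  proof -
    \<comment> \<open>The coordinates sum to 1, so \<open>P m 1 - y\<close> splits in this way; the
      first sum is zero, and by \<open>W_inner\<close> only the term \<open>i = m\<close> of the
      second contributes.\<close>
    have "P m 1 - y = (\<Sum>i\<in>{1..4}. \<kappa> i *\<^sub>R (x i - y)) + (\<Sum>i\<in>{1..4}. \<kappa> i *\<^sub>R (P m 1 - x i))"
      by (simp add: sum1 flip: sum.distrib scaleR_add_right scaleR_sum_left)
    then have "D y m = (\<Sum>i\<in>{1..4}. \<kappa> i * (W m \<bullet> (P m 1 - x i)))"
      by (simp add: D_eq sum0 inner_sum_right)
    also have "\<dots> = (\<Sum>i\<in>{1..4}. if i = m then alt m * \<kappa> m * D0 else 0)"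
      by (rule sum.cong) (auto simp: W_inner[OF m])
    also have "\<dots> = alt m * \<kappa> m * D0" using m by simp
    finally show ?thesis .
  qed
  have "0 \<le> \<kappa> m" for m using v by (auto simp: \<kappa>_def std3_def)
  then show ?thesis using that D sum1 sum0 by blast
qed

section \<open>Identities for the pyramid fluxes\<close>

lemma N_eq: "N y m = E2f m *\<^sub>R W m - (E3f y m * D y m) *\<^sub>R (\<beta> /\<^sub>R \<epsilon>)"
  unfolding N_def W_def D_def by (rule pyramid_flux_eq)

text \<open>Inserting \<open>N_eq\<close> into the cancellation \<open>sum_alt_N\<close> leaves a
  balance between the facet integrals and \<theta>.\<close>

lemma sum_alt_E2_W:
  "(\<Sum>m\<in>{1..4}. alt m *\<^sub>R (E2f m *\<^sub>R W m)) = (\<Sum>m\<in>{1..4}. alt m * (E3f y m * D y m)) *\<^sub>R (\<beta> /\<^sub>R \<epsilon>)"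
proof -
  define t where "t = \<beta> /\<^sub>R \<epsilon>"
  have "(\<Sum>m\<in>{1..4}. alt m *\<^sub>R (E2f m *\<^sub>R W m)) -
      (\<Sum>m\<in>{1..4}. alt m * (E3f y m * D y m)) *\<^sub>R t = (\<Sum>m\<in>{1..4}. alt m *\<^sub>R N y m)"
    unfolding N_eq t_def[symmetric] by (simp only: scaleR_diff_right sum_subtractf scaleR_sum_left scaleR_scaleR)
  then show ?thesis using sum_alt_N by (simp add: t_def)
qed

text \<open>Both sides are the integral of the weight over the tetrahedron, up to the same factor. They
  agree after multiplication by \<open>\<beta>\<close>, because the expression in \<open>sum_alt_E2_W\<close> does not depend on
  the apex.\<close>

lemma sum_alt_E3:
  assumes "y \<in> tetra x"
  shows "(\<Sum>m\<in>{1..4}. alt m * (E3f y m * D y m)) = D0 * E3 (x 1) (x 2) (x 3) (x 4)"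
proof (cases "\<beta> = 0")
  case True
  obtain \<kappa> :: "nat \<Rightarrow> real" where \<kappa>: "\<And>m. m \<in> {1..4} \<Longrightarrow> D y m = alt m * \<kappa> m * D0"
    "(\<Sum>m\<in>{1..4}. \<kappa> m) = 1"
    using barycentric[OF assms] by metis
  \<comment> \<open>With zero \<beta> the weight is 1 and all values of \<open>E3\<close> agree, so
    the claim reduces to the barycentric coordinates summing to 1.\<close>
  define k where "k = E3 0 0 0 0"
  have k: "E3 a b c d = k" for a b c d
    unfolding k_def tet_int_def by (simp add: True wt_def)
  have "(\<Sum>m\<in>{1..4}. alt m * (E3f y m * D y m)) = (\<Sum>m\<in>{1..4}. \<kappa> m) * (k * D0)"
    unfolding k sum_distrib_right by (rule sum.cong) (auto simp: \<kappa>(1) alt_def)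
  then show ?thesis by (simp add: \<kappa>(2) k)
next
  case False
  \<comment> \<open>The apex \<open>x 4\<close> lies in the planes of the facets 1, 2 and 3, so only
    the term for \<open>m = 4\<close> survives.\<close>
  have "(\<Sum>m\<in>{1..4}. alt m * (E3f (x 4) m * D (x 4) m)) = D0 * E3 (x 4) (x 1) (x 2) (x 3)"
    using W_inner[of _ 4] by (simp add: indices D_eq alt_simps skip_simps)
  also have "E3 (x 4) (x 1) (x 2) (x 3) = E3 (x 1) (x 2) (x 3) (x 4)"
    using wt_int_swap(4-6) by metis
  finally show ?thesis
    using sum_alt_E2_W[of y] sum_alt_E2_W[of "x 4"] False eps by auto
qed

section \<open>Criteria for a vector to vanish\<close>

lemma vertices_span:
  assumes "\<And>s t. s \<in> {1..4} \<Longrightarrow> t \<in> {1..4} \<Longrightarrow> (x s - x t) \<bullet> \<phi> = 0"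
  shows "\<phi> = 0"
proof -
  have "D0 *\<^sub>R \<phi> = 0"
    unfolding D0_def by (subst triple_expansion_dual) (use assms in \<open>simp add: inner_commute[of \<phi>]\<close>)
  then show ?thesis using D0_nonzero by simp
qed

text \<open>The facets 2, 3 and 4 meet at \<open>x 1\<close>, and their normals form, up to scaling,
  the reciprocal basis of the edges there.\<close>

lemma normals_span:
  assumes "\<And>m. m \<in> {1..4} \<Longrightarrow> W m \<bullet> \<phi> = 0"
  shows "\<phi> = 0"
proof -
  have "\<phi> \<bullet> ((x 3 - x 1) \<times> (x 4 - x 1)) = 0" "\<phi> \<bullet> ((x 4 - x 1) \<times> (x 2 - x 1)) = 0"
    "\<phi> \<bullet> ((x 2 - x 1) \<times> (x 3 - x 1)) = 0"
    using assms[of 2] assms[of 3] assms[of 4] cross_skew[of "x 4 - x 1" "x 2 - x 1"]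
    by (simp_all add: W_def skip_simps inner_commute)
  then have "D0 *\<^sub>R \<phi> = 0"
    unfolding D0_def by (subst triple_expansion) simp
  then show ?thesis using D0_nonzero by simp
qed

text \<open>If all pyramid fluxes are orthogonal to \<open>\<phi>\<close>, then the numbers \<open>alt m * (W m \<bullet> \<phi>)\<close>, whose sum
  vanishes, all have the sign of \<open>D0 * (\<beta> \<bullet> \<phi>)\<close>, hence are zero.\<close>

lemma pyramid_fluxes_span:
  assumes y: "y \<in> tetra x" and N: "\<And>m. m \<in> {1..4} \<Longrightarrow> N y m \<bullet> \<phi> = 0"
  shows "\<phi> = 0"
proof (rule normals_span)
  obtain \<kappa> :: "nat \<Rightarrow> real" where \<kappa>: "\<And>m. m \<in> {1..4} \<Longrightarrow> 0 \<le> \<kappa> m"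
    "\<And>m. m \<in> {1..4} \<Longrightarrow> D y m = alt m * \<kappa> m * D0"
    using barycentric[OF y] by metis
  define c where "c = D0 * ((\<beta> /\<^sub>R \<epsilon>) \<bullet> \<phi>)"
  define k where "k m = E3f y m * \<kappa> m / E2f m" for m
  have k: "0 \<le> k m" if "m \<in> {1..4}" for m
    using \<kappa>(1)[OF that] wt_int_pos by (simp add: k_def less_imp_le)
  have W: "alt m * (W m \<bullet> \<phi>) = k m * c" if "m \<in> {1..4}" for m
  proof -
    have "E2f m * (W m \<bullet> \<phi>) = E3f y m * (alt m * \<kappa> m * D0) * ((\<beta> /\<^sub>R \<epsilon>) \<bullet> \<phi>)"
      using N[OF that] \<kappa>(2)[OF that] by (simp add: N_eq inner_diff_left)
    then have "alt m * (E2f m * (W m \<bullet> \<phi>)) = alt m * alt m * (E3f y m * \<kappa> m * c)"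
      by (simp add: c_def)
    moreover have "alt m * alt m = 1" by (simp add: alt_def)
    ultimately show ?thesis
      using wt_int_pos(2)[of \<epsilon> \<beta> "P m 1" "P m 2" "P m 3"] by (simp add: k_def field_simps)
  qed
  have "(\<Sum>m\<in>{1..4}. k m * c) = (\<Sum>m\<in>{1..4}. alt m *\<^sub>R W m) \<bullet> \<phi>"
    by (simp add: inner_sum_left W)
  \<comment> \<open>As every \<open>k m\<close> is nonnegative, the vanishing product forces
    \<open>c\<close> or all the \<open>k m\<close> to be zero.\<close>
  then have "(\<Sum>m\<in>{1..4}. k m) * c = 0"
    by (simp add: sum_alt_W sum_distrib_right)
  then have kc: "k m * c = 0" if "m \<in> {1..4}" for m
    using sum_nonneg_eq_0_iff[of "{1..4}" k] k that by auto
  then show "W m \<bullet> \<phi> = 0" if "m \<in> {1..4}" for m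
    using W[OF that] kc[OF that] by (simp add: alt_def split: if_splits)
qed

section \<open>Outward normals and volumes of subtetrahedra\<close>

lemma W_nonzero: "m \<in> {1..4} \<Longrightarrow> W m \<noteq> 0"
  using W_inner[of m m] D0_nonzero by (auto simp: alt_def split: if_splits)

lemma W_outward:
  assumes "m \<in> {1..4}"
  shows "0 < orient m * (W m \<bullet> (P m 1 - x m))"
proof -
  have "orient m * (W m \<bullet> (P m 1 - x m)) = alt m * alt m * (sgn D0 * D0)"
    by (simp add: orient_def W_inner[OF assms assms])
  also have "\<dots> = \<bar>D0\<bar>" by (simp add: alt_def abs_sgn mult.commute)
  finally show ?thesis using D0_nonzero by simp
qed

text \<open>Orthogonality to two edges makes a candidate a multiple of \<open>W m\<close>; unit
  length fixes the modulus of the factor, and the outward condition its sign.\<close>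

lemma normal_eq:
  assumes m: "m \<in> {1..4}"
  shows "normal x m = (orient m / norm (W m)) *\<^sub>R W m"
  unfolding normal_def
proof (rule the_equality)
  let ?n = "(orient m / norm (W m)) *\<^sub>R W m"
  have Wn: "norm (W m) > 0" using W_nonzero[OF m] by simp
  have o: "\<bar>orient m\<bar> = 1" using orient_cases[of m] by auto
  have W2: "W m \<bullet> (P m 2 - P m 1) = 0" and W3: "W m \<bullet> (P m 3 - P m 1) = 0"
    by (simp_all add: W_def dot_cross_self inner_commute)
  have WP: "W m \<bullet> P m 2 = W m \<bullet> P m 1" "W m \<bullet> P m 3 = W m \<bullet> P m 1"
    using W2 W3 by (simp_all add: inner_diff_right)
  have pos: "0 < ?n \<bullet> (P m 1 - x m)"
    using W_outward[OF m] Wn by simp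
  show "norm ?n = 1 \<and> (\<forall>p\<in>{1..4} - {m}. \<forall>q\<in>{1..4} - {m}. ?n \<bullet> (x q - x p) = 0) \<and>
      (\<forall>p\<in>{1..4} - {m}. 0 < ?n \<bullet> (x p - x m))"
    unfolding skip_complement[OF m] using pos Wn o by (auto simp: inner_diff_right WP)
  fix n assume n: "norm n = 1 \<and> (\<forall>p\<in>{1..4} - {m}. \<forall>q\<in>{1..4} - {m}. n \<bullet> (x q - x p) = 0) \<and>
      (\<forall>p\<in>{1..4} - {m}. 0 < n \<bullet> (x p - x m))"
  then have n1: "norm n = 1" and n2: "n \<bullet> (P m 2 - P m 1) = 0" "n \<bullet> (P m 3 - P m 1) = 0"
    and n3: "0 < n \<bullet> (P m 1 - x m)"
    unfolding skip_complement[OF m] by auto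
  define k where "k = (W m \<bullet> n) / (W m \<bullet> W m)"
  have "(W m \<bullet> W m) *\<^sub>R n = (W m \<bullet> n) *\<^sub>R W m"
    unfolding W_def by (rule eq_scaleR_cross[OF n2])
  then have nk: "n = k *\<^sub>R W m"
    using W_nonzero[OF m] unfolding k_def
    by (metis (no_types, lifting) divide_inverse_commute inner_eq_zero_iff scaleR_left_imp_eq
        scaleR_scaleR right_inverse scaleR_one)
  have "\<bar>k\<bar> = 1 / norm (W m)" using n1 Wn by (simp add: nk field_simps)
  moreover have "0 < k * (W m \<bullet> (P m 1 - x m))" using n3 by (simp add: nk)
  then have "0 < (k * orient m) * (orient m * (W m \<bullet> (P m 1 - x m)))"
    using orient_sq[of m] by (simp add: mult_ac) (simp flip: mult.assoc)
  then have "0 < k * orient m"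
    using W_outward[OF m] by (simp add: zero_less_mult_iff)
  ultimately have "k = orient m / norm (W m)"
    using orient_cases[of m] by auto
  then show "n = ?n" by (simp add: nk)
qed

text \<open>By \<open>barycentric\<close> the signed volume has the sign of \<open>orient m\<close>
  or is zero, so the absolute value in the volume formula can be resolved uniformly.\<close>

lemma volume_subtetra:
  assumes y: "y \<in> tetra x" and m: "m \<in> {1..4}"
  shows "6 * volume (subtetra x y m) = orient m * D y m"
proof -
  obtain \<kappa> :: "nat \<Rightarrow> real" where \<kappa>: "\<And>m. m \<in> {1..4} \<Longrightarrow> 0 \<le> \<kappa> m"
    "\<And>m. m \<in> {1..4} \<Longrightarrow> D y m = alt m * \<kappa> m * D0"
    using barycentric[OF y] by metis
  have "subtetra x y m = convex hull {y, P m 1, P m 2, P m 3}"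
    by (simp add: subtetra_def skip_complement[OF m])
  then have "6 * volume (subtetra x y m) = \<bar>D y m\<bar>"
    by (simp add: volume_def measure_tetrahedron D_def)
  also have "\<dots> = orient m * D y m"
    using \<kappa>(1)[OF m] by (auto simp: \<kappa>(2)[OF m] abs_mult alt_def orient_def abs_sgn[of D0])
  finally show ?thesis .
qed

end

section \<open>The linear systems\<close>

lemma convex_combination_pos:
  fixes \<kappa> c :: "'k \<Rightarrow> real"
  assumes "finite I" "\<And>i. i \<in> I \<Longrightarrow> 0 \<le> \<kappa> i" "sum \<kappa> I = 1" "\<And>i. i \<in> I \<Longrightarrow> 0 < c i"
  shows "0 < (\<Sum>i\<in>I. \<kappa> i * c i)"
proof -
  have "\<not> (\<forall>i\<in>I. \<kappa> i = 0)" using assms(3) by (metis sum.neutral zero_neq_one)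
  then obtain i where "i \<in> I" "0 < \<kappa> i" using assms(2) by force
  then show ?thesis using assms
    by (intro sum_pos2[of I i]) (auto intro: mult_nonneg_nonneg less_imp_le)
qed

lemma pyramid_flux_rotate: "pyramid_flux \<epsilon> \<beta> y q r p = pyramid_flux \<epsilon> \<beta> y p q r"
  by (simp add: pyramid_flux_def)

lemma pyramid_flux_swap: "pyramid_flux \<epsilon> \<beta> y p r q = - pyramid_flux \<epsilon> \<beta> y p q r"
proof -
  have sw: "tri_int (wt \<epsilon> \<beta>) y a b *\<^sub>R ((a - y) \<times> (b - y)) = - (tri_int (wt \<epsilon> \<beta>) y b a *\<^sub>R ((b - y) \<times> (a - y)))"
    for a b
    using wt_int_swap(3)[of \<epsilon> \<beta> y a b] cross_skew[of "a - y" "b - y"] by simp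
  show ?thesis
    unfolding pyramid_flux_def using sw[of p r] sw[of r q] sw[of q p] by simp
qed

text \<open>Reduces the quantifier over orderings in \<open>facet_system\<close> to six cases, which
  form two cyclic classes.\<close>

lemma triple_permutations:
  assumes "i \<noteq> j" "j \<noteq> k" "i \<noteq> k" "{p, q, r} = {i, j, k}"
  shows "(p, q, r) \<in> {(i, j, k), (j, k, i), (k, i, j), (i, k, j), (k, j, i), (j, i, k)}"
proof -
  have "p \<in> {i, j, k}" "q \<in> {i, j, k}" "r \<in> {i, j, k}" using assms(4) by blast+
  moreover have "i \<in> {p, q, r}" "j \<in> {p, q, r}" "k \<in> {p, q, r}" using assms(4) by blast+
  ultimately show ?thesis using assms(1-3) by auto
qed

context tetrahedron
begin

section \<open>The systems with denominators cleared\<close>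

definition vertex_op :: "real^3 \<Rightarrow> nat \<Rightarrow> (real^3) * real \<Rightarrow> real" where
  "vertex_op y s = (\<lambda>(j, \<phi>). E1 y (x s) * ((x s - y) \<bullet> j) + \<epsilon> * E0 y * \<phi>)"

definition edge_op :: "real^3 \<Rightarrow> nat \<Rightarrow> nat \<Rightarrow> (real^3) * (real^3) \<Rightarrow> real" where
  "edge_op y s t = (\<lambda>(j, \<phi>). E2 y (x s) (x t) * (j \<bullet> ((x s - y) \<times> (x t - y)))
     + \<epsilon> * (E1 y (x t) * (\<phi> \<bullet> (x t - y)) - E1 y (x s) * (\<phi> \<bullet> (x s - y))))"

text \<open>Besides clearing denominators, the facet equation is multiplied by
  \<open>orient m\<close>; the increasing order of the base vertices then serves for either
  orientation.\<close>

definition facet_op :: "real^3 \<Rightarrow> nat \<Rightarrow> real * (real^3) \<Rightarrow> real" where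
  "facet_op y m = (\<lambda>(j, \<phi>). D y m * E3f y m * j + \<epsilon> * (N y m \<bullet> \<phi>))"

lemma linear_vertex_op: "linear (vertex_op y s)"
  unfolding vertex_op_def case_prod_unfold
  by (rule linearI) (simp_all add: algebra_simps inner_add_right)

lemma linear_edge_op: "linear (edge_op y s t)"
  unfolding edge_op_def case_prod_unfold
  by (rule linearI) (simp_all add: algebra_simps inner_add_left)

lemma linear_facet_op: "linear (facet_op y m)"
  unfolding facet_op_def case_prod_unfold
  by (rule linearI) (simp_all add: algebra_simps inner_add_right)

lemma sigma_uminus: "- (\<beta> \<bullet> (p - q)) = \<beta> \<bullet> (q - p)"
  by (simp add: inner_diff_right)

lemma vertex_system_iff:
  "vertex_system x \<epsilon> \<beta> i y j \<phi> \<longleftrightarrow>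
     (\<forall>s\<in>{1..4}. vertex_op y s (j, \<phi>) = \<epsilon> * E0 (x s) * of_bool (i = s))"
  unfolding vertex_system_def Let_def sigma_uminus B_wt
proof (intro ball_cong refl)
  fix s
  \<comment> \<open>The left coefficient comes from the edge seen from \<open>y\<close>, the right
    one from the same edge seen from \<open>x s\<close>; symmetry gives a common
    denominator.\<close>
  have "E1 (x s) y = E1 y (x s)" by (rule wt_int_swap)
  then show "((x s - y) \<bullet> j + \<epsilon> * E0 y / E1 y (x s) * \<phi> = \<epsilon> * E0 (x s) / E1 (x s) y * of_bool (i = s)) =
      (vertex_op y s (j, \<phi>) = \<epsilon> * E0 (x s) * of_bool (i = s))"
    using wt_int_pos(1)[of \<epsilon> \<beta> y "x s"] by (simp add: vertex_op_def field_simps)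
qed

lemma edge_system_iff:
  "edge_system x \<epsilon> \<beta> i k y j \<phi> \<longleftrightarrow>
     (\<forall>s\<in>{1..4}. \<forall>t\<in>{s<..4}. edge_op y s t (j, \<phi>) =
        \<epsilon> * E1 (x s) (x t) * (of_bool (i = s) * of_bool (k = t)))"
  unfolding edge_system_def Let_def sigma_uminus B_wt
proof (intro ball_cong refl)
  fix s t
  \<comment> \<open>All three Bernoulli coefficients have the integral over this triangle in the
    denominator, up to the order of its vertices.\<close>
  define e where "e = E2 y (x s) (x t)"
  have e: "e > 0" "E2 y (x s) (x t) = e" "E2 y (x t) (x s) = e" "E2 (x s) (x t) y = e"
    unfolding e_def using wt_int_pos(2) wt_int_swap(2,3) by metis+
  have "(j \<bullet> ((x s - y) \<times> (x t - y) /\<^sub>R 2)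
        - \<epsilon> * E1 y (x s) / (2 * e) * (\<phi> \<bullet> (x s - y)) + \<epsilon> * E1 y (x t) / (2 * e) * (\<phi> \<bullet> (x t - y)) =
        \<epsilon> * E1 (x s) (x t) / (2 * e) * of_bool (i = s) * of_bool (k = t)) \<longleftrightarrow>
      e * (j \<bullet> ((x s - y) \<times> (x t - y)))
        + \<epsilon> * (E1 y (x t) * (\<phi> \<bullet> (x t - y)) - E1 y (x s) * (\<phi> \<bullet> (x s - y))) =
      \<epsilon> * E1 (x s) (x t) * (of_bool (i = s) * of_bool (k = t))" (is "(?l1 = ?r1) \<longleftrightarrow> (?l2 = ?r2)")
  proof -
    have l: "?l2 = 2 * e * ?l1" and r: "?r2 = 2 * e * ?r1"
      using e(1) by (simp_all add: field_simps)
    have "2 * e \<noteq> 0" using e(1) by simp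
    then show ?thesis unfolding l r by (simp only: mult_cancel_left simp_thms)
  qed
  then show "(j \<bullet> ((x s - y) \<times> (x t - y) /\<^sub>R 2)
        - \<epsilon> * E1 y (x s) / (2 * E2 y (x s) (x t)) * (\<phi> \<bullet> (x s - y))
        + \<epsilon> * E1 y (x t) / (2 * E2 y (x t) (x s)) * (\<phi> \<bullet> (x t - y)) =
        \<epsilon> * E1 (x s) (x t) / (2 * E2 (x s) (x t) y) * of_bool (i = s) * of_bool (k = t)) =
      (edge_op y s t (j, \<phi>) = \<epsilon> * E1 (x s) (x t) * (of_bool (i = s) * of_bool (k = t)))"
    unfolding edge_op_def e(2-4) case_prod_conv .
qed

lemma facet_equation_iff:
  "V * j + (B3 \<epsilon> (\<beta> \<bullet> (p - y)) (\<beta> \<bullet> (q - y)) (\<beta> \<bullet> (r - y)) *\<^sub>R (((p - y) \<times> (q - y)) /\<^sub>R 2)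
      + B3 \<epsilon> (\<beta> \<bullet> (q - y)) (\<beta> \<bullet> (r - y)) (\<beta> \<bullet> (p - y)) *\<^sub>R (((q - y) \<times> (r - y)) /\<^sub>R 2)
      + B3 \<epsilon> (\<beta> \<bullet> (r - y)) (\<beta> \<bullet> (p - y)) (\<beta> \<bullet> (q - y)) *\<^sub>R (((r - y) \<times> (p - y)) /\<^sub>R 2)) \<bullet> \<phi>
    = B3 \<epsilon> (\<beta> \<bullet> (q - p)) (\<beta> \<bullet> (r - p)) (- (\<beta> \<bullet> (p - y))) * d
   \<longleftrightarrow> 6 * V * E3 y p q r * j + \<epsilon> * (pyramid_flux \<epsilon> \<beta> y p q r \<bullet> \<phi>) = 2 * \<epsilon> * E2 p q r * d"
proof -
  define e where "e = E3 y p q r"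
  have e: "e > 0" "E3 y p q r = e" "E3 y q r p = e" "E3 y r p q = e" "E3 p q r y = e"
    unfolding e_def using wt_int_pos(3) wt_int_swap(4-6) by metis+
  have ne: "6 * e \<noteq> 0" using e(1) by simp
  have l: "6 * e * (V * j + ((\<epsilon> * E2 y p q / (3 * e)) *\<^sub>R (((p - y) \<times> (q - y)) /\<^sub>R 2)
      + (\<epsilon> * E2 y q r / (3 * e)) *\<^sub>R (((q - y) \<times> (r - y)) /\<^sub>R 2)
      + (\<epsilon> * E2 y r p / (3 * e)) *\<^sub>R (((r - y) \<times> (p - y)) /\<^sub>R 2)) \<bullet> \<phi>) =
      6 * V * e * j + \<epsilon> * (pyramid_flux \<epsilon> \<beta> y p q r \<bullet> \<phi>)"
    using e(1) by (simp add: pyramid_flux_def inner_add_left field_simps)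
  have r: "6 * e * (\<epsilon> * E2 p q r / (3 * e) * d) = 2 * \<epsilon> * E2 p q r * d"
    using e(1) by (simp add: field_simps)
  show ?thesis
    unfolding sigma_uminus B_wt e(2-5) l[symmetric] r[symmetric]
    using ne by (simp only: mult_cancel_left simp_thms)
qed

lemma W_normal: "m \<in> {1..4} \<Longrightarrow> W m \<bullet> normal x m = orient m * norm (W m)"
  using W_nonzero[of m] by (simp add: normal_eq dot_square_norm power2_eq_square)

text \<open>Equations for cyclic permutations coincide, so two representatives \<open>a b c\<close>
  and \<open>a c b\<close> remain. The sign of \<open>orient m\<close> decides which of them is
  positively oriented; reversing the order changes the sign of the pyramid flux.\<close>

lemma facet_system_iff:
  assumes y: "y \<in> tetra x"
  shows "facet_system x \<epsilon> \<beta> i y j \<phi> \<longleftrightarrow>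
     (\<forall>m\<in>{1..4}. facet_op y m (j, \<phi>) = 2 * \<epsilon> * orient m * E2f m * of_bool (i = m))"
  unfolding facet_system_def Let_def facet_equation_iff
proof (intro ball_cong refl)
  fix m :: nat assume m: "m \<in> {1..4}"
  define V where "V = 6 * volume (subtetra x y m)"
  have V: "V = orient m * D y m" unfolding V_def by (rule volume_subtetra[OF y m])
  define a b c where "a = skip m 1" and "b = skip m 2" and "c = skip m 3"
  have dist: "a \<noteq> b" "b \<noteq> c" "a \<noteq> c"
    using m unfolding indices by (auto simp: a_def b_def c_def skip_simps)
  have compl: "{1..4} - {m} = {a, b, c}"
    unfolding a_def b_def c_def by (rule skip_complement[OF m])
  define T where "T p q r = ((x q - x p) \<times> (x r - x p)) \<bullet> normal x m" for p q r
  define A where "A p q r \<longleftrightarrow> V * E3 y (x p) (x q) (x r) * j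
    + \<epsilon> * (pyramid_flux \<epsilon> \<beta> y (x p) (x q) (x r) \<bullet> \<phi>) = 2 * \<epsilon> * E2 (x p) (x q) (x r) * of_bool (i = m)" for p q r
  have T_rot: "T q r p = T p q r" and T_swap: "T p r q = - T p q r" for p q r
    unfolding T_def by (simp_all add: cross3_simps)
  have E_rot: "E2 v w u = E2 u v w" "E3 y v w u = E3 y u v w"
    and E_swap: "E2 u w v = E2 u v w" "E3 y u w v = E3 y u v w" for u v w
    using wt_int_swap by metis+
  have A_rot: "A q r p = A p q r" for p q r
    unfolding A_def pyramid_flux_rotate[of _ _ _ "x q" "x r" "x p"] E_rot[of "x q" "x r" "x p"] ..
  have T_abc: "T a b c = orient m * norm (W m)"
    unfolding T_def a_def b_def c_def using W_normal[OF m] by (simp add: W_def)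
  have pos: "norm (W m) > 0" using W_nonzero[OF m] by simp
  have A_abc: "A a b c \<longleftrightarrow> orient m * D y m * E3f y m * j + \<epsilon> * (N y m \<bullet> \<phi>) = 2 * \<epsilon> * E2f m * of_bool (i = m)"
    unfolding A_def V N_def a_def b_def c_def ..
  have A_acb: "A a c b \<longleftrightarrow> orient m * D y m * E3f y m * j - \<epsilon> * (N y m \<bullet> \<phi>) = 2 * \<epsilon> * E2f m * of_bool (i = m)"
    unfolding A_def V N_def a_def b_def c_def pyramid_flux_swap[of _ _ _ "P m 1" "P m 3" "P m 2"]
      E_swap[of "P m 1" "P m 3" "P m 2"] by (simp add: inner_minus_left)
  have "(\<forall>p q r. {p, q, r} = {1..4} - {m} \<longrightarrow> 0 < T p q r \<longrightarrow> A p q r) \<longleftrightarrow>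
      (0 < T a b c \<longrightarrow> A a b c) \<and> (0 < T a c b \<longrightarrow> A a c b)" (is "?L \<longleftrightarrow> ?R")
  proof
    assume ?L
    moreover have "{a, b, c} = {1..4} - {m}" "{a, c, b} = {1..4} - {m}" unfolding compl by auto
    ultimately show ?R by blast
  next
    assume R: ?R
    show ?L
    proof (intro allI impI)
      fix p q r assume "{p, q, r} = {1..4} - {m}" and T: "0 < T p q r"
      then have "(p, q, r) \<in> {(a, b, c), (b, c, a), (c, a, b), (a, c, b), (c, b, a), (b, a, c)}"
        using triple_permutations[OF dist] by (simp only: compl)
      then show "A p q r"
        using R T T_rot[of a b c] T_rot[of b c a] A_rot[of a b c] A_rot[of b c a]
          T_rot[of a c b] T_rot[of c b a] A_rot[of a c b] A_rot[of c b a]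
        by auto
    qed
  qed
  also have "\<dots> \<longleftrightarrow> facet_op y m (j, \<phi>) = 2 * \<epsilon> * orient m * E2f m * of_bool (i = m)"
    using orient_cases[of m]
  proof
    assume o: "orient m = 1"
    then show ?thesis using pos by (simp add: T_swap[of a c b] T_abc A_abc A_acb facet_op_def)
  next
    assume o: "orient m = - 1"
    then have "?thesis \<longleftrightarrow> (- (D y m * E3f y m * j) - \<epsilon> * (N y m \<bullet> \<phi>) = 2 * \<epsilon> * E2f m * of_bool (i = m) \<longleftrightarrow>
        D y m * E3f y m * j + \<epsilon> * (N y m \<bullet> \<phi>) = - (2 * \<epsilon> * E2f m * of_bool (i = m)))"
      using pos by (simp add: T_swap[of a c b] T_abc A_abc A_acb facet_op_def)
    then show ?thesis by linarith
  qed
  finally show "(\<forall>p q r. {p, q, r} = {1..4} - {m} \<longrightarrow>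
      0 < ((x q - x p) \<times> (x r - x p)) \<bullet> normal x m \<longrightarrow>
      6 * volume (subtetra x y m) * E3 y (x p) (x q) (x r) * j +
      \<epsilon> * (pyramid_flux \<epsilon> \<beta> y (x p) (x q) (x r) \<bullet> \<phi>) =
      2 * \<epsilon> * E2 (x p) (x q) (x r) * of_bool (i = m)) =
     (facet_op y m (j, \<phi>) = 2 * \<epsilon> * orient m * E2f m * of_bool (i = m))"
    unfolding T_def A_def V_def .
qed

section \<open>Unique solvability\<close>

lemma vertex_op_unique:
  assumes y: "y \<in> tetra x"
  shows "\<exists>!p. \<forall>s\<in>{1..4}. vertex_op y s p = R s"
proof (rule unique_linear_solution)
  obtain \<kappa> :: "nat \<Rightarrow> real" where \<kappa>: "\<And>m. m \<in> {1..4} \<Longrightarrow> 0 \<le> \<kappa> m"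
    and "\<And>m. m \<in> {1..4} \<Longrightarrow> D y m = alt m * \<kappa> m * D0"
    and \<kappa>': "(\<Sum>m\<in>{1..4}. \<kappa> m) = 1" "(\<Sum>m\<in>{1..4}. \<kappa> m *\<^sub>R (x m - y)) = 0"
    by (rule barycentric[OF y]) blast
  fix p assume p: "\<And>s. s \<in> {1..4} \<Longrightarrow> vertex_op y s p = 0"
  obtain j \<phi> where jp: "p = (j, \<phi>)" by (cases p)
  have l: "(x s - y) \<bullet> j = - (\<epsilon> * E0 y * \<phi>) * (1 / E1 y (x s))" if "s \<in> {1..4}" for s
    using p[OF that] wt_int_pos(1)[of \<epsilon> \<beta> y "x s"] by (simp add: jp vertex_op_def field_simps)
  \<comment> \<open>The vectors \<open>x s - y\<close> with barycentric weights sum to zero, so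
    \<open>j\<close> drops out and \<phi> is left with a nonzero factor.\<close>
  have "(\<Sum>s\<in>{1..4}. \<kappa> s * (1 / E1 y (x s))) * - (\<epsilon> * E0 y * \<phi>) = (\<Sum>s\<in>{1..4}. \<kappa> s * ((x s - y) \<bullet> j))"
    unfolding sum_distrib_right by (rule sum.cong) (use l in auto)
  also have "\<dots> = (\<Sum>m\<in>{1..4}. \<kappa> m *\<^sub>R (x m - y)) \<bullet> j" by (simp add: inner_sum_left)
  finally have "(\<Sum>s\<in>{1..4}. \<kappa> s * (1 / E1 y (x s))) * - (\<epsilon> * E0 y * \<phi>) = 0" by (simp add: \<kappa>'(2))
  moreover have "0 < (\<Sum>s\<in>{1..4}. \<kappa> s * (1 / E1 y (x s)))"
    by (rule convex_combination_pos) (use \<kappa> \<kappa>' wt_int_pos(1) in auto)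
  ultimately have "\<phi> = 0" using eps wt_pos[of \<epsilon> \<beta> y] by auto
  moreover have "j = 0"
    by (rule vertices_span) (use l \<open>\<phi> = 0\<close> in \<open>auto simp: inner_diff_left\<close>)
  ultimately show "p = 0" by (simp add: jp zero_prod_def)
qed (auto simp: linear_vertex_op)

lemma N_inner:
  "N y m \<bullet> j = E2 y (P m 1) (P m 2) * (j \<bullet> ((P m 1 - y) \<times> (P m 2 - y)))
    + E2 y (P m 2) (P m 3) * (j \<bullet> ((P m 2 - y) \<times> (P m 3 - y)))
    - E2 y (P m 1) (P m 3) * (j \<bullet> ((P m 1 - y) \<times> (P m 3 - y)))"
  using wt_int_swap(3)[of \<epsilon> \<beta> y "P m 3" "P m 1"] cross_skew[of "P m 3 - y" "P m 1 - y"]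
  by (simp add: N_def pyramid_flux_def inner_add_left inner_diff_left inner_commute[of j])

lemma skip_less:
  assumes "m \<in> {1..4}"
  shows "skip m 1 \<in> {1..4}" "skip m 2 \<in> {1..4}" "skip m 2 \<in> {skip m 1<..4}"
    "skip m 3 \<in> {skip m 2<..4}" "skip m 3 \<in> {skip m 1<..4}"
  using assms by (auto simp: skip_def)

text \<open>Around the boundary of a facet the terms with \<phi> telescope. This serves both for
  uniqueness and for \<open>commute1\<close>.\<close>

lemma edge_op_cycle:
  "edge_op y (skip m 1) (skip m 2) (j, \<phi>) + edge_op y (skip m 2) (skip m 3) (j, \<phi>)
     - edge_op y (skip m 1) (skip m 3) (j, \<phi>) = N y m \<bullet> j"
  by (simp add: edge_op_def N_inner algebra_simps)

text \<open>The cycle identity eliminates \<phi>, whence \<open>pyramid_fluxes_span\<close> gives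
  \<open>j = 0\<close>; the remaining equations are treated with barycentric weights as in the
  vertex case. The six edges match the dimension of the unknown pair.\<close>

lemma edge_op_unique:
  assumes y: "y \<in> tetra x"
  shows "\<exists>!p. \<forall>s\<in>{1..4}. \<forall>t\<in>{s<..4}. edge_op y s t p = R s t"
proof -
  have "\<exists>!p. \<forall>e\<in>Sigma {1..4} (\<lambda>s. {s<..4}). (\<lambda>(s, t). edge_op y s t) e p = (\<lambda>(s, t). R s t) e"
  proof (rule unique_linear_solution)
    have "{1<..4} = {2, 3, 4::nat}" "{2<..4} = {3, 4::nat}" "{3<..4} = {4::nat}" by auto
    then show "card (Sigma {1..4} (\<lambda>s. {s<..4::nat})) = DIM((real^3) * (real^3))"
      by (simp add: indices)
    obtain \<kappa> :: "nat \<Rightarrow> real" where \<kappa>: "\<And>m. m \<in> {1..4} \<Longrightarrow> 0 \<le> \<kappa> m"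
      and "\<And>m. m \<in> {1..4} \<Longrightarrow> D y m = alt m * \<kappa> m * D0"
      and \<kappa>': "(\<Sum>m\<in>{1..4}. \<kappa> m) = 1" "(\<Sum>m\<in>{1..4}. \<kappa> m *\<^sub>R (x m - y)) = 0"
      by (rule barycentric[OF y]) blast
    fix p assume "\<And>e. e \<in> Sigma {1..4} (\<lambda>s. {s<..4}) \<Longrightarrow> (case e of (s, t) \<Rightarrow> edge_op y s t) p = 0"
    then have p: "edge_op y s t p = 0" if "s \<in> {1..4}" "t \<in> {s<..4}" for s t
      using that by force
    obtain j \<phi> where jp: "p = (j, \<phi>)" by (cases p)
    have j: "j = 0"
    proof (rule pyramid_fluxes_span[OF y])
      fix m :: nat assume m: "m \<in> {1..4}"
      show "N y m \<bullet> j = 0"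
        using edge_op_cycle[of y m j \<phi>] p skip_less[OF m] by (simp add: jp)
    qed
    \<comment> \<open>With \<open>j = 0\<close>, the equation for the pair \<open>(1, s)\<close>
      says that this quantity has the same value at every vertex.\<close>
    define c where "c = E1 y (x 1) * (\<phi> \<bullet> (x 1 - y))"
    have l: "\<phi> \<bullet> (x s - y) = c * (1 / E1 y (x s))" if "s \<in> {1..4}" for s
    proof -
      have "E1 y (x s) * (\<phi> \<bullet> (x s - y)) = c"
      proof (cases "s = 1")
        case False
        then have "edge_op y 1 s p = 0" using that by (intro p) auto
        then show ?thesis using eps by (simp add: jp j edge_op_def c_def)
      qed (simp add: c_def)
      then show ?thesis using wt_int_pos(1)[of \<epsilon> \<beta> y "x s"] by (simp add: field_simps)
    qed
    have "(\<Sum>s\<in>{1..4}. \<kappa> s * (1 / E1 y (x s))) * c = (\<Sum>s\<in>{1..4}. \<kappa> s * (\<phi> \<bullet> (x s - y)))"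
      unfolding sum_distrib_right by (rule sum.cong) (use l in auto)
    also have "\<dots> = \<phi> \<bullet> (\<Sum>m\<in>{1..4}. \<kappa> m *\<^sub>R (x m - y))" by (simp add: inner_sum_right)
    finally have "(\<Sum>s\<in>{1..4}. \<kappa> s * (1 / E1 y (x s))) * c = 0" by (simp add: \<kappa>'(2))
    moreover have "0 < (\<Sum>s\<in>{1..4}. \<kappa> s * (1 / E1 y (x s)))"
      by (rule convex_combination_pos) (use \<kappa> \<kappa>' wt_int_pos(1) in auto)
    ultimately have c: "c = 0" by auto
    have "\<phi> = 0"
      by (rule vertices_span) (use l c in \<open>auto simp: inner_diff_right inner_commute[of _ \<phi>]\<close>)
    then show "p = 0" by (simp add: jp j zero_prod_def)
  qed (auto simp: linear_edge_op)
  moreover have "(\<forall>e\<in>Sigma {1..4} (\<lambda>s. {s<..4}). (\<lambda>(s, t). edge_op y s t) e p = (\<lambda>(s, t). R s t) e) \<longleftrightarrow>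
      (\<forall>s\<in>{1..4}. \<forall>t\<in>{s<..4}. edge_op y s t p = R s t)" for p
    by auto
  ultimately show ?thesis by (simp only:)
qed

text \<open>The pyramid fluxes cancel, which removes \<phi>, and the volume terms add up to the
  integral over the whole tetrahedron.\<close>

lemma sum_alt_facet_op:
  assumes y: "y \<in> tetra x"
  shows "(\<Sum>m\<in>{1..4}. alt m * facet_op y m (j, \<phi>)) = D0 * E3 (x 1) (x 2) (x 3) (x 4) * j"
proof -
  have "(\<Sum>m\<in>{1..4}. alt m * facet_op y m (j, \<phi>)) =
      (\<Sum>m\<in>{1..4}. alt m * (E3f y m * D y m)) * j + \<epsilon> * ((\<Sum>m\<in>{1..4}. alt m *\<^sub>R N y m) \<bullet> \<phi>)"
    by (simp add: facet_op_def inner_sum_left sum_distrib_left sum_distrib_right sum.distrib algebra_simps)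
  then show ?thesis by (simp only: sum_alt_N sum_alt_E3[OF y] inner_zero_left)
qed

lemma facet_op_unique:
  assumes y: "y \<in> tetra x"
  shows "\<exists>!p. \<forall>m\<in>{1..4}. facet_op y m p = R m"
proof (rule unique_linear_solution)
  fix p assume p: "\<And>m. m \<in> {1..4} \<Longrightarrow> facet_op y m p = 0"
  obtain j \<phi> where jp: "p = (j, \<phi>)" by (cases p)
  have "D0 * E3 (x 1) (x 2) (x 3) (x 4) * j = 0"
    unfolding sum_alt_facet_op[OF y, of j \<phi>, symmetric] using p by (simp add: jp)
  then have j: "j = 0" using D0_nonzero wt_int_pos(3)[of \<epsilon> \<beta> "x 1" "x 2" "x 3" "x 4"] by auto
  have "\<phi> = 0"
    by (rule pyramid_fluxes_span[OF y]) (use p eps in \<open>auto simp: jp j facet_op_def\<close>)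
  then show "p = 0" by (simp add: jp j zero_prod_def)
qed (auto simp: linear_facet_op)

section \<open>Basis functions and superposition\<close>

lemma vertex_op_basis:
  assumes "y \<in> tetra x" "s \<in> {1..4}"
  shows "vertex_op y s (jV x \<epsilon> \<beta> i y, phiV x \<epsilon> \<beta> i y) = \<epsilon> * E0 (x s) * of_bool (i = s)"
proof -
  have "\<exists>!p. case p of (j, \<phi>) \<Rightarrow> vertex_system x \<epsilon> \<beta> i y j \<phi>"
    unfolding vertex_system_iff case_prod_unfold prod.collapse by (rule vertex_op_unique[OF assms(1)])
  from theI'[OF this] show ?thesis
    using assms(2) by (simp add: jV_def phiV_def case_prod_unfold vertex_system_iff)
qed

lemma edge_op_basis:
  assumes "y \<in> tetra x" "s \<in> {1..4}" "t \<in> {s<..4}"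
  shows "edge_op y s t (jE x \<epsilon> \<beta> i k y, phiE x \<epsilon> \<beta> i k y) =
    \<epsilon> * E1 (x s) (x t) * (of_bool (i = s) * of_bool (k = t))"
proof -
  have "\<exists>!p. case p of (j, \<phi>) \<Rightarrow> edge_system x \<epsilon> \<beta> i k y j \<phi>"
    unfolding edge_system_iff case_prod_unfold prod.collapse by (rule edge_op_unique[OF assms(1)])
  from theI'[OF this] show ?thesis
    using assms(2,3) by (simp add: jE_def phiE_def case_prod_unfold edge_system_iff)
qed

lemma facet_op_basis:
  assumes "y \<in> tetra x" "m \<in> {1..4}"
  shows "facet_op y m (jF x \<epsilon> \<beta> i y, phiF x \<epsilon> \<beta> i y) = 2 * \<epsilon> * orient m * E2f m * of_bool (i = m)"
proof -
  have "\<exists>!p. case p of (j, \<phi>) \<Rightarrow> facet_system x \<epsilon> \<beta> i y j \<phi>"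
    unfolding facet_system_iff[OF assms(1)] case_prod_unfold prod.collapse
    by (rule facet_op_unique[OF assms(1)])
  from theI'[OF this] show ?thesis
    using assms(2) by (simp add: jF_def phiF_def case_prod_unfold facet_system_iff[OF assms(1)])
qed

text \<open>Superposition: the coefficients \<open>c\<close> are the data of the system that the
  combined pair solves. Duality and the commuting diagrams access the basis functions only through
  this lemma and its analogues.\<close>

lemma vertex_op_sum:
  assumes "y \<in> tetra x" "s \<in> {1..4}"
  shows "vertex_op y s (\<Sum>i\<in>{1..4}. c i *\<^sub>R jV x \<epsilon> \<beta> i y, \<Sum>i\<in>{1..4}. c i * phiV x \<epsilon> \<beta> i y) =
    \<epsilon> * E0 (x s) * c s"
proof -
  have "(\<Sum>i\<in>{1..4}. c i *\<^sub>R jV x \<epsilon> \<beta> i y, \<Sum>i\<in>{1..4}. c i * phiV x \<epsilon> \<beta> i y) =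
      (\<Sum>i\<in>{1..4}. c i *\<^sub>R (jV x \<epsilon> \<beta> i y, phiV x \<epsilon> \<beta> i y))"
    by (simp add: prod_eq_iff fst_sum snd_sum)
  then show ?thesis
    using assms(2)
    by (simp add: linear_sum[OF linear_vertex_op] linear_cmul[OF linear_vertex_op]
        vertex_op_basis[OF assms] sum.delta of_bool_def if_distrib cong: if_cong del: scaleR_Pair)
qed

lemma edge_op_sum:
  assumes "y \<in> tetra x" "s \<in> {1..4}" "t \<in> {s<..4}"
  shows "edge_op y s t (\<Sum>i\<in>{1..4}. \<Sum>k\<in>{i<..4}. c i k *\<^sub>R jE x \<epsilon> \<beta> i k y,
      \<Sum>i\<in>{1..4}. \<Sum>k\<in>{i<..4}. c i k *\<^sub>R phiE x \<epsilon> \<beta> i k y) = \<epsilon> * E1 (x s) (x t) * c s t"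
proof -
  have "(\<Sum>i\<in>{1..4}. \<Sum>k\<in>{i<..4}. c i k *\<^sub>R jE x \<epsilon> \<beta> i k y,
      \<Sum>i\<in>{1..4}. \<Sum>k\<in>{i<..4}. c i k *\<^sub>R phiE x \<epsilon> \<beta> i k y) =
      (\<Sum>i\<in>{1..4}. \<Sum>k\<in>{i<..4}. c i k *\<^sub>R (jE x \<epsilon> \<beta> i k y, phiE x \<epsilon> \<beta> i k y))"
    by (simp add: prod_eq_iff fst_sum snd_sum)
  then have "edge_op y s t (\<Sum>i\<in>{1..4}. \<Sum>k\<in>{i<..4}. c i k *\<^sub>R jE x \<epsilon> \<beta> i k y,
      \<Sum>i\<in>{1..4}. \<Sum>k\<in>{i<..4}. c i k *\<^sub>R phiE x \<epsilon> \<beta> i k y) =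
      (\<Sum>i\<in>{1..4}. \<Sum>k\<in>{i<..4}. c i k * (\<epsilon> * E1 (x s) (x t) * (of_bool (i = s) * of_bool (k = t))))"
    by (simp add: linear_sum[OF linear_edge_op] linear_cmul[OF linear_edge_op] edge_op_basis[OF assms] del: scaleR_Pair)
  also have "\<dots> = (\<Sum>i\<in>{1..4}. if i = s then \<epsilon> * E1 (x s) (x t) * c s t else 0)"
  proof (rule sum.cong)
    fix i
    have "(\<Sum>k\<in>{s<..4}. c s k * (\<epsilon> * E1 (x s) (x t) * of_bool (k = t))) = \<epsilon> * E1 (x s) (x t) * c s t"
      using assms(3) by (simp add: of_bool_def if_distrib sum.delta cong: if_cong)
    then show "(\<Sum>k\<in>{i<..4}. c i k * (\<epsilon> * E1 (x s) (x t) * (of_bool (i = s) * of_bool (k = t)))) =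
        (if i = s then \<epsilon> * E1 (x s) (x t) * c s t else 0)"
      by simp
  qed simp
  also have "\<dots> = \<epsilon> * E1 (x s) (x t) * c s t" using assms(2) by simp
  finally show ?thesis .
qed

lemma facet_op_sum:
  assumes "y \<in> tetra x" "m \<in> {1..4}"
  shows "facet_op y m (\<Sum>i\<in>{1..4}. c i * jF x \<epsilon> \<beta> i y, \<Sum>i\<in>{1..4}. c i *\<^sub>R phiF x \<epsilon> \<beta> i y) =
    2 * \<epsilon> * orient m * E2f m * c m"
proof -
  have "(\<Sum>i\<in>{1..4}. c i * jF x \<epsilon> \<beta> i y, \<Sum>i\<in>{1..4}. c i *\<^sub>R phiF x \<epsilon> \<beta> i y) =
      (\<Sum>i\<in>{1..4}. c i *\<^sub>R (jF x \<epsilon> \<beta> i y, phiF x \<epsilon> \<beta> i y))"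
    by (simp add: prod_eq_iff fst_sum snd_sum)
  then show ?thesis
    using assms(2)
    by (simp add: linear_sum[OF linear_facet_op] linear_cmul[OF linear_facet_op]
        facet_op_basis[OF assms] sum.delta of_bool_def if_distrib cong: if_cong del: scaleR_Pair)
qed

end

section \<open>Stokes theorems and the commuting diagrams\<close>

lemma smooth_onD:
  assumes "smooth_on S f"
  shows "z \<in> S \<Longrightarrow> (f has_derivative frechet_derivative f (at z within S)) (at z within S)"
    and "continuous_on S f"
    and "continuous_on S (\<lambda>z. frechet_derivative f (at z within S) v)"
proof -
  have "Ck_on (Suc 0) S f" using assms by (simp add: smooth_on_def)
  then have *: "f differentiable_on S" "continuous_on S (\<lambda>z. frechet_derivative f (at z within S) v)"
    by simp_all
  then show "continuous_on S (\<lambda>z. frechet_derivative f (at z within S) v)"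
    and "continuous_on S f" by (simp_all add: differentiable_imp_continuous_on)
  show "z \<in> S \<Longrightarrow> (f has_derivative frechet_derivative f (at z within S)) (at z within S)"
    using *(1) by (simp add: differentiable_on_def frechet_derivative_works)
qed

section \<open>Gradient, curl and divergence in terms of edge directions\<close>

lemma linear_grad_on:
  assumes "linear (frechet_derivative u (at z within S))"
  shows "grad_on S u z \<bullet> v = frechet_derivative u (at z within S) v"
proof -
  have "v = (\<Sum>i\<in>UNIV. v $ i *\<^sub>R axis i 1)"
    by (simp add: vec_eq_iff axis_def if_distrib cong: if_cong)
  from arg_cong[OF this, of "frechet_derivative u (at z within S)"]
  have "frechet_derivative u (at z within S) v =
      (\<Sum>i\<in>UNIV. v $ i * frechet_derivative u (at z within S) (axis i 1))"
    by (simp add: linear_sum[OF assms] linear_cmul[OF assms])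
  then show ?thesis by (simp add: grad_on_def inner_vec_def mult.commute)
qed

text \<open>The curl encodes the antisymmetric part of the derivative; in this form it is the
  exterior derivative of a one-form evaluated on two directions.\<close>

lemma curl_cross:
  assumes "linear (frechet_derivative w (at z within S))"
  shows "curl_on S w z \<bullet> (u \<times> v) =
    frechet_derivative w (at z within S) u \<bullet> v - frechet_derivative w (at z within S) v \<bullet> u"
proof -
  have "frechet_derivative w (at z within S) h = jacobian w (at z within S) *v h" for h
    by (simp add: jacobian_def matrix_works[OF assms[folded linear_matrix_vector_mul_eq]])
  then show ?thesis
    by (simp add: curl_on_def Let_def matrix_vector_mult_def cross3_simps)
qed

text \<open>Replacing each argument of a determinant in turn by its image under a linear map, and
  adding, gives the trace of the map times the determinant.\<close>

lemma div_triple: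
  assumes "linear (frechet_derivative f (at z within S))"
  shows "(u \<bullet> (v \<times> w)) * div_on S f z =
    frechet_derivative f (at z within S) u \<bullet> (v \<times> w)
    + frechet_derivative f (at z within S) v \<bullet> (w \<times> u)
    + frechet_derivative f (at z within S) w \<bullet> (u \<times> v)"
proof -
  have "frechet_derivative f (at z within S) h = jacobian f (at z within S) *v h" for h
    by (simp add: jacobian_def matrix_works[OF assms[folded linear_matrix_vector_mul_eq]])
  then show ?thesis
    by (simp add: div_on_def trace_def matrix_vector_mult_def cross3_simps)
qed

context tetrahedron
begin

section \<open>Degrees of freedom and interpolation coefficients\<close>

lemma vertices_distinct:
  "i \<in> {1..4} \<Longrightarrow> j \<in> {1..4} \<Longrightarrow> i \<noteq> j \<Longrightarrow> x i \<noteq> x j"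
  using nondeg by (auto simp: nondegenerate_def inj_on_def)

lemma dof1_eq: "dof1 x s t v = seg_int (\<lambda>z. v z \<bullet> (x t - x s)) (x s) (x t)"
proof (cases "x s = x t")
  case True
  then show ?thesis by (simp add: dof1_def edge_integral_def segment_integral_def seg_int_def)
next
  case False
  then have "norm (x t - x s) > 0" by simp
  then show ?thesis
    by (simp add: dof1_def edge_integral_def segment_integral_def tangent_def seg_int_def)
qed

text \<open>The doubled area in the Jacobian cancels the normalisation of \<open>W m\<close>,
  leaving only its orientation.\<close>

lemma dof2_eq:
  assumes m: "m \<in> {1..4}"
  shows "dof2 x m v = orient m * tri_int (\<lambda>z. v z \<bullet> W m) (P m 1) (P m 2) (P m 3)"
proof -
  have "norm (W m) > 0" using W_nonzero[OF m] by simp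
  then show ?thesis
    by (simp add: dof2_def facet_integral_def triangle_integral_def normal_eq[OF m] tri_int_def
        flip: W_def)
qed

definition edge_coeff :: "(real^3 \<Rightarrow> real^3) \<Rightarrow> nat \<Rightarrow> nat \<Rightarrow> real" where
  "edge_coeff v s t = seg_int (\<lambda>z. (E0 z *\<^sub>R v z) \<bullet> (x t - x s)) (x s) (x t) / E1 (x s) (x t)"

text \<open>The parameter triangle has area 1/2, so \<open>2 * E2f m\<close> is the mean of the
  weight over the facet.\<close>

definition facet_coeff :: "(real^3 \<Rightarrow> real^3) \<Rightarrow> nat \<Rightarrow> real" where
  "facet_coeff v m =
     orient m * tri_int (\<lambda>z. (E0 z *\<^sub>R v z) \<bullet> W m) (P m 1) (P m 2) (P m 3) / (2 * E2f m)"

lemma interp0_eq: "interp0 x \<epsilon> \<beta> v y = (\<Sum>i\<in>{1..4}. v (x i) * phiV x \<epsilon> \<beta> i y)"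
  using wt_pos by (auto simp: interp0_def dof0_def less_imp_neq[THEN not_sym] intro!: sum.cong)

lemma interp1_eq:
  "interp1 x \<epsilon> \<beta> v y = (\<Sum>i\<in>{1..4}. \<Sum>k\<in>{i<..4}. edge_coeff v i k *\<^sub>R phiE x \<epsilon> \<beta> i k y)"
  unfolding interp1_def
proof (intro sum.cong refl)
  fix s t :: nat assume "s \<in> {1..4}" "t \<in> {s<..4}"
  then have "norm (x t - x s) > 0" using vertices_distinct[of s t] by auto
  then have "edge_integral x s t E0 / edge_length x s t = E1 (x s) (x t)"
    by (simp add: edge_integral_def segment_integral_def edge_length_def seg_int_def)
  then show "(dof1 x s t (\<lambda>z. E0 z *\<^sub>R v z) / (edge_integral x s t E0 / edge_length x s t)) *\<^sub>R phiE x \<epsilon> \<beta> s t y =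
      edge_coeff v s t *\<^sub>R phiE x \<epsilon> \<beta> s t y"
    by (simp only: edge_coeff_def dof1_eq)
qed

lemma interp2_eq:
  "interp2 x \<epsilon> \<beta> v y = (\<Sum>m\<in>{1..4}. facet_coeff v m *\<^sub>R phiF x \<epsilon> \<beta> m y)"
  unfolding interp2_def
proof (intro sum.cong refl)
  fix m :: nat assume m: "m \<in> {1..4}"
  have "norm (W m) > 0" using W_nonzero[OF m] by simp
  then have "facet_integral x m E0 / facet_area x m = 2 * E2f m"
    by (simp add: facet_integral_def triangle_integral_def facet_area_def tri_int_def flip: W_def)
  then show "(dof2 x m (\<lambda>z. E0 z *\<^sub>R v z) / (facet_integral x m E0 / facet_area x m)) *\<^sub>R phiF x \<epsilon> \<beta> m y =
      facet_coeff v m *\<^sub>R phiF x \<epsilon> \<beta> m y"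
    by (simp only: facet_coeff_def dof2_eq[OF m])
qed

section \<open>Duality of the degrees of freedom\<close>

lemma dof0_interp:
  assumes i: "i \<in> {1..4}"
  shows "dof0 x i (\<lambda>y. \<Sum>k\<in>{1..4}. c k * phiV x \<epsilon> \<beta> k y) = c i"
  \<comment> \<open>At \<open>y = x i\<close> the vector \<open>x i - y\<close> is zero, so the
    \<open>i\<close>-th equation involves only \<phi>.\<close>
  using vertex_op_sum[OF vertex_in_tetra[OF i] i, of c] eps wt_pos[of \<epsilon> \<beta> "x i"]
  by (simp add: dof0_def vertex_op_def)

text \<open>On the edge the vectors \<open>x s - y\<close> and \<open>x t - y\<close> are parallel,
  so \<open>j\<close> drops out of the equation for \<open>(s, t)\<close>, which then forces the
  tangential component to be constant.\<close>

lemma dof1_interp: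
  assumes s: "s \<in> {1..4}" and t: "t \<in> {s<..4}"
  shows "dof1 x s t (\<lambda>y. \<Sum>i\<in>{1..4}. \<Sum>k\<in>{i<..4}. c i k *\<^sub>R phiE x \<epsilon> \<beta> i k y) = c s t"
proof -
  have t': "t \<in> {1..4}" using s t by auto
  define j where "j y = (\<Sum>i\<in>{1..4}. \<Sum>k\<in>{i<..4}. c i k *\<^sub>R jE x \<epsilon> \<beta> i k y)" for y
  define f where "f y = (\<Sum>i\<in>{1..4}. \<Sum>k\<in>{i<..4}. c i k *\<^sub>R phiE x \<epsilon> \<beta> i k y)" for y
  have "f (x s + \<kappa> *\<^sub>R (x t - x s)) \<bullet> (x t - x s) = c s t" if \<kappa>: "\<kappa> \<in> {0..1}" for \<kappa>
  proof -
    define y where "y = x s + \<kappa> *\<^sub>R (x t - x s)"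
    define e where "e = x t - x s"
    have y: "y \<in> tetra x" unfolding y_def
      using \<kappa> by (intro convex_mem_affine2 convex_tetra vertex_in_tetra s t') auto
    have ls: "x s - y = - \<kappa> *\<^sub>R e" and lt: "x t - y = (1 - \<kappa>) *\<^sub>R e"
      by (simp_all add: y_def e_def algebra_simps)
    have cross: "(x s - y) \<times> (x t - y) = 0"
      by (simp add: ls lt cross_mult_left cross_mult_right del: scaleR_minus_left)
    \<comment> \<open>Additivity of the weight integral over the segment split at \<open>y\<close>.
      It follows from the recurrence, because the vectors from \<open>y\<close> to the endpoints
      cancel when weighted by \<open>1 - \<kappa>\<close> and \<open>\<kappa>\<close>.\<close>
    have E1: "(1 - \<kappa>) * E1 y (x t) + \<kappa> * E1 y (x s) = E1 (x s) (x t)"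
    proof -
      have e1: "((\<beta> /\<^sub>R \<epsilon>) \<bullet> (x s - y)) * E2 (x s) (x t) y = E1 (x s) (x t) - E1 y (x t)"
        using wt_int_recurrence(1)[where b = "x s" and a = y and c = "x t" and \<epsilon> = \<epsilon> and \<beta> = \<beta>] wt_int_swap(2,3) by metis
      have e2: "((\<beta> /\<^sub>R \<epsilon>) \<bullet> (x t - y)) * E2 (x s) (x t) y = E1 (x s) (x t) - E1 y (x s)"
        using wt_int_recurrence(1)[where b = "x t" and a = y and c = "x s" and \<epsilon> = \<epsilon> and \<beta> = \<beta>] wt_int_swap(1,2,3) by metis
      have "(1 - \<kappa>) * (E1 (x s) (x t) - E1 y (x t)) + \<kappa> * (E1 (x s) (x t) - E1 y (x s)) =
          ((1 - \<kappa>) * ((\<beta> /\<^sub>R \<epsilon>) \<bullet> (x s - y)) + \<kappa> * ((\<beta> /\<^sub>R \<epsilon>) \<bullet> (x t - y))) * E2 (x s) (x t) y"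
        unfolding e1[symmetric] e2[symmetric] by (simp only: distrib_right mult.assoc)
      also have "\<dots> = 0" by (simp add: ls lt)
      finally show ?thesis by (simp add: algebra_simps)
    qed
    have "\<epsilon> * (f y \<bullet> e) * ((1 - \<kappa>) * E1 y (x t) + \<kappa> * E1 y (x s)) = \<epsilon> * E1 (x s) (x t) * c s t"
      using edge_op_sum[OF y s t, of c] unfolding edge_op_def case_prod_conv cross f_def[symmetric]
      by (simp add: ls lt algebra_simps)
    then have "f y \<bullet> e = c s t"
      using eps wt_int_pos(1)[of \<epsilon> \<beta> "x s" "x t"] by (simp add: E1)
    then show ?thesis by (simp only: y_def e_def)
  qed
  then have "seg_int (\<lambda>z. f z \<bullet> (x t - x s)) (x s) (x t) = integral {0..1} (\<lambda>\<kappa>::real. c s t)"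
    unfolding seg_int_def by (intro integral_cong)
  then show ?thesis by (simp add: dof1_eq flip: f_def)
qed

text \<open>On the facet \<open>D y m\<close> vanishes, so the \<open>m\<close>-th equation contains
  neither \<open>j\<close> nor \<theta> and prescribes a constant normal component.\<close>

lemma dof2_interp:
  assumes m: "m \<in> {1..4}"
  shows "dof2 x m (\<lambda>y. \<Sum>i\<in>{1..4}. c i *\<^sub>R phiF x \<epsilon> \<beta> i y) = c m"
proof -
  define f where "f y = (\<Sum>i\<in>{1..4}. c i *\<^sub>R phiF x \<epsilon> \<beta> i y)" for y
  \<comment> \<open>Convex, containing the three vertices of the facet, and inside the plane where
    \<open>D y m\<close> is zero.\<close>
  define K where "K = tetra x \<inter> {z. W m \<bullet> z = W m \<bullet> P m 1}"
  have "f y \<bullet> W m = 2 * orient m * c m" if "y \<in> K" for y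
  proof -
    have y: "y \<in> tetra x" and D: "D y m = 0"
      using that by (auto simp: K_def D_eq inner_diff_right)
    have "\<epsilon> * E2f m * (f y \<bullet> W m) = \<epsilon> * E2f m * (2 * orient m * c m)"
      using facet_op_sum[OF y m, of c]
      by (simp add: facet_op_def D N_eq inner_commute[of _ "W m"] mult_ac flip: f_def)
    moreover have "\<epsilon> * E2f m \<noteq> 0"
      using eps wt_int_pos(2)[of \<epsilon> \<beta> "P m 1" "P m 2" "P m 3"] by simp
    ultimately show ?thesis by (simp only: mult_cancel_left simp_thms)
  qed
  moreover have "convex K" unfolding K_def by (intro convex_Int convex_tetra convex_hyperplane)
  moreover have "P m 1 \<in> K" "P m 2 \<in> K" "P m 3 \<in> K"
  proof -
    have "W m \<bullet> (P m 2 - P m 1) = 0" "W m \<bullet> (P m 3 - P m 1) = 0"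
      by (simp_all add: W_def dot_cross_self inner_commute)
    then show "P m 1 \<in> K" "P m 2 \<in> K" "P m 3 \<in> K"
      using skip_in[OF m] by (auto simp: K_def inner_diff_right intro!: vertex_in_tetra)
  qed
  ultimately have "tri_int (\<lambda>y. f y \<bullet> W m) (P m 1) (P m 2) (P m 3) =
      tri_int (\<lambda>y. 2 * orient m * c m) (P m 1) (P m 2) (P m 3)"
    by (intro tri_int_cong[of K])
  then have "dof2 x m f = orient m * orient m * c m" by (simp add: dof2_eq[OF m] tri_int_const)
  then show ?thesis by (simp add: orient_sq f_def[abs_def])
qed

section \<open>Stokes identities for the weighted fluxes\<close>

lemma edge_coeff_flux0:
  assumes w: "smooth_on (tetra x) w" and s: "s \<in> {1..4}" and t: "t \<in> {1..4}"
  shows "E1 (x s) (x t) * edge_coeff (flux0 x \<epsilon> \<beta> w) s t = \<epsilon> * (E0 (x t) * w (x t) - E0 (x s) * w (x s))"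
proof -
  define w' where "w' z = frechet_derivative w (at z within tetra x)" for z
  \<comment> \<open>The derivative of the weighted function; since \<theta> is \<beta> / \<epsilon>,
    multiplication by \<epsilon> turns it into the weighted flux.\<close>
  define G' where "G' z h = E0 z * w' z h + E0 z * ((\<beta> /\<^sub>R \<epsilon>) \<bullet> h) * w z" for z h
  have w': "(w has_derivative w' z) (at z within tetra x)" if "z \<in> tetra x" for z
    unfolding w'_def using smooth_onD(1)[OF w that] .
  have "((\<lambda>z. E0 z * w z) has_derivative G' z) (at z within tetra x)" if "z \<in> tetra x" for z
    unfolding G'_def using has_derivative_mult[OF wt_has_derivative w'[OF that]] .
  from seg_int_deriv[OF this convex_tetra vertex_in_tetra[OF s] vertex_in_tetra[OF t]]
  have "seg_int (\<lambda>z. G' z (x t - x s)) (x s) (x t) = E0 (x t) * w (x t) - E0 (x s) * w (x s)" .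
  moreover have "seg_int (\<lambda>z. (E0 z *\<^sub>R flux0 x \<epsilon> \<beta> w z) \<bullet> (x t - x s)) (x s) (x t) =
      seg_int (\<lambda>z. \<epsilon> * G' z (x t - x s)) (x s) (x t)"
  proof (rule seg_int_cong[OF convex_tetra vertex_in_tetra[OF s] vertex_in_tetra[OF t]])
    fix z assume "z \<in> tetra x"
    from linear_grad_on[OF has_derivative_linear[OF w'[OF this, unfolded w'_def]]]
    show "(E0 z *\<^sub>R flux0 x \<epsilon> \<beta> w z) \<bullet> (x t - x s) = \<epsilon> * G' z (x t - x s)"
      using eps by (simp add: flux0_def G'_def w'_def inner_add_left field_simps)
  qed
  ultimately show ?thesis
    using wt_int_pos(1)[of \<epsilon> \<beta> "x s" "x t"] by (simp add: edge_coeff_def seg_int_cmult)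
qed

context
  fixes w :: "real^3 \<Rightarrow> real^3"
  assumes w: "smooth_on (tetra x) w"
begin

definition weighted_deriv :: "real^3 \<Rightarrow> real^3 \<Rightarrow> real^3" where
  "weighted_deriv z h = E0 z *\<^sub>R frechet_derivative w (at z within tetra x) h
     + (E0 z * ((\<beta> /\<^sub>R \<epsilon>) \<bullet> h)) *\<^sub>R w z"

lemma linear_frechet: "z \<in> tetra x \<Longrightarrow> linear (frechet_derivative w (at z within tetra x))"
  using smooth_onD(1)[OF w] by (rule has_derivative_linear)

lemma weighted_has_derivative:
  assumes "z \<in> tetra x"
  shows "((\<lambda>z. (E0 z *\<^sub>R w z) \<bullet> v) has_derivative (\<lambda>h. weighted_deriv z h \<bullet> v)) (at z within tetra x)"
  unfolding weighted_deriv_def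
  by (rule has_derivative_inner_left[OF has_derivative_scaleR[OF wt_has_derivative smooth_onD(1)[OF w assms]]])

lemma continuous_on_weighted: "continuous_on (tetra x) (\<lambda>z. (E0 z *\<^sub>R w z) \<bullet> v)"
  by (intro continuous_intros continuous_on_wt smooth_onD(2)[OF w])

lemma continuous_on_weighted_deriv: "continuous_on (tetra x) (\<lambda>z. weighted_deriv z h \<bullet> v)"
  unfolding weighted_deriv_def
  by (intro continuous_intros continuous_on_wt smooth_onD(2,3)[OF w])

text \<open>Stokes on a triangle: each of the two terms of the curl integrates out along its own
  edge direction, and their contributions on the common edge \<open>q r\<close> combine because
  \<open>(r - p) - (q - p) = r - q\<close>.\<close>

lemma facet_coeff_flux1:
  assumes m: "m \<in> {1..4}"
  shows "2 * E2f m * facet_coeff (flux1 x \<epsilon> \<beta> w) m = \<epsilon> * orient m *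
    (E1 (P m 1) (P m 2) * edge_coeff w (skip m 1) (skip m 2)
     + E1 (P m 2) (P m 3) * edge_coeff w (skip m 2) (skip m 3)
     - E1 (P m 1) (P m 3) * edge_coeff w (skip m 1) (skip m 3))"
proof -
  define p q r where "p = P m 1" and "q = P m 2" and "r = P m 3"
  have mem: "p \<in> tetra x" "q \<in> tetra x" "r \<in> tetra x"
    unfolding p_def q_def r_def using skip_in[OF m] by (auto intro!: vertex_in_tetra)
  have Wm: "W m = (q - p) \<times> (r - p)" by (simp add: W_def p_def q_def r_def)
  define A where "A a b = seg_int (\<lambda>z. (E0 z *\<^sub>R w z) \<bullet> (b - a)) a b" for a b
  have "tri_int (\<lambda>z. (E0 z *\<^sub>R flux1 x \<epsilon> \<beta> w z) \<bullet> W m) p q r =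
      tri_int (\<lambda>z. \<epsilon> * (weighted_deriv z (q - p) \<bullet> (r - p) - weighted_deriv z (r - p) \<bullet> (q - p))) p q r"
  proof (rule tri_int_cong[OF convex_tetra mem])
    fix z assume z: "z \<in> tetra x"
    show "(E0 z *\<^sub>R flux1 x \<epsilon> \<beta> w z) \<bullet> W m =
        \<epsilon> * (weighted_deriv z (q - p) \<bullet> (r - p) - weighted_deriv z (r - p) \<bullet> (q - p))"
      unfolding flux1_def Wm inner_scaleR_left inner_add_left curl_cross[OF linear_frechet[OF z]]
        dot_cross weighted_deriv_def
      using eps by (simp add: field_simps del: inner_diff_left inner_diff_right)
  qed
  also have "\<dots> = \<epsilon> * (tri_int (\<lambda>z. weighted_deriv z (q - p) \<bullet> (r - p)) p q r
      - tri_int (\<lambda>z. weighted_deriv z (r - p) \<bullet> (q - p)) p q r)"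
    unfolding tri_int_cmult
    by (subst tri_int_diff[OF convex_tetra continuous_on_weighted_deriv continuous_on_weighted_deriv mem]) simp
  also have "tri_int (\<lambda>z. weighted_deriv z (q - p) \<bullet> (r - p)) p q r =
      seg_int (\<lambda>z. (E0 z *\<^sub>R w z) \<bullet> (r - p)) q r - A p r"
    unfolding A_def by (rule tri_int_deriv[OF weighted_has_derivative convex_tetra mem])
  \<comment> \<open>Exchanging \<open>q\<close> and \<open>r\<close> makes \<open>r - p\<close> the
    direction of the innermost variable.\<close>
  also have "tri_int (\<lambda>z. weighted_deriv z (r - p) \<bullet> (q - p)) p q r =
      tri_int (\<lambda>z. weighted_deriv z (r - p) \<bullet> (q - p)) p r q"
    by (rule tri_int_swap23[OF convex_tetra continuous_on_weighted_deriv mem])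
  also have "\<dots> = seg_int (\<lambda>z. (E0 z *\<^sub>R w z) \<bullet> (q - p)) q r - A p q"
    unfolding A_def seg_int_swap[of _ q r]
    by (rule tri_int_deriv[OF weighted_has_derivative convex_tetra mem(1,3,2)])
  also have "seg_int (\<lambda>z. (E0 z *\<^sub>R w z) \<bullet> (r - p)) q r - A p r
      - (seg_int (\<lambda>z. (E0 z *\<^sub>R w z) \<bullet> (q - p)) q r - A p q) = A p q + A q r - A p r"
  proof -
    have "A q r = seg_int (\<lambda>z. (E0 z *\<^sub>R w z) \<bullet> (r - p) - (E0 z *\<^sub>R w z) \<bullet> (q - p)) q r"
      unfolding A_def by (simp add: inner_diff_right flip: right_diff_distrib)
    also have "\<dots> = seg_int (\<lambda>z. (E0 z *\<^sub>R w z) \<bullet> (r - p)) q r - seg_int (\<lambda>z. (E0 z *\<^sub>R w z) \<bullet> (q - p)) q r"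
      by (rule seg_int_diff[OF convex_tetra continuous_on_weighted continuous_on_weighted mem(2,3)])
    finally show ?thesis by simp
  qed
  finally have "tri_int (\<lambda>z. (E0 z *\<^sub>R flux1 x \<epsilon> \<beta> w z) \<bullet> W m) p q r = \<epsilon> * (A p q + A q r - A p r)" .
  moreover have "A (x a) (x b) = E1 (x a) (x b) * edge_coeff w a b" for a b
    using wt_int_pos(1)[of \<epsilon> \<beta> "x a" "x b"] by (simp add: A_def edge_coeff_def)
  ultimately show ?thesis
    using wt_int_pos(2)[of \<epsilon> \<beta> p q r] by (simp add: facet_coeff_def p_def q_def r_def)
qed

text \<open>The Gauss theorem, one direction at a time: each of three terms yields an integral over
  the facet opposite \<open>x 1\<close> and one over a facet through \<open>x 1\<close>. On the
  former the three cross products add up to \<open>W 1\<close>.\<close>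

lemma tet_int_flux2:
  "D0 * tet_int (\<lambda>z. E0 z * flux2 x \<epsilon> \<beta> w z) (x 1) (x 2) (x 3) (x 4) =
    \<epsilon> * (\<Sum>m\<in>{1..4}. alt m * tri_int (\<lambda>z. (E0 z *\<^sub>R w z) \<bullet> W m) (P m 1) (P m 2) (P m 3))"
proof -
  define u v t where "u = x 2 - x 1" and "v = x 3 - x 1" and "t = x 4 - x 1"
  define T where "T c = tri_int (\<lambda>z. (E0 z *\<^sub>R w z) \<bullet> c)" for c
  have mem: "x 1 \<in> tetra x" "x 2 \<in> tetra x" "x 3 \<in> tetra x" "x 4 \<in> tetra x"
    by (intro vertex_in_tetra; simp)+
  have T_add: "T (c + d) (x 2) (x 3) (x 4) = T c (x 2) (x 3) (x 4) + T d (x 2) (x 3) (x 4)" for c d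
    unfolding T_def inner_add_right
    by (rule tri_int_add[OF convex_tetra continuous_on_weighted continuous_on_weighted mem(2-4)])
  have T_minus: "T (- c) a b d = - T c a b d" for a b c d
    using tri_int_cmult[of "-1" "\<lambda>z. (E0 z *\<^sub>R w z) \<bullet> c"] by (simp add: T_def)
  have T_swap: "T c a b d = T c b a d" "T c (x 2) (x 4) (x 3) = T c (x 2) (x 3) (x 4)" for a b c d
    unfolding T_def
    by (rule tri_int_swap12, rule tri_int_swap23[OF convex_tetra continuous_on_weighted mem(2,4,3)])
  let ?d = "\<lambda>h c z. weighted_deriv z h \<bullet> c"
  have "D0 * tet_int (\<lambda>z. E0 z * flux2 x \<epsilon> \<beta> w z) (x 1) (x 2) (x 3) (x 4) =
      tet_int (\<lambda>z. D0 * (E0 z * flux2 x \<epsilon> \<beta> w z)) (x 1) (x 2) (x 3) (x 4)"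
    by (simp add: tet_int_cmult)
  \<comment> \<open>The factor \<open>D0\<close> lets \<beta> and the divergence be expanded in the
    edge directions without division.\<close>
  also have "\<dots> = tet_int (\<lambda>z. \<epsilon> * (?d u (v \<times> t) z + ?d v (t \<times> u) z + ?d t (u \<times> v) z)) (x 1) (x 2) (x 3) (x 4)"
  proof (rule tet_int_cong[OF convex_tetra mem])
    fix z assume z: "z \<in> tetra x"
    have "D0 * (E0 z * flux2 x \<epsilon> \<beta> w z) =
        E0 z * (\<epsilon> * (D0 * div_on (tetra x) w z) + D0 * (\<beta> \<bullet> w z))"
      by (simp add: flux2_def algebra_simps)
    also have "D0 * (\<beta> \<bullet> w z) = (D0 *\<^sub>R \<beta>) \<bullet> w z" by simp
    also have "D0 *\<^sub>R \<beta> = (\<beta> \<bullet> u) *\<^sub>R (v \<times> t) + (\<beta> \<bullet> v) *\<^sub>R (t \<times> u) + (\<beta> \<bullet> t) *\<^sub>R (u \<times> v)"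
      unfolding D0_def u_def v_def t_def by (rule triple_expansion_dual)
    also have "D0 * div_on (tetra x) w z =
        frechet_derivative w (at z within tetra x) u \<bullet> (v \<times> t)
        + frechet_derivative w (at z within tetra x) v \<bullet> (t \<times> u)
        + frechet_derivative w (at z within tetra x) t \<bullet> (u \<times> v)"
      unfolding D0_def u_def v_def t_def by (rule div_triple[OF linear_frechet[OF z]])
    finally show "D0 * (E0 z * flux2 x \<epsilon> \<beta> w z) =
        \<epsilon> * (?d u (v \<times> t) z + ?d v (t \<times> u) z + ?d t (u \<times> v) z)"
      using eps by (simp add: weighted_deriv_def inner_add_left inner_add_right field_simps
          inner_commute[of "w z"])
  qed
  also have "\<dots> = \<epsilon> * (tet_int (?d u (v \<times> t)) (x 1) (x 2) (x 3) (x 4)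
      + tet_int (?d v (t \<times> u)) (x 1) (x 2) (x 3) (x 4) + tet_int (?d t (u \<times> v)) (x 1) (x 2) (x 3) (x 4))"
    unfolding tet_int_cmult
    by (simp add: tet_int_add[OF convex_tetra _ _ mem] continuous_on_weighted_deriv continuous_on_add)
  \<comment> \<open>The vertices are reordered so that the edge of differentiation belongs to the
    innermost variable.\<close>
  also have "tet_int (?d v (t \<times> u)) (x 1) (x 2) (x 3) (x 4) = tet_int (?d v (t \<times> u)) (x 1) (x 3) (x 2) (x 4)"
    by (rule tet_int_swap23[OF convex_tetra continuous_on_weighted_deriv mem])
  also have "tet_int (?d t (u \<times> v)) (x 1) (x 2) (x 3) (x 4) = tet_int (?d t (u \<times> v)) (x 1) (x 4) (x 2) (x 3)"
    using tet_int_swap34[OF convex_tetra continuous_on_weighted_deriv mem]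
      tet_int_swap23[OF convex_tetra continuous_on_weighted_deriv mem(1,2,4,3)] by simp
  also have "tet_int (?d u (v \<times> t)) (x 1) (x 2) (x 3) (x 4) =
      T (v \<times> t) (x 2) (x 3) (x 4) - T (v \<times> t) (x 1) (x 3) (x 4)"
    unfolding T_def u_def by (rule tet_int_deriv[OF weighted_has_derivative convex_tetra mem])
  also have "tet_int (?d v (t \<times> u)) (x 1) (x 3) (x 2) (x 4) =
      T (t \<times> u) (x 3) (x 2) (x 4) - T (t \<times> u) (x 1) (x 2) (x 4)"
    unfolding T_def v_def by (rule tet_int_deriv[OF weighted_has_derivative convex_tetra mem(1,3,2,4)])
  also have "tet_int (?d t (u \<times> v)) (x 1) (x 4) (x 2) (x 3) =
      T (u \<times> v) (x 4) (x 2) (x 3) - T (u \<times> v) (x 1) (x 2) (x 3)"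
    unfolding T_def t_def by (rule tet_int_deriv[OF weighted_has_derivative convex_tetra mem(1,4,2,3)])
  also have "T (t \<times> u) (x 3) (x 2) (x 4) = T (t \<times> u) (x 2) (x 3) (x 4)" by (rule T_swap)
  also have "T (u \<times> v) (x 4) (x 2) (x 3) = T (u \<times> v) (x 2) (x 3) (x 4)"
    by (subst T_swap(1)) (rule T_swap(2))
  finally have "D0 * tet_int (\<lambda>z. E0 z * flux2 x \<epsilon> \<beta> w z) (x 1) (x 2) (x 3) (x 4) =
      \<epsilon> * (T (v \<times> t + t \<times> u + u \<times> v) (x 2) (x 3) (x 4) - T (v \<times> t) (x 1) (x 3) (x 4)
        - T (t \<times> u) (x 1) (x 2) (x 4) - T (u \<times> v) (x 1) (x 2) (x 3))"
    by (simp add: T_add)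
  \<comment> \<open>\<open>t \<times> u\<close> is minus \<open>W 3\<close>, which accounts for the
    positive sign \<open>alt 3\<close>.\<close>
  also have "T (t \<times> u) (x 1) (x 2) (x 4) = - T (u \<times> t) (x 1) (x 2) (x 4)"
    by (subst cross_skew) (rule T_minus)
  also have "v \<times> t + t \<times> u + u \<times> v = W 1"
    using cross_triangle[of "x 3" "x 2" "x 4" "x 1"]
    by (simp add: W_def skip_simps u_def v_def t_def add_ac)
  finally have "D0 * tet_int (\<lambda>z. E0 z * flux2 x \<epsilon> \<beta> w z) (x 1) (x 2) (x 3) (x 4) =
      \<epsilon> * (T (W 1) (x 2) (x 3) (x 4) - T (v \<times> t) (x 1) (x 3) (x 4)
        - - T (u \<times> t) (x 1) (x 2) (x 4) - T (u \<times> v) (x 1) (x 2) (x 3))" .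
  moreover have "v \<times> t = W 2" "u \<times> t = W 3" "u \<times> v = W 4"
    by (simp_all add: W_def skip_simps u_def v_def t_def)
  ultimately show ?thesis
    unfolding T_def[symmetric] indices by (simp add: alt_simps skip_simps)
qed

end

section \<open>The three commuting diagrams\<close>

lemma commute0:
  assumes w: "smooth_on (tetra x) w" and y: "y \<in> tetra x"
  shows "interp1 x \<epsilon> \<beta> (flux0 x \<epsilon> \<beta> w) y = dflux0 x \<epsilon> \<beta> (interp0 x \<epsilon> \<beta> w) y"
proof -
  let ?c = "edge_coeff (flux0 x \<epsilon> \<beta> w)"
  define j where "j = (\<Sum>i\<in>{1..4}. w (x i) *\<^sub>R jV x \<epsilon> \<beta> i y)"
  define \<phi> where "\<phi> = (\<Sum>i\<in>{1..4}. w (x i) * phiV x \<epsilon> \<beta> i y)"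
  define J where "J = (\<Sum>i\<in>{1..4}. \<Sum>k\<in>{i<..4}. ?c i k *\<^sub>R jE x \<epsilon> \<beta> i k y)"
  have lhs: "dflux0 x \<epsilon> \<beta> (interp0 x \<epsilon> \<beta> w) y = j"
    unfolding dflux0_def interp0_eq[abs_def] j_def
    by (intro sum.cong refl) (simp only: dof0_interp)
  \<comment> \<open>The term with \<phi> is the same at every vertex, so it cancels in the
    difference that forms the edge operator.\<close>
  have V: "E1 y (x s) * (j \<bullet> (x s - y)) = \<epsilon> * E0 (x s) * w (x s) - \<epsilon> * E0 y * \<phi>" if "s \<in> {1..4}" for s
    using vertex_op_sum[OF y that, of "\<lambda>i. w (x i)"]
    by (simp add: vertex_op_def inner_commute[of _ "x s - y"] flip: j_def \<phi>_def)
  have "\<forall>s\<in>{1..4}. \<forall>t\<in>{s<..4}. edge_op y s t (0, j) = \<epsilon> * E1 (x s) (x t) * ?c s t"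
  proof (intro ballI)
    fix s t :: nat assume st: "s \<in> {1..4}" "t \<in> {s<..4}"
    then have t: "t \<in> {1..4}" by auto
    show "edge_op y s t (0, j) = \<epsilon> * E1 (x s) (x t) * ?c s t"
      unfolding edge_op_def case_prod_conv V[OF st(1)] V[OF t] mult.assoc[of \<epsilon> "E1 _ _"]
        edge_coeff_flux0[OF w st(1) t]
      by (simp add: algebra_simps)
  qed
  moreover have "\<forall>s\<in>{1..4}. \<forall>t\<in>{s<..4}.
      edge_op y s t (J, interp1 x \<epsilon> \<beta> (flux0 x \<epsilon> \<beta> w) y) = \<epsilon> * E1 (x s) (x t) * ?c s t"
    unfolding J_def interp1_eq using edge_op_sum[OF y] by blast
  \<comment> \<open>Uniqueness compares both components: the flux part \<open>J\<close> is zero and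
    the interpolated flux equals \<open>j\<close>.\<close>
  ultimately have "(J, interp1 x \<epsilon> \<beta> (flux0 x \<epsilon> \<beta> w) y) = (0, j)"
    using edge_op_unique[OF y, of "\<lambda>s t. \<epsilon> * E1 (x s) (x t) * ?c s t"] by (metis (no_types, lifting))
  then show ?thesis by (simp add: lhs)
qed

lemma commute1:
  assumes w: "smooth_on (tetra x) w" and y: "y \<in> tetra x"
  shows "interp2 x \<epsilon> \<beta> (flux1 x \<epsilon> \<beta> w) y = dflux1 x \<epsilon> \<beta> (interp1 x \<epsilon> \<beta> w) y"
proof -
  let ?c = "facet_coeff (flux1 x \<epsilon> \<beta> w)"
  define j where "j = (\<Sum>i\<in>{1..4}. \<Sum>k\<in>{i<..4}. edge_coeff w i k *\<^sub>R jE x \<epsilon> \<beta> i k y)"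
  define \<phi> where "\<phi> = (\<Sum>i\<in>{1..4}. \<Sum>k\<in>{i<..4}. edge_coeff w i k *\<^sub>R phiE x \<epsilon> \<beta> i k y)"
  define J where "J = (\<Sum>i\<in>{1..4}. ?c i * jF x \<epsilon> \<beta> i y)"
  have lhs: "dflux1 x \<epsilon> \<beta> (interp1 x \<epsilon> \<beta> w) y = j"
    unfolding dflux1_def interp1_eq[abs_def] j_def
    by (intro sum.cong refl) (simp only: dof1_interp)
  have "\<forall>m\<in>{1..4}. facet_op y m (0, j) = 2 * \<epsilon> * orient m * E2f m * ?c m"
  proof (intro ballI)
    fix m :: nat assume m: "m \<in> {1..4}"
    define r where "r = E1 (P m 1) (P m 2) * edge_coeff w (skip m 1) (skip m 2)
       + E1 (P m 2) (P m 3) * edge_coeff w (skip m 2) (skip m 3)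
       - E1 (P m 1) (P m 3) * edge_coeff w (skip m 1) (skip m 3)"
    have e: "edge_op y s t (j, \<phi>) = \<epsilon> * E1 (x s) (x t) * edge_coeff w s t"
      if "s \<in> {1..4}" "t \<in> {s<..4}" for s t
      unfolding j_def \<phi>_def by (rule edge_op_sum[OF y that])
    have "N y m \<bullet> j = \<epsilon> * r"
      unfolding edge_op_cycle[of y m j \<phi>, symmetric] r_def
      unfolding e[OF skip_less(1)[OF m] skip_less(3)[OF m]] e[OF skip_less(2)[OF m] skip_less(4)[OF m]]
        e[OF skip_less(1)[OF m] skip_less(5)[OF m]]
      by (simp add: algebra_simps)
    \<comment> \<open>Inserting the square of \<open>orient m\<close>, which is 1, produces the
      factor that occurs in \<open>facet_coeff_flux1\<close>.\<close>
    then have "facet_op y m (0, j) = \<epsilon> * orient m * (\<epsilon> * orient m * r)"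
      using orient_sq[of m] by (simp add: facet_op_def mult_ac)
    also have "\<epsilon> * orient m * r = 2 * E2f m * ?c m"
      unfolding r_def by (rule facet_coeff_flux1[OF w m, symmetric])
    finally show "facet_op y m (0, j) = 2 * \<epsilon> * orient m * E2f m * ?c m" by simp
  qed
  moreover have "\<forall>m\<in>{1..4}. facet_op y m (J, interp2 x \<epsilon> \<beta> (flux1 x \<epsilon> \<beta> w) y) =
      2 * \<epsilon> * orient m * E2f m * ?c m"
    unfolding J_def interp2_eq using facet_op_sum[OF y] by blast
  ultimately have "(J, interp2 x \<epsilon> \<beta> (flux1 x \<epsilon> \<beta> w) y) = (0, j)"
    using facet_op_unique[OF y, of "\<lambda>m. 2 * \<epsilon> * orient m * E2f m * ?c m"] by (metis (no_types, lifting))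
  then show ?thesis by (simp add: lhs)
qed

lemma commute2:
  assumes w: "smooth_on (tetra x) w" and y: "y \<in> tetra x"
  shows "interp3 x \<epsilon> \<beta> (flux2 x \<epsilon> \<beta> w) y = dflux2 x \<epsilon> \<beta> (interp2 x \<epsilon> \<beta> w) y"
proof -
  define j where "j = (\<Sum>i\<in>{1..4}. facet_coeff w i * jF x \<epsilon> \<beta> i y)"
  define \<phi> where "\<phi> = (\<Sum>i\<in>{1..4}. facet_coeff w i *\<^sub>R phiF x \<epsilon> \<beta> i y)"
  define I where "I = tet_int (\<lambda>z. E0 z * flux2 x \<epsilon> \<beta> w z) (x 1) (x 2) (x 3) (x 4)"
  define e where "e = E3 (x 1) (x 2) (x 3) (x 4)"
  have e: "e > 0" unfolding e_def by (rule wt_int_pos)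
  have rhs: "dflux2 x \<epsilon> \<beta> (interp2 x \<epsilon> \<beta> w) y = j"
    unfolding dflux2_def interp2_eq[abs_def] j_def
    by (intro sum.cong refl) (simp only: dof2_interp)
  have op: "facet_op y m (j, \<phi>) =
      \<epsilon> * tri_int (\<lambda>z. (E0 z *\<^sub>R w z) \<bullet> W m) (P m 1) (P m 2) (P m 3)" if m: "m \<in> {1..4}" for m
  proof -
    have "facet_op y m (j, \<phi>) = 2 * \<epsilon> * orient m * E2f m * facet_coeff w m"
      unfolding j_def \<phi>_def by (rule facet_op_sum[OF y m])
    also have "\<dots> = \<epsilon> * (orient m * orient m) * tri_int (\<lambda>z. (E0 z *\<^sub>R w z) \<bullet> W m) (P m 1) (P m 2) (P m 3)"
      using wt_int_pos(2)[of \<epsilon> \<beta> "P m 1" "P m 2" "P m 3"] by (simp add: facet_coeff_def)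
    finally show ?thesis by (simp only: orient_sq mult_1_right)
  qed
  \<comment> \<open>The alternating sum of the facet equations determines \<open>j\<close> directly,
    with a value that does not depend on \<open>y\<close>.\<close>
  have "D0 * e * j = (\<Sum>m\<in>{1..4}. alt m * facet_op y m (j, \<phi>))"
    unfolding e_def by (rule sum_alt_facet_op[OF y, symmetric])
  also have "\<dots> = \<epsilon> * (\<Sum>m\<in>{1..4}. alt m * tri_int (\<lambda>z. (E0 z *\<^sub>R w z) \<bullet> W m) (P m 1) (P m 2) (P m 3))"
    unfolding sum_distrib_left by (intro sum.cong refl) (simp add: op)
  also have "\<dots> = D0 * I" unfolding I_def by (rule tet_int_flux2[OF w, symmetric])
  finally have j: "j = I / e" using D0_nonzero e by (simp add: field_simps)
  have cont: "continuous_on (tetra x) (\<lambda>z. E0 z * flux2 x \<epsilon> \<beta> w z)"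
    unfolding flux2_def div_on_def trace_def jacobian_def matrix_def
    by (intro continuous_intros continuous_on_wt smooth_onD(2)[OF w])
       (auto intro!: continuous_intros smooth_onD(3)[OF w])
  have vol: "volume (tetra x) > 0"
    using D0_nonzero by (simp add: volume_def tetra_eq measure_tetrahedron D0_def)
  \<comment> \<open>Both this integral and that of the weight carry the absolute value of
    \<open>D0\<close>, and the volume in the mean cancels against \<open>phiT\<close>, so only the
    quotient \<open>I / e\<close> remains.\<close>
  have "dof3 x (\<lambda>z. E0 z * flux2 x \<epsilon> \<beta> w z) = \<bar>D0\<bar> * I"
    using integral_tetrahedron[OF cont[unfolded tetra_eq]] D0_nonzero
    by (simp add: dof3_def tetra_eq D0_def I_def)
  moreover have "integral (tetra x) E0 = \<bar>D0\<bar> * e"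
    using integral_tetrahedron[OF continuous_on_wt] D0_nonzero by (simp add: tetra_eq D0_def e_def)
  ultimately have "interp3 x \<epsilon> \<beta> (flux2 x \<epsilon> \<beta> w) y = I / e"
    using vol D0_nonzero by (simp add: interp3_def phiT_def)
  then show ?thesis by (simp add: rhs j)
qed

end

theorem theorem5p1:
  fixes x :: "nat \<Rightarrow> real^3" and \<epsilon> :: real and \<beta> :: "real^3"
  assumes "nondegenerate x" and "\<epsilon> > 0"
  shows "(\<forall>w :: real^3 \<Rightarrow> real. smooth_on (tetra x) w \<longrightarrow>
            (\<forall>y \<in> tetra x. interp1 x \<epsilon> \<beta> (flux0 x \<epsilon> \<beta> w) y = dflux0 x \<epsilon> \<beta> (interp0 x \<epsilon> \<beta> w) y))
       \<and> (\<forall>w :: real^3 \<Rightarrow> real^3. smooth_on (tetra x) w \<longrightarrow>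
            (\<forall>y \<in> tetra x. interp2 x \<epsilon> \<beta> (flux1 x \<epsilon> \<beta> w) y = dflux1 x \<epsilon> \<beta> (interp1 x \<epsilon> \<beta> w) y))
       \<and> (\<forall>w :: real^3 \<Rightarrow> real^3. smooth_on (tetra x) w \<longrightarrow>
            (\<forall>y \<in> tetra x. interp3 x \<epsilon> \<beta> (flux2 x \<epsilon> \<beta> w) y = dflux2 x \<epsilon> \<beta> (interp2 x \<epsilon> \<beta> w) y))"
proof -
  interpret tetrahedron x \<epsilon> \<beta> using assms by unfold_locales
  show ?thesis using commute0 commute1 commute2 by blast
qed

end
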